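(* Let $y_1,\dots,y_T$ (with compared pairs $(i_t,j_t)$ and covariates) be observations from the piecewise stationary CARE (PS-CARE) model described in the context, with true number of change points $K_0$ and true relative change point locations $\boldsymbol\lambda^0=(\lambda_1^0,\dots,\lambda_{K_0}^0)$, and suppose that Assumptions 1, 2 and 3 of the context hold. Let $$\{\hat K,\hat{\boldsymbol\lambda}_T,\hat{\boldsymbol\xi}_T\}=\operatorname*{arg\,min}_{K\le M,\ \boldsymbol\xi_T\in\Theta_n,\ \boldsymbol\lambda\in A^K_{\epsilon_\lambda}}\ \frac{2}{T}\,\mathrm{MDL}(K,\boldsymbol\lambda,\boldsymbol\xi_T),$$ where $\boldsymbol\xi_T=(\boldsymbol\xi_T^{(1)},\dots,\boldsymbol\xi_T^{(K+1)})$ and $\boldsymbol\xi_T\in\Theta_n$ means that each $\boldsymbol\xi_T^{(k)}\in\Theta_n$. Then, as $T\to\infty$, $$\hat K\stackrel{P}{\longrightarrow}K_0,\qquad \hat{\boldsymbol\lambda}_T\stackrel{P}{\longrightarrow}\boldsymbol\lambda^0 .$$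
   Context: Model. There are $n$ items; item $i$ has covariate vector $\boldsymbol z_i\in\mathbb R^d$. Put $\boldsymbol w_i=(1,\boldsymbol z_i^\top)^\top$, $\boldsymbol W=[\boldsymbol w_1,\dots,\boldsymbol w_n]^\top\in\mathbb R^{n\times(d+1)}$, $\Theta_n=\{(\boldsymbol\alpha,\boldsymbol\beta)\in\mathbb R^n\times\mathbb R^d:\boldsymbol W^\top\boldsymbol\alpha=\boldsymbol 0\}$, and $\tilde{\boldsymbol z}_i=(\boldsymbol e_i^\top,\boldsymbol z_i^\top)^\top\in\mathbb R^{n+d}$, with $\boldsymbol e_i$ the canonical basis of $\mathbb R^n$. Let $\mathcal G=([n],E)$ be a connected graph, $E\subseteq\{(i,j):1\le i<j\le n\}$. At each time $t=1,\dots,T$ a pair $(i_t,j_t)$ is randomly selected from $E$, independently over time; put $\boldsymbol z_t^*=\tilde{\boldsymbol z}_{i_t}-\tilde{\boldsymbol z}_{j_t}$. The outcome $y_t\in\{0,1\}$ ($y_t=1$ if $i_t$ beats $j_t$) satisfies $P(y_t=1)=\exp(\boldsymbol z_t^{*\top}\boldsymbol\xi(t))/(1+\exp(\boldsymbol z_t^{*\top}\boldsymbol\xi(t)))$, independently over time, with $\boldsymbol\xi(t)\in\Theta_n$. There are $K_0$ true change points $\tau_k^0=\lfloor\lambda_k^0T\rfloor$, $0=\lambda_0^0<\lambda_1^0<\dots<\lambda_{K_0}^0<\lambda_{K_0+1}^0=1$, such that $\boldsymbol\xi(t)=\boldsymbol\xi_k^0$ is constant for $\tau_{k-1}^0<t\le\tau_k^0$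 and $\boldsymbol\xi_k^0\ne\boldsymbol\xi_{k+1}^0$. Asymptotics are as $T\to\infty$ with $n,d,\boldsymbol z_i,K_0,\lambda_k^0,\boldsymbol\xi_k^0$ not depending on $T$. Criterion. For $\boldsymbol\lambda=(\lambda_1,\dots,\lambda_K)$ put $\tau_k=\lfloor\lambda_kT\rfloor$, $\lambda_0=0$, $\lambda_{K+1}=1$, $n_k=\tau_k-\tau_{k-1}$, and $$\mathrm{MDL}(K,\boldsymbol\lambda,\boldsymbol\xi_T)=\log(K+1)+(K+1)\log T+\sum_{k=1}^{K+1}\frac{n+d-1}{2}\log n_k+\sum_{k=1}^{K+1}\sum_{t=\tau_{k-1}+1}^{\tau_k}\Big(-y_t\boldsymbol z_t^{*\top}\boldsymbol\xi_T^{(k)}+\log\big(1+\exp(\boldsymbol z_t^{*\top}\boldsymbol\xi_T^{(k)})\big)\Big)\log_2 e .$$ Fix $\epsilon_\lambda>0$ sufficiently small, $\epsilon_\lambda\ll\min_{1\le k\le K_0+1}(\lambda_k^0-\lambda_{k-1}^0)$ (in particular less than this minimum), let $A^K_{\epsilon_\lambda}=\{(\lambda_1,\dots,\lambda_K):0=\lambda_0<\lambda_1<\dots<\lambda_K<\lambda_{K+1}=1,\ \lambda_k-\lambda_{k-1}\ge\epsilon_\lambda,\ k=1,\dots,K+1\}$, and $M=\lceil1/\epsilon_\lambda\rceil+1$. Assumption 1. There is $c_0>0$ with $\|\boldsymbol W(\boldsymbol W^\top\boldsymbol W)^{-1}\boldsymbol W^\top\|_{2,\infty}\le c_0\sqrt{(d+1)/n}$,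 where $\|\cdot\|_{2,\infty}$ is the maximum Euclidean norm of the rows. Assumption 2. With $\boldsymbol\Sigma=\sum_{i>j}(\tilde{\boldsymbol z}_i-\tilde{\boldsymbol z}_j)(\tilde{\boldsymbol z}_i-\tilde{\boldsymbol z}_j)^\top$ there are constants $c_1,c_2>0$ with $c_2n\le\lambda_{\min,\perp}(\boldsymbol\Sigma)\le\|\boldsymbol\Sigma\|_{op}\le c_1n$, where $\lambda_{\min,\perp}(\boldsymbol\Sigma)=\max\{\mu:\boldsymbol u^\top\boldsymbol\Sigma\boldsymbol u\ge\mu\|\boldsymbol u\|_2^2\text{ for all }\boldsymbol u\in\Theta_n\}$. Assumption 3. For each segment $I_k=\{\tau_{k-1}^0+1,\dots,\tau_k^0\}$, let $t_k$ be its number of time points, $L_{g,h,k}$ the number of times items $g,h$ are compared in $I_k$, and $L_{\min,k}=\min_{g,h}L_{g,h,k}$. Then $L_{\min,k}\le c_1n^{c_2}$ for some absolute constants $c_1,c_2>0$; $n L_{\min,k}/t_k>c_p\log n$ for some $c_p>0$; $d+1<n$; and $(d+1)\log n\lesssim nL_{\min,k}/t_k$, where $a\lesssim b$ means $a=O(b)$. *)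

theory Defs
  imports "HOL-Probability.Probability"
begin

text \<open>
  Items are the elements of a finite linearly ordered type \<^typ>\<open>'n\<close>, so \<open>n = CARD('n)\<close>;
  \<open>d = CARD('d)\<close>. A parameter \<open>(\<alpha>, \<beta>)\<close> is a vector indexed by the sum type \<open>'n + 'd\<close>, with
  \<open>\<alpha>\<close> at the indices \<^const>\<open>Inl\<close> and \<open>\<beta>\<close> at the indices \<^const>\<open>Inr\<close>. Likewise the
  \<open>d + 1\<close> columns of \<open>W\<close> are indexed by \<open>unit + 'd\<close>.
\<close>

definition W_mat :: "('n::finite \<Rightarrow> real ^ 'd::finite) \<Rightarrow> real ^ (unit + 'd) ^ 'n" where
  "W_mat z = (\<chi> i c. case c of Inl _ \<Rightarrow> 1 | Inr l \<Rightarrow> z i $ l)"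

definition Theta :: "('n::finite \<Rightarrow> real ^ 'd::finite) \<Rightarrow> (real ^ ('n + 'd)) set" where
  "Theta z = {\<xi>. transpose (W_mat z) *v (\<chi> i. \<xi> $ Inl i) = 0}"

definition z_tilde :: "('n::finite \<Rightarrow> real ^ 'd::finite) \<Rightarrow> 'n \<Rightarrow> real ^ ('n + 'd)" where
  "z_tilde z i = (\<chi> c. case c of Inl j \<Rightarrow> axis i 1 $ j | Inr l \<Rightarrow> z i $ l)"

definition z_star :: "('n::finite \<Rightarrow> real ^ 'd::finite) \<Rightarrow> 'n \<times> 'n \<Rightarrow> real ^ ('n + 'd)" where
  "z_star z e = z_tilde z (fst e) - z_tilde z (snd e)"

definition connected_graph :: "('n \<times> 'n) set \<Rightarrow> bool" where
  "connected_graph E \<longleftrightarrow> (\<forall>i j. (i, j) \<in> (E \<union> E\<inverse>)\<^sup>*)"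


subsection \<open>The observations\<close>

text \<open>
  Joint law of one compared pair and its outcome: the pair is drawn from \<open>q\<close>, and given the
  pair \<open>e\<close> the outcome is Bernoulli with the logistic success probability. The selection law
  \<open>q\<close> is the same at all times; uniform selection is \<open>q = pmf_of_set E\<close>.
\<close>

definition care_pmf ::
    "('n::finite \<Rightarrow> real ^ 'd::finite) \<Rightarrow> ('n \<times> 'n) pmf \<Rightarrow> real ^ ('n + 'd)
      \<Rightarrow> (('n \<times> 'n) \<times> bool) pmf" where
  "care_pmf z q \<xi> =
     bind_pmf q (\<lambda>e. map_pmf (\<lambda>b. (e, b))
       (bernoulli_pmf (exp (z_star z e \<bullet> \<xi>) / (1 + exp (z_star z e \<bullet> \<xi>)))))"

definition cp_time :: "(nat \<Rightarrow> real) \<Rightarrow> nat \<Rightarrow> nat \<Rightarrow> nat" where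
  "cp_time lam T k = nat \<lfloor>lam k * real T\<rfloor>"

text \<open>
  Because the change point times depend on \<open>T\<close>, the data form a triangular array: \<open>pr T t\<close> and
  \<open>y T t\<close>, for \<open>t = 1, \<dots>, T\<close>, live on the probability space \<open>P T\<close>. The functions \<open>lam0\<close> and
  \<open>\<xi>0\<close> are only used at the indices \<open>0, \<dots>, K0 + 1\<close> and \<open>1, \<dots>, K0 + 1\<close>.
\<close>

definition ps_care ::
    "(nat \<Rightarrow> 'w measure) \<Rightarrow> ('n::finite \<Rightarrow> real ^ 'd::finite) \<Rightarrow> ('n \<times> 'n) pmf
      \<Rightarrow> nat \<Rightarrow> (nat \<Rightarrow> real) \<Rightarrow> (nat \<Rightarrow> real ^ ('n + 'd))
      \<Rightarrow> (nat \<Rightarrow> nat \<Rightarrow> 'w \<Rightarrow> 'n \<times> 'n) \<Rightarrow> (nat \<Rightarrow> nat \<Rightarrow> 'w \<Rightarrow> bool) \<Rightarrow> bool" where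
  "ps_care P z q K0 lam0 \<xi>0 pr y \<longleftrightarrow>
     lam0 0 = 0 \<and> lam0 (K0 + 1) = 1 \<and> (\<forall>k\<in>{1..K0 + 1}. lam0 (k - 1) < lam0 k) \<and>
     (\<forall>k\<in>{1..K0 + 1}. \<xi>0 k \<in> Theta z) \<and> (\<forall>k\<in>{1..K0}. \<xi>0 k \<noteq> \<xi>0 (k + 1)) \<and>
     (\<forall>T. prob_space (P T) \<and>
        prob_space.indep_vars (P T) (\<lambda>_. count_space UNIV) (\<lambda>t \<omega>. (pr T t \<omega>, y T t \<omega>)) {1..T} \<and>
        (\<forall>k\<in>{1..K0 + 1}. \<forall>t. cp_time lam0 T (k - 1) < t \<and> t \<le> cp_time lam0 T k \<longrightarrow>
           distr (P T) (count_space UNIV) (\<lambda>\<omega>. (pr T t \<omega>, y T t \<omega>)) =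
             measure_pmf (care_pmf z q (\<xi>0 k))))"


subsection \<open>The criterion\<close>

definition MDL ::
    "('n::finite \<Rightarrow> real ^ 'd::finite) \<Rightarrow> nat \<Rightarrow> (nat \<Rightarrow> 'n \<times> 'n) \<Rightarrow> (nat \<Rightarrow> bool)
      \<Rightarrow> nat \<Rightarrow> (nat \<Rightarrow> real) \<Rightarrow> (nat \<Rightarrow> real ^ ('n + 'd)) \<Rightarrow> real" where
  "MDL z T pr y K lam \<xi> =
     ln (real (K + 1)) + real (K + 1) * ln (real T)
     + (\<Sum>k=1..K + 1. (real CARD('n) + real CARD('d) - 1) / 2
           * ln (real (cp_time lam T k - cp_time lam T (k - 1))))
     + (\<Sum>k=1..K + 1. \<Sum>t=cp_time lam T (k - 1) + 1..cp_time lam T k.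
           (- of_bool (y t) * (z_star z (pr t) \<bullet> \<xi> k) + ln (1 + exp (z_star z (pr t) \<bullet> \<xi> k))))
       * log 2 (exp 1)"

definition A_set :: "real \<Rightarrow> nat \<Rightarrow> (nat \<Rightarrow> real) set" where
  "A_set \<epsilon> K = {lam. lam 0 = 0 \<and> lam (K + 1) = 1 \<and>
     (\<forall>k\<in>{1..K + 1}. lam (k - 1) < lam k \<and> lam k - lam (k - 1) \<ge> \<epsilon>)}"

definition mdl_minimizer ::
    "('n::finite \<Rightarrow> real ^ 'd::finite) \<Rightarrow> real \<Rightarrow> nat \<Rightarrow> (nat \<Rightarrow> 'n \<times> 'n) \<Rightarrow> (nat \<Rightarrow> bool)
      \<Rightarrow> nat \<times> (nat \<Rightarrow> real) \<times> (nat \<Rightarrow> real ^ ('n + 'd)) \<Rightarrow> bool" where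
  "mdl_minimizer z \<epsilon> T pr y =
     is_arg_min (\<lambda>(K, lam, \<xi>). 2 / real T * MDL z T pr y K lam \<xi>)
       (\<lambda>(K, lam, \<xi>). K \<le> nat \<lceil>1 / \<epsilon>\<rceil> + 1 \<and> lam \<in> A_set \<epsilon> K \<and> (\<forall>k\<in>{1..K + 1}. \<xi> k \<in> Theta z))"

text \<open>
  For finite \<open>T\<close> the logistic likelihood of a segment may have no maximizer (separated data), so
  a minimizer of the criterion need not exist. The estimator is a minimizer whenever there is one,
  and arbitrary otherwise; it is also arbitrary which minimizer is chosen.
\<close>

definition mdl_estimator ::
    "(nat \<Rightarrow> 'w measure) \<Rightarrow> ('n::finite \<Rightarrow> real ^ 'd::finite) \<Rightarrow> real
      \<Rightarrow> (nat \<Rightarrow> nat \<Rightarrow> 'w \<Rightarrow> 'n \<times> 'n) \<Rightarrow> (nat \<Rightarrow> nat \<Rightarrow> 'w \<Rightarrow> bool)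
      \<Rightarrow> (nat \<Rightarrow> 'w \<Rightarrow> nat) \<Rightarrow> (nat \<Rightarrow> 'w \<Rightarrow> nat \<Rightarrow> real)
      \<Rightarrow> (nat \<Rightarrow> 'w \<Rightarrow> nat \<Rightarrow> real ^ ('n + 'd)) \<Rightarrow> bool" where
  "mdl_estimator P z \<epsilon> pr y Kh lamh \<xi>h \<longleftrightarrow>
     (\<forall>T. Kh T \<in> measurable (P T) (count_space UNIV) \<and>
        (\<forall>k. (\<lambda>\<omega>. lamh T \<omega> k) \<in> borel_measurable (P T)) \<and>
        (\<forall>\<omega>\<in>space (P T).
           (\<exists>m. mdl_minimizer z \<epsilon> T (\<lambda>t. pr T t \<omega>) (\<lambda>t. y T t \<omega>) m) \<longrightarrow>
           mdl_minimizer z \<epsilon> T (\<lambda>t. pr T t \<omega>) (\<lambda>t. y T t \<omega>) (Kh T \<omega>, lamh T \<omega>, \<xi>h T \<omega>)))"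


subsection \<open>The assumptions\<close>

definition norm_2_inf :: "real ^ 'm ^ 'n \<Rightarrow> real" where
  "norm_2_inf A = Max (range (\<lambda>i. norm (A $ i)))"

definition assumption1 :: "('n::finite \<Rightarrow> real ^ 'd::finite) \<Rightarrow> bool" where
  "assumption1 z \<longleftrightarrow>
     (let W = W_mat z in
       invertible (transpose W ** W) \<and>
       (\<exists>c0>0. norm_2_inf (W ** matrix_inv (transpose W ** W) ** transpose W)
          \<le> c0 * sqrt ((real CARD('d) + 1) / real CARD('n))))"

definition Sigma_mat ::
    "('n::{finite,linorder} \<Rightarrow> real ^ 'd::finite) \<Rightarrow> real ^ ('n + 'd) ^ ('n + 'd)" where
  "Sigma_mat z = (\<Sum>(i, j)\<in>{(i, j). i > j}.
     (\<chi> r c. (z_tilde z i - z_tilde z j) $ r * (z_tilde z i - z_tilde z j) $ c))"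

text \<open>The supremum is attained as soon as \<^term>\<open>Theta z\<close> contains a nonzero vector.\<close>

definition lambda_min_perp :: "('n::{finite,linorder} \<Rightarrow> real ^ 'd::finite) \<Rightarrow> real" where
  "lambda_min_perp z = Sup {\<mu>. \<forall>u\<in>Theta z. u \<bullet> (Sigma_mat z *v u) \<ge> \<mu> * (norm u)\<^sup>2}"

definition assumption2 :: "('n::{finite,linorder} \<Rightarrow> real ^ 'd::finite) \<Rightarrow> bool" where
  "assumption2 z \<longleftrightarrow>
     (\<exists>c1>0. \<exists>c2>0. c2 * real CARD('n) \<le> lambda_min_perp z \<and>
        lambda_min_perp z \<le> onorm ((*v) (Sigma_mat z)) \<and>
        onorm ((*v) (Sigma_mat z)) \<le> c1 * real CARD('n))"

text \<open>Smallest number of comparisons, over the edges, at the times \<open>s < t \<le> s'\<close>.\<close>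

definition L_min :: "('n \<times> 'n) set \<Rightarrow> (nat \<Rightarrow> 'n \<times> 'n) \<Rightarrow> nat \<Rightarrow> nat \<Rightarrow> nat" where
  "L_min E pr s s' = Min ((\<lambda>e. card {t \<in> {s<..s'}. pr t = e}) ` E)"

text \<open>
  The comparison counts are random, so their bounds are required with probability tending to one.
  The number of items is fixed while \<open>T \<rightarrow> \<infinity>\<close>, and \<open>L_min\<close> grows linearly in \<open>T\<close> by the second
  bound, so the constants \<open>c1\<close>, \<open>c2\<close> of the first bound have to be allowed to vary with \<open>T\<close>: with
  constants uniform in \<open>T\<close> the first two bounds would contradict each other.
\<close>

definition assumption3 ::
    "(nat \<Rightarrow> 'w measure) \<Rightarrow> ('n::finite \<Rightarrow> real ^ 'd::finite) \<Rightarrow> ('n \<times> 'n) set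
      \<Rightarrow> nat \<Rightarrow> (nat \<Rightarrow> real) \<Rightarrow> (nat \<Rightarrow> nat \<Rightarrow> 'w \<Rightarrow> 'n \<times> 'n) \<Rightarrow> bool" where
  "assumption3 P z E K0 lam0 pr \<longleftrightarrow>
     CARD('d) + 1 < CARD('n) \<and>
     (\<exists>c1 c2 :: nat \<Rightarrow> real. \<exists>cp>0. \<exists>C>0. (\<forall>T. c1 T > 0 \<and> c2 T > 0) \<and>
        (\<lambda>T. measure (P T) {\<omega> \<in> space (P T). \<forall>k\<in>{1..K0 + 1}.
             let s = cp_time lam0 T (k - 1); s' = cp_time lam0 T k;
                 n = real CARD('n); L = real (L_min E (\<lambda>t. pr T t \<omega>) s s'); tk = real (s' - s)
             in L \<le> c1 T * n powr c2 T \<and>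
                n * L / tk > cp * ln n \<and>
                (real CARD('d) + 1) * ln n \<le> C * (n * L / tk)}) \<longlonglongrightarrow> 1)"


subsection \<open>Convergence in probability to a constant\<close>

definition tendsto_in_prob ::
    "(nat \<Rightarrow> 'w measure) \<Rightarrow> (nat \<Rightarrow> 'w \<Rightarrow> 'a::metric_space) \<Rightarrow> 'a \<Rightarrow> bool" where
  "tendsto_in_prob P X c \<longleftrightarrow>
     (\<forall>\<delta>>0. (\<lambda>T. measure (P T) {\<omega> \<in> space (P T). dist (X T \<omega>) c > \<delta>}) \<longlonglongrightarrow> 0)"

text \<open>
  The vector \<open>(lamh 1, \<dots>, lamh Kh)\<close> has random length; vectors of different lengths are not
  regarded as close, at any tolerance.
\<close>

definition cp_tendsto_in_prob ::
    "(nat \<Rightarrow> 'w measure) \<Rightarrow> (nat \<Rightarrow> 'w \<Rightarrow> nat) \<Rightarrow> (nat \<Rightarrow> 'w \<Rightarrow> nat \<Rightarrow> real)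
      \<Rightarrow> nat \<Rightarrow> (nat \<Rightarrow> real) \<Rightarrow> bool" where
  "cp_tendsto_in_prob P Kh lamh K0 lam0 \<longleftrightarrow>
     (\<forall>\<delta>>0. (\<lambda>T. measure (P T) {\<omega> \<in> space (P T).
        Kh T \<omega> \<noteq> K0 \<or> L2_set (\<lambda>k. lamh T \<omega> k - lam0 k) {1..K0} > \<delta>}) \<longlonglongrightarrow> 0)"

end

theory Submission
  imports Defs "HOL-Real_Asymp.Real_Asymp"
begin

text \<open>
  Measure the distance of parameters by \<open>\<parallel>v\<parallel> = (\<Sum>e\<in>E. \<bar>z_star z e \<bullet> v\<bar>)\<close>, a norm on \<^term>\<open>Theta z\<close>.
  On \<open>m\<close> times of a true regime with parameter \<open>\<xi>0\<close>, the excess loss of \<open>\<xi>\<close> over \<open>\<xi>0\<close> is at least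
  \<open>m \<kappa> \<phi>(w) - 4 r w\<close>, where \<open>w = \<parallel>\<xi> - \<xi>0\<parallel>\<close>, \<open>\<phi>(w) = min w\<^sup>2 w\<close> and \<open>r\<close> bounds the deviations of the
  empirical counts up to any time. With probability tending to one, \<open>r\<^sup>2 \<le> T sqrt (log T)\<close> by
  Kolmogorov's maximal inequality, and by Hoeffding's inequality the deviation over \<open>m\<close> times that
  start or end at a true change point is at most \<open>c m + sqrt (log T)\<close> with a small constant \<open>c\<close>.

  Every fitted segment contains a piece of a true regime of length proportional to \<open>T\<close>. If a true
  change point is missed, some segment contains such pieces of two adjacent regimes and cannot fit
  both, which costs a multiple of \<open>T\<close>, far more than the penalty. In any case the total gain in
  likelihood is \<open>O(sqrt (log T))\<close>: on long pieces by completing the square, and on short pieces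
  because of the drift. This is less than the penalty \<open>log T\<close> of a superfluous change point. The
  bounds also make the losses coercive, so that a minimizer exists.
\<close>

subsection \<open>Maximal and concentration inequalities\<close>

text \<open>The scale sqrt (log T) is a compromise. The maximal inequality needs
  \<open>T / r^2\<close> to vanish, whereas \<open>r^2 / T\<close>, the order of what overfitting
  gains on a long piece, must stay below the log T charged for one more change point. Any divergent
  rate of smaller order than log T would serve. The obstacle is a fitted change point near a true
  one but not on it. It leaves a piece of unknown, possibly tiny length under a wrong parameter, and
  there the uniform bound \<open>r\<close>, which exceeds sqrt T, would swamp the penalty. Since
  fitted segments are long, such a piece has a true change point as one of its ends. Deviations
  measured from these \<open>K0\<close> fixed base points have geometric tails in the distance,
  whence the affine bound. The parameter set is unbounded and the logistic loss grows only linearly.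
  Therefore every noise bound is kept proportional to \<open>w\<close>, so that the drift also beats
  it for large \<open>w\<close> and no compactness of the parameter set has to be assumed.\<close>

primrec stopped_sum :: "real \<Rightarrow> nat \<Rightarrow> (nat \<Rightarrow> real) \<Rightarrow> real" where
  "stopped_sum x 0 g = 0"
| "stopped_sum x (Suc s) g =
     (if \<bar>stopped_sum x s g\<bar> \<ge> x then stopped_sum x s g else stopped_sum x s g + g (Suc s))"

lemma stopped_sum_cong:
  "(\<And>i. i \<in> {1..s} \<Longrightarrow> g i = h i) \<Longrightarrow> stopped_sum x s g = stopped_sum x s h"
proof (induction s)
  case (Suc s)
  have "stopped_sum x s g = stopped_sum x s h" "g (Suc s) = h (Suc s)"
    using Suc.prems by (auto intro!: Suc.IH)
  then show ?case by simp
qed simp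

text \<open>As a function of the path, the stopped sum reads only the coordinates
  \<open>1..s\<close>. With \<open>I = {1..s}\<close> this yields independence of the next
  summand.\<close>

lemma stopped_sum_measurable:
  "{1..s} \<subseteq> I \<Longrightarrow> stopped_sum x s \<in> borel_measurable (PiM I (\<lambda>_. borel))"
proof (induction s)
  case (Suc s)
  have [measurable]: "stopped_sum x s \<in> borel_measurable (PiM I (\<lambda>_. borel))"
    using Suc.prems by (intro Suc.IH) auto
  have [measurable]: "(\<lambda>g. g (Suc s)) \<in> borel_measurable (PiM I (\<lambda>_. borel))"
    using Suc.prems by (intro measurable_component_singleton) auto
  show ?case unfolding stopped_sum.simps(2)[abs_def] by measurable
qed (simp add: stopped_sum.simps(1)[abs_def])

lemma stopped_sum_before:
  "(\<And>i. i < s \<Longrightarrow> \<bar>\<Sum>j=1..i. g j\<bar> < x) \<Longrightarrow> stopped_sum x s g = (\<Sum>j=1..s. g j)"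
proof (induction s)
  case (Suc s)
  have "stopped_sum x s g = (\<Sum>j=1..s. g j)"
    using Suc.prems by (intro Suc.IH) simp
  moreover have "\<bar>\<Sum>j=1..s. g j\<bar> < x"
    using Suc.prems by simp
  ultimately show ?case by simp
qed simp

lemma stopped_sum_after:
  assumes "s \<le> n" "\<bar>stopped_sum x s g\<bar> \<ge> x"
  shows "\<bar>stopped_sum x n g\<bar> \<ge> x"
  using assms by (induction n rule: dec_induct) auto

text \<open>Up to the first index at which the partial sum reaches the level nothing has been
  stopped, so both sums agree there; from then on the stopped sum is frozen.\<close>

lemma stopped_sum_hits:
  assumes "s \<le> n" "\<bar>\<Sum>j=1..s. g j\<bar> \<ge> x"
  shows "\<bar>stopped_sum x n g\<bar> \<ge> x"
proof -
  define s0 where "s0 = (LEAST s. \<bar>\<Sum>j=1..s. g j\<bar> \<ge> x)"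
  have s0: "\<bar>\<Sum>j=1..s0. g j\<bar> \<ge> x" "s0 \<le> s"
    unfolding s0_def by (fact LeastI[of "\<lambda>s. \<bar>\<Sum>j=1..s. g j\<bar> \<ge> x", OF assms(2)])
      (fact Least_le[of "\<lambda>s. \<bar>\<Sum>j=1..s. g j\<bar> \<ge> x", OF assms(2)])
  have "\<bar>\<Sum>j=1..i. g j\<bar> < x" if "i < s0" for i
    using not_less_Least[of i "\<lambda>s. \<bar>\<Sum>j=1..s. g j\<bar> \<ge> x"] that unfolding s0_def by simp
  then have "stopped_sum x s0 g = (\<Sum>j=1..s0. g j)"
    by (rule stopped_sum_before)
  then show ?thesis
    using stopped_sum_after[of s0 n x g] s0 assms(1) by linarith
qed

text \<open>Crude, but it serves only integrability.\<close>

lemma stopped_sum_bound: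
  "(\<And>i. i \<in> {1..s} \<Longrightarrow> \<bar>g i\<bar> \<le> 1) \<Longrightarrow> \<bar>stopped_sum x s g\<bar> \<le> real s"
proof (induction s)
  case (Suc s)
  have "\<bar>stopped_sum x s g\<bar> \<le> real s" "\<bar>g (Suc s)\<bar> \<le> 1"
    using Suc.prems by (auto intro!: Suc.IH)
  then show ?case using abs_triangle_ineq[of "stopped_sum x s g" "g (Suc s)"] by auto
qed simp

text \<open>
  With \<open>Y\<^sub>s\<close> the stopped sums and \<open>V\<^sub>s = Y\<^sub>s 1{|Y\<^sub>s| < x}\<close> we have
  \<open>Y\<^sub>s\<^sub>+\<^sub>1\<^sup>2 \<le> Y\<^sub>s\<^sup>2 + 2 V\<^sub>s X\<^sub>s\<^sub>+\<^sub>1 + X\<^sub>s\<^sub>+\<^sub>1\<^sup>2\<close>, where the middle term has mean zero by independence.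
\<close>

lemma (in prob_space) kolmogorov_maximal_ineq:
  fixes X :: "nat \<Rightarrow> 'a \<Rightarrow> real"
  assumes indep: "indep_vars (\<lambda>_. borel) X {1..n}"
    and bnd: "\<And>i \<omega>. i \<in> {1..n} \<Longrightarrow> \<omega> \<in> space M \<Longrightarrow> \<bar>X i \<omega>\<bar> \<le> 1"
    and mean: "\<And>i. i \<in> {1..n} \<Longrightarrow> expectation (X i) = 0"
    and x: "x > 0"
  shows "prob {\<omega> \<in> space M. \<exists>s\<le>n. \<bar>\<Sum>i=1..s. X i \<omega>\<bar> \<ge> x} \<le> real n / x\<^sup>2"
proof -
  define Y where "Y s \<omega> = stopped_sum x s (\<lambda>i. X i \<omega>)" for s \<omega>
  define V where "V s \<omega> = (if \<bar>Y s \<omega>\<bar> \<ge> x then 0 else Y s \<omega>)" for s \<omega>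
  have X_meas: "X i \<in> borel_measurable M" if "i \<in> {1..n}" for i
    using indep that by (auto simp: indep_vars_def)
  have Y_restrict: "Y s \<omega> = stopped_sum x s (restrict (\<lambda>i. X i \<omega>) {1..s})" for s \<omega>
    unfolding Y_def by (rule stopped_sum_cong) simp
  have Y_meas: "Y s \<in> borel_measurable M" if "s \<le> n" for s
  proof -
    have "(\<lambda>\<omega>. restrict (\<lambda>i. X i \<omega>) {1..s}) \<in> M \<rightarrow>\<^sub>M PiM {1..s} (\<lambda>_. borel)"
      using that by (intro measurable_restrict X_meas) auto
    from measurable_compose[OF this stopped_sum_measurable[OF order_refl]] show ?thesis
      unfolding Y_restrict[abs_def] .
  qed
  have Y_bnd: "\<bar>Y s \<omega>\<bar> \<le> real n" if "s \<le> n" "\<omega> \<in> space M" for s \<omega>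
    unfolding Y_def using stopped_sum_bound[of s "\<lambda>i. X i \<omega>" x] bnd that by fastforce
  have Y2_int: "integrable M (\<lambda>\<omega>. (Y s \<omega>)\<^sup>2)" if "s \<le> n" for s
  proof (rule integrable_const_bound[where B="(real n)\<^sup>2"])
    show "AE \<omega> in M. norm ((Y s \<omega>)\<^sup>2) \<le> (real n)\<^sup>2"
      using Y_bnd[OF that] by (intro AE_I2) (auto simp flip: abs_le_square_iff)
    show "(\<lambda>\<omega>. (Y s \<omega>)\<^sup>2) \<in> borel_measurable M"
      using Y_meas[OF that] by measurable
  qed
  have step: "expectation (\<lambda>\<omega>. (Y s \<omega>)\<^sup>2) \<le> real s" if "s \<le> n" for s
    using that
  proof (induction s)
    case 0
    show ?case by (simp add: Y_def)
  next
    case (Suc s)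
    have s: "Suc s \<in> {1..n}" "s \<le> n" using Suc.prems by auto
    have V_meas: "V s \<in> borel_measurable M"
      using Y_meas[OF s(2)] unfolding V_def by measurable
    have X_int: "integrable M (X (Suc s))"
      using bnd[OF s(1)] X_meas[OF s(1)] by (intro integrable_const_bound[where B=1]) auto
    have X2_int: "integrable M (\<lambda>\<omega>. (X (Suc s) \<omega>)\<^sup>2)"
    proof (rule integrable_const_bound[where B=1])
      show "AE \<omega> in M. norm ((X (Suc s) \<omega>)\<^sup>2) \<le> 1"
        using bnd[OF s(1)] by (intro AE_I2) (simp add: abs_square_le_1)
    qed (use X_meas[OF s(1)] in measurable)
    have V_int: "integrable M (V s)"
      using Y_bnd[OF s(2)] V_meas
      by (intro integrable_const_bound[where B="real n"]) (auto simp: V_def)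
    let ?f = "\<lambda>g. if \<bar>stopped_sum x s g\<bar> \<ge> x then 0 else stopped_sum x s g"
    have f_meas: "?f \<in> borel_measurable (PiM {1..s} (\<lambda>_. borel))"
      using stopped_sum_measurable[OF order_refl, where s=s and x=x] by measurable
    \<comment> \<open>The two factors are functions of disjoint blocks of coordinates,
      \<open>{1..s}\<close> and \<open>{Suc s}\<close>.\<close>
    have "indep_var borel (?f \<circ> (\<lambda>\<omega>. restrict (\<lambda>i. X i \<omega>) {1..s}))
        borel ((\<lambda>g. g (Suc s)) \<circ> (\<lambda>\<omega>. restrict (\<lambda>i. X i \<omega>) {Suc s}))"
      using s by (intro indep_var_compose[OF indep_var_restrict[OF indep]] f_meas) auto
    also have "?f \<circ> (\<lambda>\<omega>. restrict (\<lambda>i. X i \<omega>) {1..s}) = V s"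
      by (simp add: fun_eq_iff V_def Y_restrict)
    also have "(\<lambda>g. g (Suc s)) \<circ> (\<lambda>\<omega>. restrict (\<lambda>i. X i \<omega>) {Suc s}) = X (Suc s)"
      by (simp add: fun_eq_iff)
    finally have ind: "indep_var borel (V s) borel (X (Suc s))" .
    have VX: "expectation (\<lambda>\<omega>. V s \<omega> * X (Suc s) \<omega>) = 0"
      using indep_var_lebesgue_integral[OF ind V_int X_int] mean[OF s(1)] by simp
    note VX_int = indep_var_integrable[OF ind V_int X_int]
    have "expectation (\<lambda>\<omega>. (Y (Suc s) \<omega>)\<^sup>2)
        \<le> expectation (\<lambda>\<omega>. (Y s \<omega>)\<^sup>2 + 2 * (V s \<omega> * X (Suc s) \<omega>) + (X (Suc s) \<omega>)\<^sup>2)"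
    proof (rule integral_mono)
      show "integrable M (\<lambda>\<omega>. (Y s \<omega>)\<^sup>2 + 2 * (V s \<omega> * X (Suc s) \<omega>) + (X (Suc s) \<omega>)\<^sup>2)"
        using Y2_int[OF s(2)] VX_int X2_int by simp
      \<comment> \<open>An equality while the sum is running; once it is stopped, \<open>V s\<close>
        is 0 and \<open>Y\<close> no longer moves.\<close>
      show "(Y (Suc s) \<omega>)\<^sup>2 \<le> (Y s \<omega>)\<^sup>2 + 2 * (V s \<omega> * X (Suc s) \<omega>) + (X (Suc s) \<omega>)\<^sup>2" for \<omega>
        by (simp add: Y_def V_def power2_sum)
    qed (rule Y2_int[OF Suc.prems])
    also have "\<dots> = expectation (\<lambda>\<omega>. (Y s \<omega>)\<^sup>2) + expectation (\<lambda>\<omega>. (X (Suc s) \<omega>)\<^sup>2)"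
      using Y2_int[OF s(2)] VX_int X2_int VX by simp
    also have "expectation (\<lambda>\<omega>. (X (Suc s) \<omega>)\<^sup>2) \<le> expectation (\<lambda>_. 1)"
      using bnd[OF s(1)] X2_int by (intro integral_mono) (auto simp: abs_square_le_1)
    finally show ?case
      using Suc.IH s(2) by (simp add: prob_space)
  qed
  have "prob {\<omega> \<in> space M. \<exists>s\<le>n. \<bar>\<Sum>i=1..s. X i \<omega>\<bar> \<ge> x} \<le> prob {\<omega> \<in> space M. x\<^sup>2 \<le> (Y n \<omega>)\<^sup>2}"
  proof (rule finite_measure_mono)
    show "{\<omega> \<in> space M. \<exists>s\<le>n. \<bar>\<Sum>i=1..s. X i \<omega>\<bar> \<ge> x} \<subseteq> {\<omega> \<in> space M. x\<^sup>2 \<le> (Y n \<omega>)\<^sup>2}"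
    proof safe
      fix \<omega> s assume "s \<le> n" "x \<le> \<bar>\<Sum>i=1..s. X i \<omega>\<bar>"
      then have "\<bar>x\<bar> \<le> \<bar>Y n \<omega>\<bar>"
        using stopped_sum_hits[of s n x "\<lambda>i. X i \<omega>"] x by (simp add: Y_def)
      then show "x\<^sup>2 \<le> (Y n \<omega>)\<^sup>2" by (simp only: abs_le_square_iff)
    qed
    show "{\<omega> \<in> space M. x\<^sup>2 \<le> (Y n \<omega>)\<^sup>2} \<in> events"
      using Y_meas[of n] by measurable
  qed
  also have "\<dots> \<le> expectation (\<lambda>\<omega>. (Y n \<omega>)\<^sup>2) / x\<^sup>2"
    using x by (intro integral_Markov_inequality_measure[OF Y2_int, where A="{}"]) auto
  also have "\<dots> \<le> real n / x\<^sup>2"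
    using step[of n] by (intro divide_right_mono) auto
  finally show ?thesis .
qed

text \<open>The bound is written as a power of a fixed number, so that a union bound over windows of
  growing length becomes a geometric series. \<open>J\<close> is nonempty because the exponent in
  Hoeffding's inequality divides by the number of summands.\<close>

lemma (in prob_space) hoeffding_unit_interval:
  fixes X :: "nat \<Rightarrow> 'a \<Rightarrow> real"
  assumes indep: "indep_vars (\<lambda>_. borel) X J" and fin: "finite J" and ne: "J \<noteq> {}"
    and bnd: "\<And>i \<omega>. i \<in> J \<Longrightarrow> \<omega> \<in> space M \<Longrightarrow> X i \<omega> \<in> {0..1}"
    and c: "c > 0"
  shows "prob {\<omega> \<in> space M. \<bar>\<Sum>i\<in>J. (X i \<omega> - expectation (X i))\<bar> \<ge> c * real (card J)}
           \<le> 2 * exp (- 2 * c\<^sup>2) ^ card J"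
proof -
  interpret Hoeffding_ineq M J X "\<lambda>_. 0" "\<lambda>_. 1" "\<Sum>i\<in>J. expectation (X i)"
    using bnd by unfold_locales (auto simp: fin indep)
  have pos: "card J > 0" using fin ne by (simp add: card_gt_0_iff)
  have "prob {\<omega> \<in> space M. \<bar>(\<Sum>i\<in>J. X i \<omega>) - (\<Sum>i\<in>J. expectation (X i))\<bar> \<ge> c * real (card J)}
      \<le> 2 * exp (- 2 * (c * real (card J))\<^sup>2 / (\<Sum>i\<in>J. (1 - 0)\<^sup>2))"
    using c pos by (intro Hoeffding_ineq_abs_ge) auto
  also have "- 2 * (c * real (card J))\<^sup>2 / (\<Sum>i\<in>J. (1 - 0)\<^sup>2) = real (card J) * (- 2 * c\<^sup>2)"
    using pos by (simp add: power2_eq_square)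
  finally show ?thesis
    by (simp only: sum_subtractf exp_of_nat_mult)
qed


subsection \<open>The logistic loss\<close>

text \<open>Quadratic near 0, like any smooth strictly convex loss near its minimum, and linear at
  infinity, which is the true growth of the logistic loss.\<close>

definition phi :: "real \<Rightarrow> real" where
  "phi w = min (w\<^sup>2) w"

lemma phi_nonneg: "w \<ge> 0 \<Longrightarrow> phi w \<ge> 0"
  by (simp add: phi_def)

lemma phi_mono: "0 \<le> v \<Longrightarrow> v \<le> w \<Longrightarrow> phi v \<le> phi w"
  unfolding phi_def by (intro min.mono power_mono) auto

text \<open>Turns a separation by \<open>\<delta>\<close> into a drift proportional to
  \<open>w\<close>, which can be compared directly with noise proportional to
  \<open>w\<close>.\<close>

lemma phi_ge_linear: "0 \<le> \<delta> \<Longrightarrow> \<delta> \<le> w \<Longrightarrow> phi w \<ge> min \<delta> 1 * w"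
  by (cases "w \<le> 1") (auto simp: phi_def power2_eq_square min_def intro: mult_right_mono mult_left_le_one_le)

lemma phi_divide:
  assumes "w \<ge> 0" "c \<ge> 1"
  shows "phi (w / c) \<ge> phi w / c\<^sup>2"
proof -
  have "w / c\<^sup>2 \<le> w / c"
    using assms by (intro divide_left_mono) (auto simp: power2_eq_square)
  then have "min (w\<^sup>2) w / c\<^sup>2 \<le> w / c"
    by (meson divide_right_mono min.cobounded2 order_trans zero_le_power2)
  then show ?thesis
    by (simp add: phi_def power_divide divide_right_mono)
qed

lemma phi_sum:
  assumes "finite E" "E \<noteq> {}" "\<And>e. e \<in> E \<Longrightarrow> u e \<ge> 0"
  shows "(\<Sum>e\<in>E. phi (u e)) \<ge> phi (\<Sum>e\<in>E. u e) / (real (card E))\<^sup>2"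
proof -
  have N: "real (card E) \<ge> 1"
    using assms by (simp add: Suc_le_eq card_gt_0_iff)
  obtain e where e: "e \<in> E" "u e \<ge> (\<Sum>e\<in>E. u e) / real (card E)"
    using sum_bounded_above_strict[of E u "(\<Sum>e\<in>E. u e) / real (card E)"] N assms(1,2)
    by (force simp: card_gt_0_iff)
  have nn: "(\<Sum>e\<in>E. u e) \<ge> 0"
    using assms(3) by (rule sum_nonneg)
  have "phi (\<Sum>e\<in>E. u e) / (real (card E))\<^sup>2 \<le> phi ((\<Sum>e\<in>E. u e) / real (card E))"
    using phi_divide[OF nn N] .
  also have "\<dots> \<le> phi (u e)"
    using nn e(2) by (intro phi_mono) auto
  also have "\<dots> \<le> (\<Sum>e\<in>E. phi (u e))"
    using assms(1,3) e(1) by (intro member_le_sum) (auto intro: phi_nonneg)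
  finally show ?thesis .
qed

section \<open>Curvature of the softplus function\<close>

lemma softplus_deriv:
  "((\<lambda>x. ln (1 + exp x)) has_real_derivative exp x / (1 + exp x)) (at (x::real))"
  by (auto intro!: derivative_eq_intros simp: add_pos_pos)

lemma sigmoid_deriv:
  "((\<lambda>x. exp x / (1 + exp x)) has_real_derivative exp x / (1 + exp x)\<^sup>2) (at (x::real))"
proof -
  have "1 + exp x \<noteq> 0" using exp_gt_zero[of x] by linarith
  then show ?thesis
    by (auto intro!: derivative_eq_intros simp: field_simps power2_eq_square)
qed

text \<open>The derivative is the reciprocal of \<open>2 + exp x + exp (- x)\<close>, and each of
  these terms is controlled by \<open>exp \<bar>x\<bar>\<close>.\<close>

lemma sigmoid_deriv_lower:
  fixes x :: real
  shows "exp x / (1 + exp x)\<^sup>2 \<ge> exp (- \<bar>x\<bar>) / 4"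
proof -
  have "(1 + exp x) * (1 + exp (- x)) \<le> 4 * exp \<bar>x\<bar>"
  proof -
    have "(1 + exp x) * (1 + exp (- x)) = 2 + exp x + exp (- x)"
      by (simp add: algebra_simps flip: exp_add)
    moreover have "exp x \<le> exp \<bar>x\<bar>" "exp (- x) \<le> exp \<bar>x\<bar>" "1 \<le> exp \<bar>x\<bar>" by auto
    ultimately show ?thesis by linarith
  qed
  moreover have "(1 + exp x)\<^sup>2 = exp x * ((1 + exp x) * (1 + exp (- x)))"
    by (simp add: algebra_simps power2_eq_square flip: exp_add)
  ultimately have le: "(1 + exp x)\<^sup>2 \<le> exp x * (4 * exp \<bar>x\<bar>)"
    by simp
  have "exp (- \<bar>x\<bar>) / 4 = exp x / (exp x * (4 * exp \<bar>x\<bar>))"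
    by (simp add: exp_minus field_simps)
  also have "\<dots> \<le> exp x / (1 + exp x)\<^sup>2"
    using le by (intro divide_left_mono mult_pos_pos zero_less_power) (auto simp: add_pos_pos)
  finally show ?thesis .
qed

text \<open>The slope \<open>a\<close> is free, as linear terms do not affect convexity; it will be
  the derivative at 0. A positive \<open>c\<close> on a bounded interval yields a quadratic lower
  bound, \<open>c = 0\<close> on the whole line yields plain convexity.\<close>

lemma softplus_bregman_convex:
  assumes "convex C" and "\<And>u. u \<in> C \<Longrightarrow> c \<le> exp (\<theta> + u) / (1 + exp (\<theta> + u))\<^sup>2"
  shows "convex_on C (\<lambda>u::real. ln (1 + exp (\<theta> + u)) - a * u - c / 2 * u\<^sup>2)"
proof (rule f''_ge0_imp_convex)
  show "((\<lambda>u. ln (1 + exp (\<theta> + u)) - a * u - c / 2 * u\<^sup>2) has_real_derivative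
      exp (\<theta> + u) / (1 + exp (\<theta> + u)) - a - c * u) (at u)" for u
    by (rule derivative_eq_intros DERIV_chain2[OF softplus_deriv] refl | simp)+
  show "((\<lambda>u. exp (\<theta> + u) / (1 + exp (\<theta> + u)) - a - c * u) has_real_derivative
      exp (\<theta> + u) / (1 + exp (\<theta> + u))\<^sup>2 - c) (at u)" for u
    by (rule derivative_eq_intros DERIV_chain2[OF sigmoid_deriv] refl | simp)+
qed (use assms in auto)

text \<open>On \<open>[-1, 1]\<close> strong convexity puts the function above its tangent plus a
  parabola. Farther out, convexity and the value 0 at 0 give
  \<open>G (u / \<bar>u\<bar>) \<le> G u / \<bar>u\<bar>\<close>, so the bound at distance 1
  propagates linearly with the same constant.\<close>

lemma softplus_bregman_lower:
  fixes \<theta> :: real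
  shows "exp (- \<bar>\<theta>\<bar> - 1) / 8 * phi \<bar>u\<bar>
    \<le> ln (1 + exp (\<theta> + u)) - ln (1 + exp \<theta>) - exp \<theta> / (1 + exp \<theta>) * u"
    (is "?c / 8 * _ \<le> ?G u")
proof -
  let ?s = "exp \<theta> / (1 + exp \<theta>)"
  have near: "?c / 8 * u\<^sup>2 \<le> ?G u" if "u \<in> {-1..1}" for u
  proof -
    let ?h = "\<lambda>u. ln (1 + exp (\<theta> + u)) - ?s * u - (?c / 4) / 2 * u\<^sup>2"
    have "convex_on {-1..1} ?h"
    proof (rule softplus_bregman_convex)
      fix u :: real assume "u \<in> {-1..1}"
      \<comment> \<open>The argument moves by at most 1, hence the \<open>- 1\<close> in the
        exponent of \<open>?c\<close>. The 8 is the 4 of \<open>sigmoid_deriv_lower\<close> times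
        the 2 of the second-order term.\<close>
      then have "?c / 4 \<le> exp (- \<bar>\<theta> + u\<bar>) / 4" by auto
      also have "\<dots> \<le> exp (\<theta> + u) / (1 + exp (\<theta> + u))\<^sup>2"
        by (rule sigmoid_deriv_lower)
      finally show "?c / 4 \<le> exp (\<theta> + u) / (1 + exp (\<theta> + u))\<^sup>2" .
    qed simp
    moreover have "(?h has_real_derivative 0) (at 0 within {-1..1})"
      by (rule derivative_eq_intros DERIV_chain2[OF softplus_deriv] refl has_field_derivative_at_within | simp)+
    ultimately have "?h u - ?h 0 \<ge> 0 * (u - 0)"
      using that by (intro convex_on_imp_above_tangent[where A="{-1..1}"])
        (auto simp: interior_atLeastAtMost_real)
    moreover have "?h 0 = ln (1 + exp \<theta>)" by simp
    ultimately show ?thesis by linarith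
  qed
  show ?thesis
  proof (cases "\<bar>u\<bar> \<le> 1")
    case True
    have "?c / 8 * phi \<bar>u\<bar> \<le> ?c / 8 * u\<^sup>2"
      by (intro mult_left_mono) (auto simp: phi_def)
    also have "\<dots> \<le> ?G u" using True by (intro near) auto
    finally show ?thesis .
  next
    case False
    let ?h = "\<lambda>u. ln (1 + exp (\<theta> + u)) - ?s * u - 0 / 2 * u\<^sup>2"
    have cvx: "convex_on UNIV ?h"
      by (rule softplus_bregman_convex) auto
    \<comment> \<open>The weight that places the convex combination of 0 and \<open>u\<close> at
      distance 1 from 0.\<close>
    let ?t = "1 / \<bar>u\<bar>"
    have "?h ((1 - ?t) *\<^sub>R 0 + ?t *\<^sub>R u) \<le> (1 - ?t) * ?h 0 + ?t * ?h u"
      using False by (intro convex_onD[OF cvx]) auto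
    also have "(1 - ?t) * ?h 0 + ?t * ?h u = ?h 0 + ?t * (?h u - ?h 0)"
      by (simp only: left_diff_distrib right_diff_distrib)
    also have "(1 - ?t) *\<^sub>R 0 + ?t *\<^sub>R u = u / \<bar>u\<bar>"
      by simp
    finally have "?h (u / \<bar>u\<bar>) - ?h 0 \<le> (?h u - ?h 0) / \<bar>u\<bar>"
      by simp
    moreover have "?h v - ?h 0 = ?G v" for v
      by simp
    ultimately have G: "?G (u / \<bar>u\<bar>) \<le> ?G u / \<bar>u\<bar>"
      by (simp only:)
    have "?c / 8 * (u / \<bar>u\<bar>)\<^sup>2 \<le> ?G (u / \<bar>u\<bar>)"
      using False by (intro near) (auto simp: field_simps abs_if)
    from order_trans[OF this G] have "?c / 8 * (u / \<bar>u\<bar>)\<^sup>2 \<le> ?G u / \<bar>u\<bar>" .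
    moreover have "(u / \<bar>u\<bar>)\<^sup>2 = 1"
      using False by (simp add: power_divide)
    ultimately have "?c / 8 \<le> ?G u / \<bar>u\<bar>"
      by (simp only: mult_1_right)
    then have "?c / 8 * \<bar>u\<bar> \<le> ?G u"
      using False by (subst (asm) pos_le_divide_eq) auto
    moreover have "phi \<bar>u\<bar> \<le> \<bar>u\<bar>" by (simp add: phi_def)
    then have "?c / 8 * phi \<bar>u\<bar> \<le> ?c / 8 * \<bar>u\<bar>"
      by (intro mult_left_mono) auto
    ultimately show ?thesis by (rule order_trans[rotated])
  qed
qed

text \<open>One bound for each outcome: the losses for outcomes 0 and 1 have as derivatives the
  sigmoid and the sigmoid minus 1, both of modulus at most 1.\<close>

lemma softplus_lipschitz:
  fixes \<theta> u :: real
  shows "\<bar>ln (1 + exp (\<theta> + u)) - ln (1 + exp \<theta>)\<bar> \<le> \<bar>u\<bar>"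
    and "\<bar>ln (1 + exp (\<theta> + u)) - ln (1 + exp \<theta>) - u\<bar> \<le> \<bar>u\<bar>"
proof -
  have up: "0 \<le> ln (1 + exp (\<theta> + u)) - ln (1 + exp \<theta>) \<and> ln (1 + exp (\<theta> + u)) - ln (1 + exp \<theta>) \<le> u"
    if "u \<ge> 0" for \<theta> u :: real
  proof
    have "ln (1 + exp \<theta>) \<le> ln (1 + exp (\<theta> + u))"
      using that by (intro ln_mono) (auto simp: add_pos_pos)
    then show "0 \<le> ln (1 + exp (\<theta> + u)) - ln (1 + exp \<theta>)" by simp
    have "ln (1 + exp (\<theta> + u)) \<le> ln (exp u * (1 + exp \<theta>))"
      using that by (intro ln_mono) (auto simp: add_pos_pos algebra_simps exp_add)
    also have "\<dots> = u + ln (1 + exp \<theta>)"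
      by (subst ln_mult) (auto simp: add_pos_pos add_nonneg_eq_0_iff)
    finally show "ln (1 + exp (\<theta> + u)) - ln (1 + exp \<theta>) \<le> u" by simp
  qed
  show "\<bar>ln (1 + exp (\<theta> + u)) - ln (1 + exp \<theta>)\<bar> \<le> \<bar>u\<bar>"
    and "\<bar>ln (1 + exp (\<theta> + u)) - ln (1 + exp \<theta>) - u\<bar> \<le> \<bar>u\<bar>"
    using up[of u \<theta>] up[of "- u" "\<theta> + u"] by (cases "u \<ge> 0"; simp)+
qed

section \<open>The loss of one observation and the edge seminorm\<close>

definition loss :: "('n::finite \<Rightarrow> real ^ 'd::finite) \<Rightarrow> ('n \<times> 'n) \<times> bool \<Rightarrow> real ^ ('n + 'd) \<Rightarrow> real" where
  "loss z x \<xi> = - of_bool (snd x) * (z_star z (fst x) \<bullet> \<xi>) + ln (1 + exp (z_star z (fst x) \<bullet> \<xi>))"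

text \<open>Only a seminorm on the whole space: adding a constant to all \<open>\<alpha>\<close>
  changes no term. The likelihood of comparisons along \<open>E\<close> sees a parameter only
  through these inner products.\<close>

definition edge_norm :: "('n::finite \<Rightarrow> real ^ 'd::finite) \<Rightarrow> ('n \<times> 'n) set \<Rightarrow> real ^ ('n + 'd) \<Rightarrow> real" where
  "edge_norm z E v = (\<Sum>e\<in>E. \<bar>z_star z e \<bullet> v\<bar>)"

lemma edge_norm_nonneg: "edge_norm z E v \<ge> 0"
  unfolding edge_norm_def by (intro sum_nonneg) auto

lemma edge_norm_triangle: "edge_norm z E (u + v) \<le> edge_norm z E u + edge_norm z E v"
  unfolding edge_norm_def sum.distrib[symmetric]
  by (intro sum_mono) (simp add: inner_add_right abs_triangle_ineq)

lemma edge_norm_minus_commute: "edge_norm z E (u - v) = edge_norm z E (v - u)"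
  unfolding edge_norm_def by (intro sum.cong) (auto simp: inner_diff_right)

lemma pmf_care:
  "pmf (care_pmf z q \<xi>) (e, b) = pmf q e *
     (if b then exp (z_star z e \<bullet> \<xi>) / (1 + exp (z_star z e \<bullet> \<xi>))
      else 1 - exp (z_star z e \<bullet> \<xi>) / (1 + exp (z_star z e \<bullet> \<xi>)))"
proof -
  define s where "s e = exp (z_star z e \<bullet> \<xi>) / (1 + exp (z_star z e \<bullet> \<xi>))" for e
  have s: "0 \<le> s e" "s e \<le> 1" for e
    by (auto simp: s_def add_pos_pos divide_simps)
  have "pmf (map_pmf (\<lambda>b. (e', b)) (bernoulli_pmf (s e'))) (e, b)
      = indicator {e} e' * (if b then s e else 1 - s e)" for e'
  proof (cases "e' = e")
    case True
    have "pmf (map_pmf (\<lambda>b. (e, b)) (bernoulli_pmf (s e))) (e, b) = pmf (bernoulli_pmf (s e)) b"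
      by (rule pmf_map_inj') (auto simp: inj_def)
    then show ?thesis using True s[of e] by auto
  next
    case False
    then have "(e, b) \<notin> set_pmf (map_pmf (\<lambda>b. (e', b)) (bernoulli_pmf (s e')))" by auto
    then show ?thesis using False by (simp add: pmf_eq_0_set_pmf)
  qed
  then have "pmf (care_pmf z q \<xi>) (e, b)
      = measure_pmf.expectation q (\<lambda>e'. indicator {e} e' * (if b then s e else 1 - s e))"
    unfolding care_pmf_def pmf_bind s_def[symmetric] by simp
  also have "\<dots> = pmf q e * (if b then s e else 1 - s e)"
    by (simp add: measure_pmf_single)
  finally show ?thesis by (simp add: s_def)
qed

text \<open>
  The mean excess loss is a sum of Bregman divergences, and the fluctuations are controlled because
  the loss is 1-Lipschitz in \<open>z_star z e \<bullet> \<xi>\<close>.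
\<close>

lemma loss_excess_lower:
  fixes z :: "'n::finite \<Rightarrow> real ^ 'd::finite"
  assumes E: "E \<noteq> {}" "\<And>e. e \<in> E \<Longrightarrow> pmf q e > 0"
  shows "\<exists>\<kappa>>0. \<forall>J Z r \<xi>. finite (J :: nat set) \<longrightarrow> (\<forall>t\<in>J. fst (Z t) \<in> E) \<longrightarrow>
      (\<forall>x. \<bar>\<Sum>t\<in>J. of_bool (Z t = x) - pmf (care_pmf z q \<xi>k) x\<bar> \<le> r) \<longrightarrow>
      (\<Sum>t\<in>J. loss z (Z t) \<xi> - loss z (Z t) \<xi>k)
        \<ge> real (card J) * \<kappa> * phi (edge_norm z E (\<xi> - \<xi>k)) - 2 * r * edge_norm z E (\<xi> - \<xi>k)"
proof -
  \<comment> \<open>The Bregman constant of an edge weighted by the probability of drawing it. The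
    minimum over edges makes it uniform, and the squared cardinality in \<open>\<kappa>\<close> is
    the price of \<open>phi_sum\<close>.\<close>
  define \<kappa>0 where "\<kappa>0 e = pmf q e * (exp (- \<bar>z_star z e \<bullet> \<xi>k\<bar> - 1) / 8)" for e
  define \<kappa>1 where "\<kappa>1 = Min (\<kappa>0 ` E)"
  define \<kappa> where "\<kappa> = \<kappa>1 / (real (card E))\<^sup>2"
  have \<kappa>1: "\<kappa>1 > 0" "\<And>e. e \<in> E \<Longrightarrow> \<kappa>1 \<le> \<kappa>0 e"
    proof -
    show "\<kappa>1 > 0"
      unfolding \<kappa>1_def using E by (subst Min_gr_iff) (auto simp: \<kappa>0_def)
    show "\<kappa>1 \<le> \<kappa>0 e" if "e \<in> E" for e
      unfolding \<kappa>1_def using that by (intro Min_le) auto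
  qed
  have "card E > 0" using E by (simp add: card_gt_0_iff)
  then have "\<kappa> > 0" unfolding \<kappa>_def using \<kappa>1(1) by (intro divide_pos_pos zero_less_power) auto
  moreover have "(\<Sum>t\<in>J. loss z (Z t) \<xi> - loss z (Z t) \<xi>k)
        \<ge> real (card J) * \<kappa> * phi (edge_norm z E (\<xi> - \<xi>k)) - 2 * r * edge_norm z E (\<xi> - \<xi>k)"
    if fin: "finite (J :: nat set)" and JE: "\<forall>t\<in>J. fst (Z t) \<in> E"
      and dev: "\<forall>x. \<bar>\<Sum>t\<in>J. of_bool (Z t = x) - pmf (care_pmf z q \<xi>k) x\<bar> \<le> r" for J Z r \<xi>
  proof -
    define u where "u e = z_star z e \<bullet> (\<xi> - \<xi>k)" for e
    define h where "h x = loss z x \<xi> - loss z x \<xi>k" for x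
    define p where "p = pmf (care_pmf z q \<xi>k)"
    define D where "D x = (\<Sum>t\<in>J. of_bool (Z t = x) - p x)" for x
    have \<theta>: "z_star z e \<bullet> \<xi> = z_star z e \<bullet> \<xi>k + u e" for e
      by (simp add: u_def inner_diff_right)
    have h_le: "\<bar>h (e, b)\<bar> \<le> \<bar>u e\<bar>" for e b
      using softplus_lipschitz[of "z_star z e \<bullet> \<xi>k" "u e"]
      by (cases b) (simp_all add: h_def loss_def \<theta> algebra_simps)
    have mean: "p (e, True) * h (e, True) + p (e, False) * h (e, False) \<ge> \<kappa>1 * phi \<bar>u e\<bar>"
      if "e \<in> E" for e
    proof -
      let ?th = "z_star z e \<bullet> \<xi>k"
      let ?s = "exp ?th / (1 + exp ?th)"
      have "\<kappa>1 * phi \<bar>u e\<bar> \<le> \<kappa>0 e * phi \<bar>u e\<bar>"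
        using \<kappa>1(2)[OF that] by (intro mult_right_mono phi_nonneg) auto
      also have "\<dots> = pmf q e * (exp (- \<bar>?th\<bar> - 1) / 8 * phi \<bar>u e\<bar>)"
        by (simp add: \<kappa>0_def)
      also have "\<dots> \<le> pmf q e * (ln (1 + exp (?th + u e)) - ln (1 + exp ?th) - ?s * u e)"
        by (intro mult_left_mono softplus_bregman_lower) auto
      also have "\<dots> = p (e, True) * h (e, True) + p (e, False) * h (e, False)"
        unfolding p_def pmf_care h_def loss_def \<theta> if_True if_False
        by (simp add: algebra_simps add_divide_distrib)
      finally show ?thesis .
    qed
    \<comment> \<open>Grouping the times by the observed value reduces the data to finitely many
      counts, so one bound on their deviations works for all \<open>\<xi>\<close> at once.\<close>
    have "(\<Sum>t\<in>J. h (Z t)) = (\<Sum>t\<in>J. \<Sum>x\<in>E \<times> UNIV. of_bool (Z t = x) * h x)"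
    proof (rule sum.cong)
      fix t assume "t \<in> J"
      then have "Z t \<in> E \<times> UNIV" using JE by (simp add: mem_Times_iff)
      then show "h (Z t) = (\<Sum>x\<in>E \<times> UNIV. of_bool (Z t = x) * h x)"
        by (simp add: of_bool_def if_distrib[of "\<lambda>a. a * _"] sum.delta' cong: if_cong)
    qed simp
    also have "\<dots> = (\<Sum>x\<in>E \<times> UNIV. (\<Sum>t\<in>J. of_bool (Z t = x)) * h x)"
      by (subst sum.swap) (simp add: sum_distrib_right)
    also have "\<dots> = (\<Sum>x\<in>E \<times> UNIV. real (card J) * (p x * h x) + D x * h x)"
      by (intro sum.cong) (auto simp: D_def sum_subtractf algebra_simps)
    also have "\<dots> = real (card J) * (\<Sum>x\<in>E \<times> UNIV. p x * h x) + (\<Sum>x\<in>E \<times> UNIV. D x * h x)"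
      by (simp add: sum.distrib sum_distrib_left)
    finally have eq: "(\<Sum>t\<in>J. h (Z t))
        = real (card J) * (\<Sum>x\<in>E \<times> UNIV. p x * h x) + (\<Sum>x\<in>E \<times> UNIV. D x * h x)" .
    have split: "(\<Sum>x\<in>E \<times> UNIV. f x) = (\<Sum>e\<in>E. f (e, True) + f (e, False))" for f :: "_ \<Rightarrow> real"
      by (simp add: sum.cartesian_product' UNIV_bool add.commute)
    have "\<kappa> * phi (edge_norm z E (\<xi> - \<xi>k)) = \<kappa>1 * (phi (\<Sum>e\<in>E. \<bar>u e\<bar>) / (real (card E))\<^sup>2)"
      by (simp add: \<kappa>_def edge_norm_def u_def)
    also have "\<dots> \<le> \<kappa>1 * (\<Sum>e\<in>E. phi \<bar>u e\<bar>)"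
      using \<kappa>1(1) E(1) by (intro mult_left_mono phi_sum) auto
    also have "\<dots> \<le> (\<Sum>x\<in>E \<times> UNIV. p x * h x)"
      unfolding split sum_distrib_left by (intro sum_mono mean)
    finally have 1: "\<kappa> * phi (edge_norm z E (\<xi> - \<xi>k)) \<le> (\<Sum>x\<in>E \<times> UNIV. p x * h x)" .
    have "\<bar>\<Sum>x\<in>E \<times> UNIV. D x * h x\<bar> \<le> (\<Sum>x\<in>E \<times> UNIV. \<bar>D x * h x\<bar>)"
      by (rule sum_abs)
    also have "\<dots> \<le> (\<Sum>x\<in>E \<times> (UNIV :: bool set). r * \<bar>u (fst x)\<bar>)"
    proof (rule sum_mono)
      fix x :: "('n \<times> 'n) \<times> bool"
      show "\<bar>D x * h x\<bar> \<le> r * \<bar>u (fst x)\<bar>"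
        unfolding abs_mult
      proof (rule mult_mono)
        show "\<bar>D x\<bar> \<le> r" unfolding D_def p_def using dev by blast
        then show "r \<ge> 0" by linarith
        show "\<bar>h x\<bar> \<le> \<bar>u (fst x)\<bar>" using h_le[of "fst x" "snd x"] by simp
      qed simp
    qed
    \<comment> \<open>The factor 2 counts the two outcomes on each edge.\<close>
    also have "\<dots> = 2 * r * edge_norm z E (\<xi> - \<xi>k)"
      unfolding split by (simp add: edge_norm_def u_def sum_distrib_left mult.assoc)
    finally have 2: "\<bar>\<Sum>x\<in>E \<times> UNIV. D x * h x\<bar> \<le> 2 * r * edge_norm z E (\<xi> - \<xi>k)" .
    have "real (card J) * (\<kappa> * phi (edge_norm z E (\<xi> - \<xi>k))) - 2 * r * edge_norm z E (\<xi> - \<xi>k)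
        \<le> (\<Sum>t\<in>J. h (Z t))"
      unfolding eq using mult_left_mono[OF 1, of "real (card J)"] 2 by linarith
    then show ?thesis by (simp add: h_def mult.assoc)
  qed
  ultimately show ?thesis by blast
qed


section \<open>Identifiability on the constraint space\<close>

lemma outer_product_mult_vec:
  "(\<chi> r c. a $ r * a $ c) *v v = (a \<bullet> v) *\<^sub>R (a :: real ^ 'm::finite)"
  by (simp add: vec_eq_iff matrix_vector_mult_def inner_vec_def sum_distrib_left sum_distrib_right algebra_simps)

lemma sum_matrix_vector_mult:
  "(\<Sum>i\<in>I. A i) *v v = (\<Sum>i\<in>I. A i *v (v :: real ^ 'm::finite))"
  by (induction I rule: infinite_finite_induct) (simp_all add: matrix_vector_mult_add_rdistrib)

lemma Sigma_quadratic_form: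
  "v \<bullet> (Sigma_mat z *v v) = (\<Sum>(i, j)\<in>{(i, j). i > j}. ((z_tilde z i - z_tilde z j) \<bullet> v)\<^sup>2)"
  unfolding Sigma_mat_def sum_matrix_vector_mult inner_sum_right
proof (rule sum.cong, simp, clarify)
  fix i j
  show "v \<bullet> ((\<chi> r c. (z_tilde z i - z_tilde z j) $ r * (z_tilde z i - z_tilde z j) $ c) *v v)
      = ((z_tilde z i - z_tilde z j) \<bullet> v)\<^sup>2"
    by (simp only: outer_product_mult_vec inner_scaleR_right power2_eq_square inner_commute[of v])
qed

text \<open>The difference telescopes along a path from \<open>i\<close> to \<open>j\<close>, and
  each step is bounded by the whole edge norm; orientation is lost in the absolute value.\<close>

lemma tilde_diff_le_edge_norm:
  fixes z :: "'n::finite \<Rightarrow> real ^ 'd::finite"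
  assumes "connected_graph E"
  shows "\<exists>c\<ge>0. \<forall>v. \<bar>(z_tilde z i - z_tilde z j) \<bullet> v\<bar> \<le> c * edge_norm z E v"
proof -
  have "(i, j) \<in> (E \<union> E\<inverse>)\<^sup>*"
    using assms by (simp add: connected_graph_def)
  then show ?thesis
  proof (induction rule: rtrancl_induct)
    case (step j k)
    then obtain c where c: "c \<ge> 0" "\<And>v. \<bar>(z_tilde z i - z_tilde z j) \<bullet> v\<bar> \<le> c * edge_norm z E v"
      by blast
    have "\<bar>(z_tilde z j - z_tilde z k) \<bullet> v\<bar> \<le> edge_norm z E v" for v
    proof -
      obtain e where e: "e \<in> E" "\<bar>(z_tilde z j - z_tilde z k) \<bullet> v\<bar> = \<bar>z_star z e \<bullet> v\<bar>"
        using step(2) by (force simp: z_star_def inner_diff_left abs_minus_commute)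
      have "\<bar>z_star z e \<bullet> v\<bar> \<le> edge_norm z E v"
        unfolding edge_norm_def using e(1) by (intro member_le_sum) auto
      then show ?thesis using e(2) by simp
    qed
    moreover have "(z_tilde z i - z_tilde z k) \<bullet> v
        = (z_tilde z i - z_tilde z j) \<bullet> v + (z_tilde z j - z_tilde z k) \<bullet> v" for v
      by (simp add: inner_diff_left)
    ultimately have "\<bar>(z_tilde z i - z_tilde z k) \<bullet> v\<bar> \<le> (c + 1) * edge_norm z E v" for v
      using c(2)[of v] abs_triangle_ineq[of "(z_tilde z i - z_tilde z j) \<bullet> v" "(z_tilde z j - z_tilde z k) \<bullet> v"]
      by (simp only: distrib_right mult_1) (meson add_mono order_trans)
    moreover have "c + 1 \<ge> 0" using c(1) by simp
    ultimately show ?case by blast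
  qed (auto intro: exI[of _ 0])
qed

text \<open>Assumption 2 bounds the norm by the quadratic form of \<open>Sigma_mat z\<close>, a sum
  over all pairs of items; connectedness replaces arbitrary pairs by edges.\<close>

lemma norm_le_edge_norm:
  fixes z :: "'n::{finite,linorder} \<Rightarrow> real ^ 'd::finite"
  assumes "connected_graph E" "assumption2 z"
  shows "\<exists>C>0. \<forall>v\<in>Theta z. norm v \<le> C * edge_norm z E v"
proof -
  obtain c where c: "\<And>i j. c i j \<ge> 0"
      "\<And>i j v. \<bar>(z_tilde z i - z_tilde z j) \<bullet> v\<bar> \<le> c i j * edge_norm z E v"
    using tilde_diff_le_edge_norm[OF assms(1), of z] by metis
  define c1 where "c1 = (\<Sum>(i, j)\<in>{(i, j). i > j}. (c i j)\<^sup>2)"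
  let ?S = "{\<mu>. \<forall>u\<in>Theta z. u \<bullet> (Sigma_mat z *v u) \<ge> \<mu> * (norm u)\<^sup>2}"
  obtain c2 where "c2 > 0" "c2 * real CARD('n) \<le> Sup ?S"
    using assms(2) by (auto simp: assumption2_def lambda_min_perp_def)
  then have "0 < Sup ?S"
    by (smt (verit) mult_pos_pos of_nat_0_less_iff zero_less_card_finite)
  \<comment> \<open>Nonemptiness lets a positive \<open>\<mu>\<close> be taken inside the set, so it
    does not matter whether the supremum is attained.\<close>
  moreover have "0 \<in> ?S"
    by (auto simp: Sigma_quadratic_form intro!: sum_nonneg)
  ultimately obtain \<mu> where \<mu>: "\<mu> > 0" "\<And>u. u \<in> Theta z \<Longrightarrow> u \<bullet> (Sigma_mat z *v u) \<ge> \<mu> * (norm u)\<^sup>2"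
    using less_cSupD[of ?S 0] by blast
  \<comment> \<open>The \<open>+ 1\<close> keeps the constant positive even if \<open>c1\<close> is
    0.\<close>
  have "norm v \<le> (sqrt (c1 / \<mu>) + 1) * edge_norm z E v" if "v \<in> Theta z" for v
  proof -
    have "\<mu> * (norm v)\<^sup>2 \<le> (\<Sum>(i, j)\<in>{(i, j). i > j}. ((z_tilde z i - z_tilde z j) \<bullet> v)\<^sup>2)"
      using \<mu>(2)[OF that] by (simp add: Sigma_quadratic_form)
    also have "\<dots> \<le> (\<Sum>(i, j)\<in>{(i, j). i > j}. (c i j)\<^sup>2 * (edge_norm z E v)\<^sup>2)"
    proof (rule sum_mono, clarify)
      fix i j
      have "\<bar>(z_tilde z i - z_tilde z j) \<bullet> v\<bar> \<le> \<bar>c i j * edge_norm z E v\<bar>"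
        using c(2)[of i j v] by linarith
      then show "((z_tilde z i - z_tilde z j) \<bullet> v)\<^sup>2 \<le> (c i j)\<^sup>2 * (edge_norm z E v)\<^sup>2"
        by (simp add: abs_le_square_iff power_mult_distrib)
    qed
    also have "\<dots> = c1 * (edge_norm z E v)\<^sup>2"
      unfolding c1_def sum_distrib_right by (intro sum.cong) auto
    finally have "(norm v)\<^sup>2 \<le> c1 / \<mu> * (edge_norm z E v)\<^sup>2"
      using \<mu>(1) by (simp add: field_simps)
    then have "norm v \<le> sqrt (c1 / \<mu> * (edge_norm z E v)\<^sup>2)"
      by (rule real_le_rsqrt)
    also have "\<dots> = sqrt (c1 / \<mu>) * edge_norm z E v"
      by (simp only: real_sqrt_mult real_sqrt_abs abs_of_nonneg[OF edge_norm_nonneg])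
    finally show ?thesis using edge_norm_nonneg[of z E v] by (simp add: algebra_simps)
  qed
  moreover have "c1 \<ge> 0"
    unfolding c1_def by (intro sum_nonneg) auto
  then have "sqrt (c1 / \<mu>) + 1 > 0"
    using \<mu>(1) by (simp add: add_nonneg_pos)
  ultimately show ?thesis by blast
qed

section \<open>Existence of minima on the constraint space\<close>

lemma Theta_diff: "u \<in> Theta z \<Longrightarrow> v \<in> Theta z \<Longrightarrow> u - v \<in> Theta z"
proof -
  have "(\<chi> i. (u - v) $ Inl i) = (\<chi> i. u $ Inl i) - (\<chi> i. v $ Inl i)"
    by (simp add: vec_eq_iff)
  then show "u \<in> Theta z \<Longrightarrow> v \<in> Theta z \<Longrightarrow> u - v \<in> Theta z"
    unfolding Theta_def mem_Collect_eq by (simp only: matrix_vector_mult_diff_distrib diff_self)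
qed

lemma closed_Theta: "closed (Theta z)"
  unfolding Theta_def matrix_vector_mult_def
  by (intro closed_Collect_eq continuous_intros)

text \<open>The sublevel set of \<open>x0\<close> within \<open>Theta z\<close> is closed, and
  bounded because the edge norm dominates the Euclidean norm there; hence it is compact.\<close>

lemma coercive_attains_min:
  fixes f :: "real ^ ('n::{finite,linorder} + 'd::finite) \<Rightarrow> real"
  assumes E: "connected_graph E" and A2: "assumption2 z"
    and cont: "continuous_on UNIV f" and x0: "x0 \<in> Theta z"
    and bnd: "\<And>\<xi>. \<xi> \<in> Theta z \<Longrightarrow> f \<xi> \<le> f x0 \<Longrightarrow> edge_norm z E (\<xi> - x0) \<le> R"
  shows "\<exists>\<xi>\<in>Theta z. \<forall>\<eta>\<in>Theta z. f \<xi> \<le> f \<eta>"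
proof -
  obtain C where C: "C > 0" "\<And>v. v \<in> Theta z \<Longrightarrow> norm v \<le> C * edge_norm z E v"
    using norm_le_edge_norm[OF E A2] by blast
  define S where "S = Theta z \<inter> {\<xi>. f \<xi> \<le> f x0}"
  have "S \<subseteq> cball x0 (C * R)"
  proof
    fix \<xi> assume "\<xi> \<in> S"
    then have \<xi>: "\<xi> \<in> Theta z" "f \<xi> \<le> f x0" by (auto simp: S_def)
    have "norm (\<xi> - x0) \<le> C * edge_norm z E (\<xi> - x0)"
      by (intro C Theta_diff \<xi> x0)
    also have "\<dots> \<le> C * R"
      using C(1) bnd[OF \<xi>] by simp
    finally show "\<xi> \<in> cball x0 (C * R)" by (simp add: dist_norm norm_minus_commute)
  qed
  then have "bounded S" using bounded_cball bounded_subset by blast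
  moreover have "closed S"
    unfolding S_def by (intro closed_Int closed_Theta closed_Collect_le cont continuous_on_const)
  ultimately have "compact S" by (simp add: compact_eq_bounded_closed)
  moreover have "x0 \<in> S" using x0 by (simp add: S_def)
  ultimately obtain \<xi> where \<xi>: "\<xi> \<in> S" "\<And>\<eta>. \<eta> \<in> S \<Longrightarrow> f \<xi> \<le> f \<eta>"
    using continuous_attains_inf[of S f] continuous_on_subset[OF cont] by blast
  then have "f \<xi> \<le> f \<eta>" if "\<eta> \<in> Theta z" for \<eta>
    using that \<open>x0 \<in> S\<close> by (cases "f \<eta> \<le> f x0") (fastforce simp: S_def)+
  then show ?thesis using \<xi>(1) by (auto simp: S_def)
qed


subsection \<open>Segmentations and excess loss\<close>

lemma quadratic_lower:
  fixes A :: real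
  assumes "A > 0"
  shows "- (R\<^sup>2 / (4 * A)) \<le> A * w\<^sup>2 - R * w"
proof -
  have "0 \<le> (2 * A * w - R)\<^sup>2" by simp
  also have "\<dots> = 4 * A * (A * w\<^sup>2 - R * w) + R\<^sup>2"
    by (simp add: power2_eq_square algebra_simps)
  finally show ?thesis using assms by (simp add: field_simps)
qed

text \<open>
  Here \<open>excess k t \<xi>\<close> is the extra loss of \<open>\<xi>\<close> at time \<open>t\<close> over the parameter of regime \<open>k\<close>, and
  \<open>w k \<xi>\<close> is the distance between the two. The noise in a piece is at most \<open>R w\<close>, and \<open>R\<close> becomes linear
  with a small slope \<open>c\<close>, up to \<open>a\<close>, if the piece touches a true change point.
\<close>

locale change_point_bounds =
  fixes T K0 :: nat and tau :: "nat \<Rightarrow> nat" and excess :: "nat \<Rightarrow> nat \<Rightarrow> 'p \<Rightarrow> real"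
    and w :: "nat \<Rightarrow> 'p \<Rightarrow> real" and \<kappa> B \<delta> R c a \<rho> :: real
  assumes tau_0: "tau 0 = 0" and tau_T: "tau (Suc K0) = T"
    and spacing: "\<And>k. k \<in> {1..Suc K0} \<Longrightarrow> real (tau (k - 1)) + \<rho> * T \<le> real (tau k)"
    and w_nonneg: "\<And>k \<xi>. w k \<xi> \<ge> 0"
    and w_close: "\<And>k l \<xi>. k \<in> {1..Suc K0} \<Longrightarrow> l \<in> {1..Suc K0} \<Longrightarrow> w k \<xi> \<le> w l \<xi> + B"
    and w_sep: "\<And>k \<xi>. k \<in> {1..K0} \<Longrightarrow> 2 * \<delta> \<le> w k \<xi> + w (Suc k) \<xi>"
    and piece: "\<And>k s s' \<xi>. k \<in> {1..Suc K0} \<Longrightarrow> tau (k - 1) \<le> s \<Longrightarrow> s \<le> s' \<Longrightarrow> s' \<le> tau k \<Longrightarrow>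
        (\<Sum>t\<in>{s<..s'}. excess k t \<xi>) \<ge> real (s' - s) * \<kappa> * phi (w k \<xi>) - R * w k \<xi>"
    and piece_near: "\<And>k s s' \<xi>. k \<in> {1..Suc K0} \<Longrightarrow> tau (k - 1) \<le> s \<Longrightarrow> s \<le> s' \<Longrightarrow> s' \<le> tau k \<Longrightarrow>
        (k \<ge> 2 \<and> s = tau (k - 1)) \<or> (k \<le> K0 \<and> s' = tau k) \<Longrightarrow>
        (\<Sum>t\<in>{s<..s'}. excess k t \<xi>) \<ge> real (s' - s) * \<kappa> * phi (w k \<xi>) - (c * real (s' - s) + a) * w k \<xi>"
    and T_pos: "T > 0" and \<kappa>_pos: "\<kappa> > 0" and B_nonneg: "B \<ge> 0" and \<delta>_pos: "\<delta> > 0" and R_nonneg: "R \<ge> 0"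
    and a_nonneg: "a \<ge> 0" and \<rho>_pos: "\<rho> > 0" and c_le: "c \<le> \<kappa> * min \<delta> 1"
    and R_small: "2 * (real (Suc K0) * R) \<le> \<rho> * \<kappa> * min \<delta> 1 * T"
    and R_small': "real (Suc K0) * R * B \<le> \<rho> * \<kappa> * min \<delta> 1 * \<delta> / 2 * T"
begin

text \<open>\<open>{lo s k<..hi s' k}\<close> is the intersection of the segment
  \<open>{s<..s'}\<close> with regime \<open>k\<close>, and is empty if they do not meet.\<close>

definition lo :: "nat \<Rightarrow> nat \<Rightarrow> nat" where "lo s k = max s (tau (k - 1))"

definition hi :: "nat \<Rightarrow> nat \<Rightarrow> nat" where "hi s' k = min s' (tau k)"

definition part :: "nat \<Rightarrow> nat \<Rightarrow> 'p \<Rightarrow> nat \<Rightarrow> real" where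
  "part s s' \<xi> k = (\<Sum>t\<in>{lo s k<..hi s' k}. excess k t \<xi>)"

definition seg :: "nat \<Rightarrow> nat \<Rightarrow> 'p \<Rightarrow> real" where
  "seg s s' \<xi> = (\<Sum>k=1..Suc K0. part s s' \<xi> k)"

text \<open>The threshold equals the minimal length in \<open>spacing\<close>, so a regime that lies
  inside the segment is always long.\<close>

definition long :: "nat \<Rightarrow> nat \<Rightarrow> nat \<Rightarrow> bool" where
  "long s s' k \<longleftrightarrow> real (lo s k) + \<rho> * T \<le> real (hi s' k)"

lemma long_less: "long s s' k \<Longrightarrow> lo s k < hi s' k"
  unfolding long_def using mult_pos_pos[OF \<rho>_pos, of "real T"] T_pos by simp

lemma R_le: "real (Suc K0) * R \<le> \<rho> * \<kappa> * T" "R \<le> \<rho> * \<kappa> * T"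
proof -
  have "\<rho> * \<kappa> * min \<delta> 1 * T \<le> \<rho> * \<kappa> * 1 * T"
    using \<rho>_pos \<kappa>_pos by (intro mult_right_mono mult_left_mono) auto
  moreover have "real (Suc K0) * R \<ge> 0" using R_nonneg by simp
  ultimately show 1: "real (Suc K0) * R \<le> \<rho> * \<kappa> * T" using R_small by linarith
  have "1 * R \<le> real (Suc K0) * R" using R_nonneg by (intro mult_right_mono) auto
  then show "R \<le> \<rho> * \<kappa> * T" using 1 by linarith
qed

lemma part_any:
  assumes k: "k \<in> {1..Suc K0}"
  shows "part s s' \<xi> k \<ge> - R * w k \<xi>"
proof (cases "lo s k \<le> hi s' k")
  case True
  have "real (hi s' k - lo s k) * \<kappa> * phi (w k \<xi>) \<ge> 0"
    using \<kappa>_pos by (intro mult_nonneg_nonneg phi_nonneg w_nonneg) auto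
  then show ?thesis
    using piece[OF k _ True, of \<xi>] by (simp add: part_def lo_def hi_def)
next
  case False
  then show ?thesis
    using R_nonneg w_nonneg[of k \<xi>] by (simp add: part_def)
qed

lemma part_long:
  assumes k: "k \<in> {1..Suc K0}" and l: "long s s' k"
  shows "part s s' \<xi> k \<ge> \<rho> * \<kappa> * T * phi (w k \<xi>) - R * w k \<xi>"
proof -
  have "\<rho> * T * \<kappa> * phi (w k \<xi>) \<le> real (hi s' k - lo s k) * \<kappa> * phi (w k \<xi>)"
    using long_less[OF l] l \<kappa>_pos
    by (intro mult_right_mono phi_nonneg w_nonneg) (auto simp: long_def)
  also have "\<dots> - R * w k \<xi> \<le> part s s' \<xi> k"
    unfolding part_def using piece[OF k, of "lo s k" "hi s' k" \<xi>] long_less[OF l]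
    by (simp add: lo_def hi_def)
  finally show ?thesis by (simp add: mult_ac)
qed

text \<open>By \<open>w_close\<close> all distances are at most \<open>w l \<xi> + B\<close>, so the
  noise of every part is charged to the drift of a single long one.\<close>

lemma seg_lower:
  assumes l: "l \<in> {1..Suc K0}" "long s s' l"
  shows "seg s s' \<xi> \<ge> \<rho> * \<kappa> * T * phi (w l \<xi>) - real (Suc K0) * R * (w l \<xi> + B)"
proof -
  have "(\<Sum>k=1..Suc K0. (if k = l then \<rho> * \<kappa> * T * phi (w l \<xi>) else 0) - R * (w l \<xi> + B)) \<le> seg s s' \<xi>"
    unfolding seg_def
  proof (rule sum_mono)
    fix k assume k: "k \<in> {1..Suc K0}"
    have le: "R * w k \<xi> \<le> R * (w l \<xi> + B)"
      using R_nonneg w_close[OF k l(1)] by (intro mult_left_mono) auto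
    show "(if k = l then \<rho> * \<kappa> * T * phi (w l \<xi>) else 0) - R * (w l \<xi> + B) \<le> part s s' \<xi> k"
      using le part_any[OF k, of \<xi> s s'] part_long[OF l, of \<xi>] by auto
  qed
  then show ?thesis
    using l(1) by (simp add: sum_subtractf mult.assoc del: sum.cl_ivl_Suc)
qed

text \<open>For \<open>w \<le> 1\<close> the noise is at most of order \<open>R\<close>; beyond 1
  the drift is linear and absorbs it by \<open>R_le\<close>. This bounds what a segment can gain
  when nothing is known about its position.\<close>

lemma seg_crude:
  assumes l: "l \<in> {1..Suc K0}" "long s s' l"
  shows "seg s s' \<xi> \<ge> - (real (Suc K0) * R * (1 + B))"
proof -
  let ?w = "w l \<xi>" let ?R = "real (Suc K0) * R" let ?A = "\<rho> * \<kappa> * T"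
  have A: "?A \<ge> 0" using \<rho>_pos \<kappa>_pos by simp
  have R: "?R \<ge> 0" "?R \<le> ?A" using R_nonneg R_le by simp_all
  have "?A * phi ?w - ?R * ?w \<ge> - ?R"
  proof (cases "?w \<le> 1")
    case True
    then have "?R * ?w \<le> ?R * 1" using R by (intro mult_left_mono) auto
    moreover have "?A * phi ?w \<ge> 0" by (intro mult_nonneg_nonneg A phi_nonneg w_nonneg)
    ultimately show ?thesis by linarith
  next
    case False
    then have "phi ?w = ?w" by (simp add: phi_def power2_eq_square)
    moreover have "?R * ?w \<le> ?A * ?w" using R w_nonneg by (intro mult_right_mono) auto
    ultimately show ?thesis using R(1) by simp
  qed
  then show ?thesis using seg_lower[OF l, of \<xi>] by (simp add: distrib_left)
qed

text \<open>Beyond \<open>\<delta>\<close> the drift is a multiple of \<open>w\<close>, and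
  \<open>R_small\<close> lets the noise use up at most half of it. The other half is of order
  \<open>T\<close>.\<close>

lemma seg_far:
  assumes l: "l \<in> {1..Suc K0}" "long s s' l" and far: "w l \<xi> \<ge> \<delta>"
  shows "seg s s' \<xi> \<ge> \<rho> * \<kappa> * min \<delta> 1 * \<delta> / 2 * T - real (Suc K0) * R * B"
proof -
  let ?w = "w l \<xi>" let ?R = "real (Suc K0) * R" let ?A = "\<rho> * \<kappa> * min \<delta> 1 * T"
  have A: "\<rho> * \<kappa> * T \<ge> 0" "?A \<ge> 0" using \<rho>_pos \<kappa>_pos \<delta>_pos by simp_all
  have "\<rho> * \<kappa> * T * (min \<delta> 1 * ?w) \<le> \<rho> * \<kappa> * T * phi ?w"
    using \<delta>_pos far by (intro mult_left_mono[OF _ A(1)] phi_ge_linear) auto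
  moreover have "?R * ?w \<le> ?A / 2 * ?w"
    using R_small w_nonneg by (intro mult_right_mono) auto
  moreover have "?A / 2 * \<delta> \<le> ?A / 2 * ?w"
    using A(2) far by (intro mult_left_mono) auto
  ultimately show ?thesis
    using seg_lower[OF l, of \<xi>] by (simp add: algebra_simps)
qed

section \<open>Short pieces of a fitted segment\<close>

lemma tau_le_T: "k \<le> Suc K0 \<Longrightarrow> tau k \<le> T"
proof (induction k rule: inc_induct)
  case (step k)
  have "\<rho> * T \<ge> 0" using \<rho>_pos by simp
  moreover have "real (tau k) + \<rho> * T \<le> real (tau (Suc k))" using spacing[of "Suc k"] step by simp
  ultimately have "real (tau k) \<le> real (tau (Suc k))" by linarith
  then show ?case using step.IH by linarith
qed (simp add: tau_T)

text \<open>A short part contains neither its whole regime nor the whole segment, so one of its ends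
  comes from each. Of the segment, more than \<open>\<rho> * T\<close> then lies beyond the true
  change point, and the neighbouring regime is long enough to make its part long too.\<close>

lemma short_part_adjacent:
  assumes k: "k \<in> {1..Suc K0}" and ne: "lo s k < hi s' k" and short: "\<not> long s s' k"
    and len: "real s + 2 * \<rho> * T \<le> real s'" and s': "s' \<le> T"
  shows "(k \<ge> 2 \<and> lo s k = tau (k - 1) \<and> long s s' (k - 1)) \<or> (k \<le> K0 \<and> hi s' k = tau k \<and> long s s' (Suc k))"
proof -
  have \<rho>T: "\<rho> * T > 0" using \<rho>_pos T_pos by simp
  note sp = spacing[OF k]
  show ?thesis
  proof (cases "s < tau (k - 1)")
    case True
    have k2: "k \<ge> 2"
    proof (rule ccontr)
      assume "\<not> k \<ge> 2"
      then have "k = 1" using k by auto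
      then show False using True tau_0 by simp
    qed
    then have k1: "k - 1 \<in> {1..Suc K0}" using k by auto
    have lo: "lo s k = tau (k - 1)" using True by (simp add: lo_def)
    have hi: "hi s' k = s'" "real s' < real (tau (k - 1)) + \<rho> * T"
      using short sp unfolding long_def lo by (auto simp: hi_def min_def split: if_splits)
    have "long s s' (k - 1)"
      using spacing[OF k1] hi(2) len ne True unfolding long_def hi(1) lo
      by (auto simp: lo_def hi_def hi(1) max_def min_def)
    then show ?thesis using k2 lo by blast
  next
    case False
    then have lo: "lo s k = s" by (simp add: lo_def)
    have hi: "hi s' k = tau k" "real (tau k) < real s + \<rho> * T"
      using short len \<rho>T unfolding long_def lo by (auto simp: hi_def min_def split: if_splits)
    have "tau k < s'" using hi(2) len \<rho>T by linarith
    then have kK: "k \<le> K0" using k s' tau_T by (cases "k = Suc K0") auto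
    then have k1: "Suc k \<in> {1..Suc K0}" by simp
    have "long s s' (Suc k)"
      using spacing[OF k1] hi(2) len ne unfolding long_def hi(1) lo
      by (auto simp: lo_def hi_def max_def min_def)
    then show ?thesis using kK hi(1) by blast
  qed
qed

text \<open>The regime of the first time point of the segment has a nonempty part; if that part is
  short, its neighbour is long.\<close>

lemma exists_long:
  assumes len: "real s + 2 * \<rho> * T \<le> real s'" and s': "s' \<le> T"
  shows "\<exists>l\<in>{1..Suc K0}. long s s' l"
proof -
  have \<rho>T: "\<rho> * T > 0" using \<rho>_pos T_pos by simp
  define k where "k = (LEAST k. s < tau k)"
  have "s < tau (Suc K0)" using len s' tau_T \<rho>T by linarith
  then have k: "s < tau k" "k \<le> Suc K0"
    unfolding k_def by (rule LeastI, intro Least_le)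
  have "k \<noteq> 0" using k(1) tau_0 by (cases k) auto
  then have "\<not> s < tau (k - 1)"
    unfolding k_def by (intro not_less_Least) simp
  then have ne: "lo s k < hi s' k" using k(1) len \<rho>T by (auto simp: lo_def hi_def)
  have kin: "k \<in> {1..Suc K0}" using k(2) \<open>k \<noteq> 0\<close> by simp
  show ?thesis
  proof (cases "long s s' k")
    case False
    from short_part_adjacent[OF kin ne False len s'] show ?thesis
    proof
      assume "k \<ge> 2 \<and> lo s k = tau (k - 1) \<and> long s s' (k - 1)"
      then show ?thesis using kin by (intro bexI[of _ "k - 1"]) auto
    next
      assume "k \<le> K0 \<and> hi s' k = tau k \<and> long s s' (Suc k)"
      then show ?thesis by (intro bexI[of _ "Suc k"]) auto
    qed
  qed (use kin in blast)
qed

text \<open>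
  A short part touches a true change point with a long part beyond it. If \<open>\<xi>\<close> is close to the true
  parameter of the long part, it is far from that of the short part, where the drift then dominates.
\<close>

lemma part_tight:
  assumes k: "k \<in> {1..Suc K0}" and len: "real s + 2 * \<rho> * T \<le> real s'" and s': "s' \<le> T"
    and near: "\<And>l. l \<in> {1..Suc K0} \<Longrightarrow> long s s' l \<Longrightarrow> w l \<xi> < \<delta>"
  shows "part s s' \<xi> k \<ge> - (R\<^sup>2 / (4 * (\<rho> * \<kappa> * T)) + a * (B + \<delta>))"
proof -
  let ?A = "\<rho> * \<kappa> * T" let ?w = "w k \<xi>"
  have A: "?A > 0" using \<rho>_pos \<kappa>_pos T_pos by simp
  have nn: "R\<^sup>2 / (4 * ?A) \<ge> 0" "a * (B + \<delta>) \<ge> 0"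
    using A a_nonneg B_nonneg \<delta>_pos by simp_all
  consider "hi s' k \<le> lo s k" | "long s s' k" | "lo s k < hi s' k" "\<not> long s s' k" by linarith
  then show ?thesis
  proof cases
    case 1
    then show ?thesis using nn by (simp add: part_def)
  next
    case 2
    have "?A * phi ?w - R * ?w \<ge> - (R\<^sup>2 / (4 * ?A))"
    proof (cases "?w \<le> 1")
      case True
      then have "phi ?w = ?w\<^sup>2"
        using w_nonneg[of k \<xi>] by (simp add: phi_def power2_eq_square mult_left_le_one_le)
      then show ?thesis using quadratic_lower[OF A] by simp
    next
      case False
      then have ph: "phi ?w = ?w" by (simp add: phi_def power2_eq_square)
      have "R * ?w \<le> ?A * ?w" using R_le w_nonneg by (intro mult_right_mono) auto
      then show ?thesis unfolding ph using nn(1) by linarith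
    qed
    then show ?thesis using part_long[OF k 2, of \<xi>] nn by linarith
  next
    case 3
    obtain l where l: "l \<in> {1..Suc K0}" "long s s' l" and sep: "2 * \<delta> \<le> ?w + w l \<xi>"
      and touch: "(k \<ge> 2 \<and> lo s k = tau (k - 1)) \<or> (k \<le> K0 \<and> hi s' k = tau k)"
      using short_part_adjacent[OF k 3 len s']
    proof
      assume *: "k \<ge> 2 \<and> lo s k = tau (k - 1) \<and> long s s' (k - 1)"
      then have "k - 1 \<in> {1..K0}" "k - 1 \<in> {1..Suc K0}" "Suc (k - 1) = k" using k by auto
      then show thesis using that[of "k - 1"] w_sep[of "k - 1" \<xi>] * by (simp add: add.commute)
    next
      assume *: "k \<le> K0 \<and> hi s' k = tau k \<and> long s s' (Suc k)"
      then show thesis using that[of "Suc k"] w_sep[of k \<xi>] k by simp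
    qed
    have wl: "w l \<xi> < \<delta>" using near[OF l] .
    have wk: "?w \<ge> \<delta>" "?w \<le> B + \<delta>" using sep wl w_close[OF k l(1), of \<xi>] by linarith+
    define m where "m = real (hi s' k - lo s k)"
    have "m \<ge> 0" by (simp add: m_def)
    \<comment> \<open>By the choice of \<open>c\<close> the drift cancels the part of the noise that
      grows with the length \<open>m\<close>, whatever \<open>m\<close> is; only
      \<open>a * ?w\<close> survives.\<close>
    have "c * ?w \<le> \<kappa> * min \<delta> 1 * ?w" using c_le w_nonneg by (intro mult_right_mono) auto
    also have "\<dots> \<le> \<kappa> * phi ?w"
      using phi_ge_linear[of \<delta> ?w] \<delta>_pos wk(1) \<kappa>_pos by (simp add: mult.assoc)
    finally have "m * (c * ?w) \<le> m * (\<kappa> * phi ?w)"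
      using \<open>m \<ge> 0\<close> by (rule mult_left_mono)
    moreover have "a * ?w \<le> a * (B + \<delta>)" using a_nonneg wk by (intro mult_left_mono) auto
    moreover have "part s s' \<xi> k \<ge> m * \<kappa> * phi ?w - (c * m + a) * ?w"
      unfolding part_def m_def using 3(1) touch by (intro piece_near[OF k]) (auto simp: lo_def hi_def)
    ultimately show ?thesis using nn(1) by (simp add: algebra_simps)
  qed
qed

text \<open>Either \<open>\<xi>\<close> is far from the truth on some long part, and then
  \<open>R_small'\<close> makes the bound of \<open>seg_far\<close> nonnegative, or it is near on
  all long parts and \<open>part_tight\<close> applies to every regime.\<close>

lemma seg_tight:
  assumes len: "real s + 2 * \<rho> * T \<le> real s'" and s': "s' \<le> T"
  shows "seg s s' \<xi> \<ge> - (real (Suc K0) * (R\<^sup>2 / (4 * (\<rho> * \<kappa> * T)) + a * (B + \<delta>)))"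
proof (cases "\<exists>l\<in>{1..Suc K0}. long s s' l \<and> w l \<xi> \<ge> \<delta>")
  case True
  then obtain l where l: "l \<in> {1..Suc K0}" "long s s' l" "w l \<xi> \<ge> \<delta>" by blast
  have "real (Suc K0) * (R\<^sup>2 / (4 * (\<rho> * \<kappa> * T)) + a * (B + \<delta>)) \<ge> 0"
    using \<rho>_pos \<kappa>_pos T_pos a_nonneg B_nonneg \<delta>_pos by (intro mult_nonneg_nonneg add_nonneg_nonneg) auto
  then show ?thesis using seg_far[OF l] R_small' by linarith
next
  case False
  then have "part s s' \<xi> k \<ge> - (R\<^sup>2 / (4 * (\<rho> * \<kappa> * T)) + a * (B + \<delta>))" if "k \<in> {1..Suc K0}" for k
    using that by (intro part_tight len s') (auto simp: not_le)
  then have "(\<Sum>k=1..Suc K0. - (R\<^sup>2 / (4 * (\<rho> * \<kappa> * T)) + a * (B + \<delta>))) \<le> seg s s' \<xi>"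
    unfolding seg_def by (rule sum_mono)
  then show ?thesis by (simp only: sum_constant card_atLeastAtMost diff_Suc_1 mult_minus_right)
qed

text \<open>With room on both sides, the parts in both adjacent regimes are long, and by
  \<open>w_sep\<close> no parameter is within \<open>\<delta>\<close> of both truths.\<close>

lemma seg_missed:
  assumes k: "k \<in> {1..K0}" and "real s + \<rho> * T \<le> tau k" "tau k + \<rho> * T \<le> real s'"
  shows "seg s s' \<xi> \<ge> \<rho> * \<kappa> * min \<delta> 1 * \<delta> / 2 * T - real (Suc K0) * R * B"
proof -
  have k1: "k \<in> {1..Suc K0}" "Suc k \<in> {1..Suc K0}" using k by auto
  have \<rho>T: "\<rho> * T > 0" using \<rho>_pos T_pos by simp
  have "long s s' k" "long s s' (Suc k)"
    using spacing[OF k1(1)] spacing[OF k1(2)] assms(2,3) \<rho>T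
    by (auto simp: long_def lo_def hi_def max_def min_def)
  moreover have "w k \<xi> \<ge> \<delta> \<or> w (Suc k) \<xi> \<ge> \<delta>" using w_sep[OF k, of \<xi>] by linarith
  ultimately show ?thesis using seg_far k1 by blast
qed

section \<open>Sums over all fitted segments\<close>

context
  fixes K :: nat and th :: "nat \<Rightarrow> nat" and xi :: "nat \<Rightarrow> 'p"
  assumes th_0: "th 0 = 0" and th_T: "th (Suc K) = T"
    and th_len: "\<And>j. j \<in> {1..Suc K} \<Longrightarrow> real (th (j - 1)) + 2 * \<rho> * T \<le> real (th j)"
begin

lemma th_le_T: "j \<le> Suc K \<Longrightarrow> th j \<le> T"
proof (induction j rule: inc_induct)
  case (step j)
  have "2 * \<rho> * T \<ge> 0" using \<rho>_pos by simp
  moreover have "real (th j) + 2 * \<rho> * T \<le> real (th (Suc j))" using th_len[of "Suc j"] step by simp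
  ultimately have "real (th j) \<le> real (th (Suc j))" by linarith
  then show ?case using step.IH by linarith
qed (simp add: th_T)

lemma total_tight:
  "(\<Sum>j=1..Suc K. seg (th (j - 1)) (th j) (xi j))
     \<ge> - (real (Suc K) * (real (Suc K0) * (R\<^sup>2 / (4 * (\<rho> * \<kappa> * T)) + a * (B + \<delta>))))"
proof -
  have "(\<Sum>j=1..Suc K. - (real (Suc K0) * (R\<^sup>2 / (4 * (\<rho> * \<kappa> * T)) + a * (B + \<delta>))))
      \<le> (\<Sum>j=1..Suc K. seg (th (j - 1)) (th j) (xi j))"
    by (intro sum_mono seg_tight th_len th_le_T) auto
  then show ?thesis by simp
qed

text \<open>The segment that straddles the missed change point pays an amount of order
  \<open>T\<close>; each other one can recover at most the bound of
  \<open>seg_crude\<close>.\<close>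

lemma total_missed:
  assumes k: "k \<in> {1..K0}" and miss: "\<And>j. j \<in> {1..K} \<Longrightarrow> \<bar>real (th j) - real (tau k)\<bar> > \<rho> * T"
  shows "(\<Sum>j=1..Suc K. seg (th (j - 1)) (th j) (xi j))
     \<ge> \<rho> * \<kappa> * min \<delta> 1 * \<delta> / 2 * T - real (Suc K) * (real (Suc K0) * R * (1 + B))"
proof -
  have \<rho>T: "\<rho> * T > 0" using \<rho>_pos T_pos by simp
  have tk: "\<rho> * T \<le> tau k" "tau k + \<rho> * T \<le> T"
  proof -
    have k1: "k \<in> {1..Suc K0}" "Suc k \<in> {1..Suc K0}" using k by auto
    show "\<rho> * T \<le> tau k" using spacing[OF k1(1)] by linarith
    have "tau (Suc k) \<le> T" using k1(2) by (intro tau_le_T) simp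
    then show "tau k + \<rho> * T \<le> T" using spacing[OF k1(2)] by simp
  qed
  \<comment> \<open>The segment that contains the missed change point. If it is the first or the
    last one, its outer end is 0 or \<open>T\<close>, about which \<open>miss\<close> says nothing;
    there the room comes from \<open>tk\<close>.\<close>
  define j where "j = (LEAST j. tau k < th j)"
  have "tau k < th (Suc K)" using th_T tk \<rho>T by linarith
  then have j: "tau k < th j" "j \<le> Suc K"
    unfolding j_def by (rule LeastI, intro Least_le)
  have "j \<noteq> 0" using j(1) th_0 by (cases j) auto
  then have jin: "j \<in> {1..Suc K}" using j by auto
  have "\<not> tau k < th (j - 1)"
    using \<open>j \<noteq> 0\<close> unfolding j_def by (intro not_less_Least) simp
  then have "real (th (j - 1)) + \<rho> * T \<le> tau k"
  proof (cases "j = 1")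
    case True
    then show ?thesis using th_0 tk(1) by simp
  next
    case False
    then have "j - 1 \<in> {1..K}" using jin by auto
    from miss[OF this] show ?thesis using \<open>\<not> tau k < th (j - 1)\<close> by linarith
  qed
  moreover have "tau k + \<rho> * T \<le> real (th j)"
    using miss[of j] jin th_T tk(2) j(1) by (cases "j = Suc K") auto
  ultimately have m: "seg (th (j - 1)) (th j) (xi j)
      \<ge> \<rho> * \<kappa> * min \<delta> 1 * \<delta> / 2 * T - real (Suc K0) * R * B"
    by (rule seg_missed[OF k])
  let ?L = "\<rho> * \<kappa> * min \<delta> 1 * \<delta> / 2 * T" let ?C = "real (Suc K0) * R * (1 + B)"
  have "real (Suc K0) * R * B \<le> ?C" using R_nonneg B_nonneg by (intro mult_left_mono) auto
  \<comment> \<open>Subtracting \<open>?C\<close> for the straddling segment as well keeps all terms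
    uniform.\<close>
  then have "(\<Sum>i=1..Suc K. (if i = j then ?L else 0) - ?C) \<le> (\<Sum>j=1..Suc K. seg (th (j - 1)) (th j) (xi j))"
  proof (intro sum_mono)
    fix i assume i: "i \<in> {1..Suc K}"
    obtain l where "l \<in> {1..Suc K0}" "long (th (i - 1)) (th i) l"
      using exists_long[OF th_len[OF i] th_le_T] i by auto
    from seg_crude[OF this, of "xi i"] have "0 - ?C \<le> seg (th (i - 1)) (th i) (xi i)" by linarith
    moreover have "?L - ?C \<le> seg (th (j - 1)) (th j) (xi j)"
      using m \<open>real (Suc K0) * R * B \<le> ?C\<close> by linarith
    ultimately show "(if i = j then ?L else 0) - ?C \<le> seg (th (i - 1)) (th i) (xi i)"
      by (auto simp only: if_True if_False split: if_split)
  qed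
  then show ?thesis using jin by (simp add: sum_subtractf del: sum.cl_ivl_Suc)
qed

end

end


subsection \<open>Change point times and the penalty\<close>

text \<open>Serves two segmentations: the true regimes clipped to a fitted segment, and, with
  \<open>s = 0\<close> and \<open>s' = T\<close>, the fitted segments themselves.\<close>

lemma sum_split_blocks:
  fixes tau :: "nat \<Rightarrow> nat" and f :: "nat \<Rightarrow> nat \<Rightarrow> real"
  assumes "tau 0 = 0" and mono: "\<And>k. k \<in> {1..n} \<Longrightarrow> tau (k - 1) \<le> tau k"
    and f: "\<And>k t. k \<in> {1..n} \<Longrightarrow> tau (k - 1) < t \<Longrightarrow> t \<le> tau k \<Longrightarrow> f k t = g t"
  shows "(\<Sum>k=1..n. \<Sum>t\<in>{max s (tau (k - 1))<..min s' (tau k)}. f k t) = (\<Sum>t\<in>{s<..min s' (tau n)}. g t)"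
  using mono f
proof (induction n)
  case (Suc n)
  have m: "tau n \<le> tau (Suc n)" using Suc.prems(1)[of "Suc n"] by simp
  have "(\<Sum>k=1..n. \<Sum>t\<in>{max s (tau (k - 1))<..min s' (tau k)}. f k t) = (\<Sum>t\<in>{s<..min s' (tau n)}. g t)"
    using Suc.prems by (intro Suc.IH) auto
  moreover have "(\<Sum>t\<in>{max s (tau n)<..min s' (tau (Suc n))}. f (Suc n) t)
      = (\<Sum>t\<in>{max s (tau n)<..min s' (tau (Suc n))}. g t)"
    using Suc.prems(2)[of "Suc n"] by (intro sum.cong) auto
  moreover have "{s<..min s' (tau (Suc n))} = {s<..min s' (tau n)} \<union> {max s (tau n)<..min s' (tau (Suc n))}"
    using m by auto
  moreover have "{s<..min s' (tau n)} \<inter> {max s (tau n)<..min s' (tau (Suc n))} = {}" by auto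
  ultimately show ?case by (simp add: sum.union_disjoint)
qed (simp add: assms(1))

definition regime :: "(nat \<Rightarrow> nat) \<Rightarrow> nat \<Rightarrow> nat" where
  "regime tau t = (LEAST k. t \<le> tau k)"

lemma regime_eq:
  assumes mono: "\<And>k. k \<in> {1..n} \<Longrightarrow> tau (k - 1) \<le> tau k"
    and k: "k \<in> {1..n}" and t: "tau (k - 1) < t" "t \<le> tau k"
  shows "regime tau t = k"
  unfolding regime_def
proof (rule Least_equality)
  fix j assume j: "t \<le> tau j"
  have le: "tau j \<le> tau (k - 1)" if "j \<le> k - 1"
    using that
  proof (induction j rule: inc_induct)
    case (step i)
    then show ?case using mono[of "Suc i"] k by force
  qed simp
  show "k \<le> j"
  proof (rule ccontr)
    assume "\<not> k \<le> j"
    then have "j \<le> k - 1" by simp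
    from le[OF this] show False using j t(1) by simp
  qed
qed (fact t(2))

lemma cp_time_bounds:
  assumes "lam k \<ge> 0"
  shows "real (cp_time lam T k) \<le> lam k * T" "lam k * T - 1 < real (cp_time lam T k)"
  using assms by (auto simp: cp_time_def)

lemma A_set_less: "lam \<in> A_set \<epsilon> K \<Longrightarrow> i \<le> K \<Longrightarrow> lam i < lam (Suc i)"
  by (force simp: A_set_def)

lemma A_set_nonneg:
  assumes "lam \<in> A_set \<epsilon> K" "k \<le> Suc K"
  shows "lam k \<ge> 0"
  using assms(2)
proof (induction k)
  case (Suc k)
  then have "lam k < lam (Suc k)" by (intro A_set_less[OF assms(1)]) simp
  then show ?case using Suc by simp
qed (use assms(1) in \<open>simp add: A_set_def\<close>)

text \<open>Rounding both ends down shortens a segment by at most one time step, hence the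
  \<open>- 1\<close>.\<close>

lemma A_set_cp_time:
  assumes lam: "lam \<in> A_set \<epsilon> K"
  shows "cp_time lam T 0 = 0" "cp_time lam T (Suc K) = T"
    and "j \<in> {1..Suc K} \<Longrightarrow> real (cp_time lam T (j - 1)) + \<epsilon> * T - 1 \<le> real (cp_time lam T j)"
proof -
  show "cp_time lam T 0 = 0" "cp_time lam T (Suc K) = T"
    using lam by (auto simp: cp_time_def A_set_def)
  assume j: "j \<in> {1..Suc K}"
  then have "lam j - lam (j - 1) \<ge> \<epsilon>" using lam by (auto simp: A_set_def)
  moreover have nn: "lam (j - 1) \<ge> 0" "lam j \<ge> 0"
    using j by (auto intro!: A_set_nonneg[OF lam])
  ultimately have "\<epsilon> * T \<le> (lam j - lam (j - 1)) * T" by (intro mult_right_mono) auto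
  then show "real (cp_time lam T (j - 1)) + \<epsilon> * T - 1 \<le> real (cp_time lam T j)"
    using cp_time_bounds(1)[where lam=lam and k="j - 1" and T=T]
      cp_time_bounds(2)[where lam=lam and k=j and T=T] nn
    by (simp add: left_diff_distrib)
qed

text \<open>Counting from below gives \<open>k \<le> f k\<close>, counting from above gives
  \<open>f k \<le> m - (n - k)\<close>. It is applied to the map from true change points to fitted
  ones near them.\<close>

lemma strictly_increasing_selection:
  fixes f :: "nat \<Rightarrow> nat"
  assumes inc: "\<And>k. 1 \<le> k \<Longrightarrow> k < n \<Longrightarrow> f k < f (Suc k)" and ran: "\<And>k. k \<in> {1..n} \<Longrightarrow> f k \<in> {1..m}"
  shows "n \<le> m" and "m = n \<Longrightarrow> k \<in> {1..n} \<Longrightarrow> f k = k"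
proof -
  have low: "k \<le> f k" if "k \<in> {1..n}" for k
    using that
  proof (induction k)
    case (Suc k)
    show ?case
    proof (cases "k = 0")
      case True
      then show ?thesis using ran[OF Suc.prems] by simp
    next
      case False
      then show ?thesis using Suc inc[of k] by simp
    qed
  qed simp
  have up: "f k + (n - k) \<le> m" if "1 \<le> k" "k \<le> n" for k
    using that(2,1)
  proof (induction k rule: inc_induct)
    case base
    then show ?case using ran[of n] by simp
  next
    case (step k)
    then show ?case using inc[of k] by simp
  qed
  show "n \<le> m"
  proof (cases "n = 0")
    case False
    then show ?thesis using low[of n] ran[of n] by simp
  qed simp
  show "f k = k" if "m = n" "k \<in> {1..n}"
    using low[OF that(2)] up[of k] that by simp
qed

text \<open>Prefix sums with time-dependent probabilities: one maximal inequality then covers all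
  regimes, and windows are differences of two prefixes.\<close>

definition dev :: "('b \<Rightarrow> nat \<Rightarrow> real) \<Rightarrow> (nat \<Rightarrow> 'b) \<Rightarrow> 'b \<Rightarrow> nat \<Rightarrow> real" where
  "dev p Z x s = (\<Sum>t=1..s. of_bool (Z t = x) - p x t)"

lemma dev_diff:
  assumes "s \<le> s'"
  shows "(\<Sum>t\<in>{s<..s'}. of_bool (Z t = x) - p x t) = dev p Z x s' - dev p Z x s"
proof -
  have "{1..s'} = {1..s} \<union> {s<..s'}" using assms by auto
  moreover have "{1..s} \<inter> {s<..s'} = {}" by auto
  ultimately show ?thesis by (simp add: dev_def sum.union_disjoint)
qed

definition MDL_penalty :: "real \<Rightarrow> nat \<Rightarrow> nat \<Rightarrow> (nat \<Rightarrow> nat) \<Rightarrow> real" where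
  "MDL_penalty D T K th = ln (real (K + 1)) + real (K + 1) * ln (real T)
     + (\<Sum>k=1..K + 1. D * ln (real (th k - th (k - 1))))"

definition seg_loss :: "('n::finite \<Rightarrow> real ^ 'd::finite) \<Rightarrow> (nat \<Rightarrow> ('n \<times> 'n) \<times> bool) \<Rightarrow> nat \<Rightarrow> nat
    \<Rightarrow> real ^ ('n + 'd) \<Rightarrow> real" where
  "seg_loss z Z s s' \<xi> = (\<Sum>t\<in>{s<..s'}. loss z (Z t) \<xi>)"

lemma MDL_eq:
  fixes z :: "'n::finite \<Rightarrow> real ^ 'd::finite"
  shows "MDL z T pr y K lam \<xi> = MDL_penalty ((real CARD('n) + real CARD('d) - 1) / 2) T K (cp_time lam T)
     + (\<Sum>k=1..K + 1. seg_loss z (\<lambda>t. (pr t, y t)) (cp_time lam T (k - 1)) (cp_time lam T k) (\<xi> k)) * log 2 (exp 1)"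
proof -
  have "{a + 1..b} = {a<..b}" for a b :: nat by auto
  then show ?thesis
    by (simp add: MDL_def MDL_penalty_def seg_loss_def loss_def del: sum.cl_ivl_Suc)
qed

lemma mdl_minimizer_le:
  assumes "mdl_minimizer z \<epsilon> T pr y (K, lam, \<xi>)"
    and "K' \<le> nat \<lceil>1 / \<epsilon>\<rceil> + 1" "lam' \<in> A_set \<epsilon> K'" "\<forall>k\<in>{1..K' + 1}. \<xi>' k \<in> Theta z"
  shows "2 / real T * MDL z T pr y K lam \<xi> \<le> 2 / real T * MDL z T pr y K' lam' \<xi>'"
proof -
  have "\<not> ((case (K', lam', \<xi>') of (K, lam, \<xi>) \<Rightarrow>
        K \<le> nat \<lceil>1 / \<epsilon>\<rceil> + 1 \<and> lam \<in> A_set \<epsilon> K \<and> (\<forall>k\<in>{1..K + 1}. \<xi> k \<in> Theta z)) \<and>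
      (case (K', lam', \<xi>') of (K, lam, \<xi>) \<Rightarrow> 2 / real T * MDL z T pr y K lam \<xi>)
        < (case (K, lam, \<xi>) of (K, lam, \<xi>) \<Rightarrow> 2 / real T * MDL z T pr y K lam \<xi>))"
    using assms(1) unfolding mdl_minimizer_def is_arg_min_def not_ex by blast
  then show ?thesis unfolding prod.case using assms(2-4) by (meson not_less)
qed

text \<open>With \<open>L\<close> proportional to \<open>T\<close>, this and
  \<open>penalty_upper\<close> determine the penalty as \<open>(K + 1) * (1 + D) * ln T\<close> up
  to a bounded term.\<close>

lemma penalty_lower:
  assumes "D \<ge> 0" "L \<ge> 1" and len: "\<And>k. k \<in> {1..Suc K} \<Longrightarrow> real (th (k - 1)) + L \<le> real (th k)"
  shows "MDL_penalty D T K th \<ge> real (K + 1) * ln (real T) + real (K + 1) * D * ln L"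
proof -
  have "(\<Sum>k=1..K + 1. D * ln L) \<le> (\<Sum>k=1..K + 1. D * ln (real (th k - th (k - 1))))"
  proof (intro sum_mono mult_left_mono assms(1) ln_mono)
    fix k assume "k \<in> {1..K + 1}"
    then have "real (th (k - 1)) + L \<le> real (th k)" using len by simp
    moreover from this have "th (k - 1) \<le> th k" using assms(2) by linarith
    ultimately show "L \<le> real (th k - th (k - 1))" by simp
  qed (use assms(2) in auto)
  then have "real (K + 1) * D * ln L \<le> (\<Sum>k=1..K + 1. D * ln (real (th k - th (k - 1))))"
    by (simp add: mult.assoc del: sum.cl_ivl_Suc)
  moreover have "ln (real (K + 1)) \<ge> 0" by simp
  ultimately show ?thesis unfolding MDL_penalty_def by linarith
qed

lemma penalty_upper:
  assumes "D \<ge> 0" "\<And>k. k \<in> {1..Suc K} \<Longrightarrow> th (k - 1) < th k" "\<And>k. k \<in> {1..Suc K} \<Longrightarrow> th k \<le> T"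
  shows "MDL_penalty D T K th \<le> ln (real (K + 1)) + real (K + 1) * (1 + D) * ln (real T)"
proof -
  have "(\<Sum>k=1..K + 1. D * ln (real (th k - th (k - 1)))) \<le> (\<Sum>k=1..K + 1. D * ln (real T))"
  proof (intro sum_mono mult_left_mono assms(1) ln_mono)
    fix k assume "k \<in> {1..K + 1}"
    then have "th (k - 1) < th k" "th k \<le> T" using assms(2,3) by auto
    then show "0 < real (th k - th (k - 1))" "real (th k - th (k - 1)) \<le> real T" by auto
  qed
  then show ?thesis by (simp add: MDL_penalty_def algebra_simps del: sum.cl_ivl_Suc)
qed

lemma finite_min_pos:
  assumes "finite S" "\<And>k. k \<in> S \<Longrightarrow> \<exists>c>0::real. Q k c" "\<And>k c c'. Q k c \<Longrightarrow> 0 < c' \<Longrightarrow> c' \<le> c \<Longrightarrow> Q k c'"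
  shows "\<exists>c>0. \<forall>k\<in>S. Q k c"
  using assms(1,2)
proof (induction S rule: finite_induct)
  case (insert k S)
  then obtain c c' where "c > 0" "\<forall>k\<in>S. Q k c" "c' > 0" "Q k c'" by blast
  then show ?case by (intro exI[of _ "min c c'"]) (auto intro: assms(3))
qed (auto intro: exI[of _ 1])


subsection \<open>The excess loss of the observations\<close>

locale care_change_points =
  fixes z :: "'n::{finite,linorder} \<Rightarrow> real ^ 'd::finite" and E :: "('n \<times> 'n) set" and q :: "('n \<times> 'n) pmf"
    and K0 :: nat and lam0 :: "nat \<Rightarrow> real" and \<xi>0 :: "nat \<Rightarrow> real ^ ('n + 'd)" and \<epsilon> :: real
  assumes conn: "connected_graph E" and A2: "assumption2 z"
    and E_ne: "E \<noteq> {}" and q_pos: "\<And>e. e \<in> E \<Longrightarrow> pmf q e > 0"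
    and lam0_0: "lam0 0 = 0" and lam0_1: "lam0 (Suc K0) = 1"
    and \<epsilon>_pos: "\<epsilon> > 0" and lam0_gap: "\<And>k. k \<in> {1..Suc K0} \<Longrightarrow> \<epsilon> < lam0 k - lam0 (k - 1)"
    and \<xi>0_Theta: "\<And>k. k \<in> {1..Suc K0} \<Longrightarrow> \<xi>0 k \<in> Theta z"
    and \<xi>0_ne: "\<And>k. k \<in> {1..K0} \<Longrightarrow> \<xi>0 k \<noteq> \<xi>0 (Suc k)"
begin

lemma lam0_A_set: "lam0 \<in> A_set \<epsilon> K0"
  using lam0_0 lam0_1 lam0_gap \<epsilon>_pos by (force simp: A_set_def)

text \<open>The gaps between true change points exceed \<open>\<epsilon>\<close> and sum to 1. The
  bound makes the true segmentation an admissible competitor.\<close>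

lemma K0_le: "K0 \<le> nat \<lceil>1 / \<epsilon>\<rceil> + 1"
proof -
  have "real k * \<epsilon> \<le> lam0 k" if "k \<le> Suc K0" for k
    using that
  proof (induction k)
    case (Suc k)
    then show ?case using lam0_gap[of "Suc k"] by (simp add: algebra_simps)
  qed (simp add: lam0_0)
  from this[of "Suc K0"] have "real (Suc K0) * \<epsilon> \<le> 1" by (simp add: lam0_1)
  then have "real (Suc K0) \<le> 1 / \<epsilon>" using \<epsilon>_pos by (simp add: field_simps)
  then have "real K0 \<le> real_of_int \<lceil>1 / \<epsilon>\<rceil>" by linarith
  then show ?thesis by linarith
qed

definition dist0 :: "nat \<Rightarrow> real ^ ('n + 'd) \<Rightarrow> real" where
  "dist0 k \<xi> = edge_norm z E (\<xi> - \<xi>0 k)"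

lemma dist0_nonneg: "dist0 k \<xi> \<ge> 0"
  by (simp add: dist0_def edge_norm_nonneg)

lemma dist0_triangle: "dist0 k \<xi> \<le> dist0 l \<xi> + edge_norm z E (\<xi>0 l - \<xi>0 k)"
  using edge_norm_triangle[of z E "\<xi> - \<xi>0 l" "\<xi>0 l - \<xi>0 k"] by (simp add: dist0_def)

lemma excess_constant:
  "\<exists>\<kappa>>0. \<forall>k\<in>{1..Suc K0}. \<forall>J Z r \<xi>. finite (J :: nat set) \<longrightarrow> (\<forall>t\<in>J. fst (Z t) \<in> E) \<longrightarrow>
      (\<forall>x. \<bar>\<Sum>t\<in>J. of_bool (Z t = x) - pmf (care_pmf z q (\<xi>0 k)) x\<bar> \<le> r) \<longrightarrow>
      (\<Sum>t\<in>J. loss z (Z t) \<xi> - loss z (Z t) (\<xi>0 k))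
        \<ge> real (card J) * \<kappa> * phi (dist0 k \<xi>) - 2 * r * dist0 k \<xi>"
proof (rule finite_min_pos)
  fix k c c'
  let ?Q = "\<lambda>c. \<forall>J Z r \<xi>. finite (J :: nat set) \<longrightarrow> (\<forall>t\<in>J. fst (Z t) \<in> E) \<longrightarrow>
      (\<forall>x. \<bar>\<Sum>t\<in>J. of_bool (Z t = x) - pmf (care_pmf z q (\<xi>0 k)) x\<bar> \<le> r) \<longrightarrow>
      (\<Sum>t\<in>J. loss z (Z t) \<xi> - loss z (Z t) (\<xi>0 k))
        \<ge> real (card J) * c * phi (dist0 k \<xi>) - 2 * r * dist0 k \<xi>"
  show "\<exists>c>0. ?Q c"
    unfolding dist0_def by (rule loss_excess_lower[OF E_ne q_pos])
  assume Q: "?Q c" and c': "0 < c'" "c' \<le> c"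
  have "real (card J) * c' * phi (dist0 k \<xi>) \<le> real (card J) * c * phi (dist0 k \<xi>)" for J :: "nat set" and \<xi>
    using c' by (intro mult_right_mono mult_left_mono phi_nonneg dist0_nonneg) auto
  then show "?Q c'" using Q by (meson diff_right_mono order_trans)
qed simp

lemma spread_constant:
  "\<exists>B\<ge>0. \<forall>k\<in>{1..Suc K0}. \<forall>l\<in>{1..Suc K0}. \<forall>\<xi>. dist0 k \<xi> \<le> dist0 l \<xi> + B"
proof (intro exI conjI ballI allI)
  let ?B = "\<Sum>k\<in>{1..Suc K0}. \<Sum>l\<in>{1..Suc K0}. edge_norm z E (\<xi>0 l - \<xi>0 k)"
  show "?B \<ge> 0" by (intro sum_nonneg edge_norm_nonneg)
  fix k l \<xi> assume kl: "k \<in> {1..Suc K0}" "l \<in> {1..Suc K0}"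
  have "edge_norm z E (\<xi>0 l - \<xi>0 k) \<le> (\<Sum>l\<in>{1..Suc K0}. edge_norm z E (\<xi>0 l - \<xi>0 k))"
    using kl by (intro member_le_sum edge_norm_nonneg) auto
  also have "\<dots> \<le> ?B"
    using kl by (intro member_le_sum[where f="\<lambda>k. \<Sum>l\<in>{1..Suc K0}. edge_norm z E (\<xi>0 l - \<xi>0 k)"])
      (auto intro!: sum_nonneg edge_norm_nonneg simp del: sum.cl_ivl_Suc)
  finally show "dist0 k \<xi> \<le> dist0 l \<xi> + ?B" using dist0_triangle[of k \<xi> l] by linarith
qed

text \<open>By the triangle inequality it suffices that each jump has positive edge norm, which
  holds because jumps are nonzero vectors of \<open>Theta z\<close>, where the edge norm is
  definite.\<close>

lemma separation_constant: "\<exists>\<delta>>0. \<forall>k\<in>{1..K0}. \<forall>\<xi>. 2 * \<delta> \<le> dist0 k \<xi> + dist0 (Suc k) \<xi>"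
proof (rule finite_min_pos)
  fix k assume k: "k \<in> {1..K0}"
  obtain C where C: "C > 0" "\<And>v. v \<in> Theta z \<Longrightarrow> norm v \<le> C * edge_norm z E v"
    using norm_le_edge_norm[OF conn A2] by blast
  let ?v = "\<xi>0 k - \<xi>0 (Suc k)"
  have "0 < norm ?v" using \<xi>0_ne[OF k] by simp
  also have "norm ?v \<le> C * edge_norm z E ?v"
    using k by (intro C Theta_diff \<xi>0_Theta) auto
  finally have pos: "edge_norm z E ?v > 0" using C(1) by (simp add: zero_less_mult_iff)
  have "edge_norm z E ?v \<le> dist0 k \<xi> + dist0 (Suc k) \<xi>" for \<xi>
    using edge_norm_triangle[of z E "\<xi>0 k - \<xi>" "\<xi> - \<xi>0 (Suc k)"]
    by (simp add: dist0_def edge_norm_minus_commute[of z E _ \<xi>])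
  then show "\<exists>\<delta>>0. \<forall>\<xi>. 2 * \<delta> \<le> dist0 k \<xi> + dist0 (Suc k) \<xi>"
    using pos by (intro exI[of _ "edge_norm z E ?v / 2"]) auto
next
  fix k :: nat and c c' :: real
  assume "\<forall>\<xi>. 2 * c \<le> dist0 k \<xi> + dist0 (Suc k) \<xi>" "c' \<le> c"
  then show "\<forall>\<xi>. 2 * c' \<le> dist0 k \<xi> + dist0 (Suc k) \<xi>" by (meson mult_left_mono order_trans zero_le_numeral)
qed simp

definition excess :: "(nat \<Rightarrow> ('n \<times> 'n) \<times> bool) \<Rightarrow> nat \<Rightarrow> nat \<Rightarrow> real ^ ('n + 'd) \<Rightarrow> real" where
  "excess Z k t \<xi> = loss z (Z t) \<xi> - loss z (Z t) (\<xi>0 k)"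

text \<open>
  \<open>p x t\<close> stands for the probability of the observation \<open>x\<close> at time \<open>t\<close>. The last bound controls the
  short pieces next to a true change point, for which the uniform bound \<open>r\<close> is too weak.
\<close>

definition good :: "nat \<Rightarrow> (nat \<Rightarrow> ('n \<times> 'n) \<times> bool) \<Rightarrow> (('n \<times> 'n) \<times> bool \<Rightarrow> nat \<Rightarrow> real) \<Rightarrow> real \<Rightarrow> real \<Rightarrow> real \<Rightarrow> bool" where
  "good T Z p r c a \<longleftrightarrow> (\<forall>t\<in>{1..T}. fst (Z t) \<in> E) \<and> (\<forall>x. \<forall>s\<le>T. \<bar>dev p Z x s\<bar> \<le> r) \<and>
     (\<forall>x. \<forall>k\<in>{1..K0}. \<forall>s\<le>T. \<bar>dev p Z x s - dev p Z x (cp_time lam0 T k)\<bar>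
        \<le> c * \<bar>real s - real (cp_time lam0 T k)\<bar> + a)"

text \<open>The loss bound doubles the deviation of the counts. A general window is a difference of
  two prefixes, each within \<open>r\<close>, which gives \<open>4 * r\<close>; for a window that
  touches a true change point \<open>good\<close> bounds this difference itself, which gives
  \<open>2 * c\<close> and \<open>2 * a\<close>.\<close>

lemma good_bounds:
  assumes good: "good T Z p r c a"
    and p: "\<And>k t x. k \<in> {1..Suc K0} \<Longrightarrow> cp_time lam0 T (k - 1) < t \<Longrightarrow> t \<le> cp_time lam0 T k \<Longrightarrow>
        p x t = pmf (care_pmf z q (\<xi>0 k)) x"
    and \<kappa>: "\<kappa> > 0" "\<And>k J Z r \<xi>. k \<in> {1..Suc K0} \<Longrightarrow> finite (J :: nat set) \<Longrightarrow> (\<forall>t\<in>J. fst (Z t) \<in> E) \<Longrightarrow>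
      (\<forall>x. \<bar>\<Sum>t\<in>J. of_bool (Z t = x) - pmf (care_pmf z q (\<xi>0 k)) x\<bar> \<le> r) \<Longrightarrow>
      (\<Sum>t\<in>J. loss z (Z t) \<xi> - loss z (Z t) (\<xi>0 k))
        \<ge> real (card J) * \<kappa> * phi (dist0 k \<xi>) - 2 * r * dist0 k \<xi>"
    and B: "B \<ge> 0" "\<And>k l \<xi>. k \<in> {1..Suc K0} \<Longrightarrow> l \<in> {1..Suc K0} \<Longrightarrow> dist0 k \<xi> \<le> dist0 l \<xi> + B"
    and \<delta>: "\<delta> > 0" "\<And>k \<xi>. k \<in> {1..K0} \<Longrightarrow> 2 * \<delta> \<le> dist0 k \<xi> + dist0 (Suc k) \<xi>"
    and T: "T > 0" and \<rho>: "\<rho> > 0" "\<rho> \<le> \<epsilon> / 4" "\<epsilon> * T \<ge> 2"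
    and nn: "r \<ge> 0" "a \<ge> 0" and c: "2 * c \<le> \<kappa> * min \<delta> 1"
    and R: "2 * (real (Suc K0) * (4 * r)) \<le> \<rho> * \<kappa> * min \<delta> 1 * T"
      "real (Suc K0) * (4 * r) * B \<le> \<rho> * \<kappa> * min \<delta> 1 * \<delta> / 2 * T"
  shows "change_point_bounds T K0 (cp_time lam0 T) (excess Z) dist0 \<kappa> B \<delta> (4 * r) (2 * c) (2 * a) \<rho>"
proof
  note tau = A_set_cp_time(1,2)[OF lam0_A_set, of T]
  note tau_gap = A_set_cp_time(3)[OF lam0_A_set, where T=T]
  show "cp_time lam0 T 0 = 0" "cp_time lam0 T (Suc K0) = T" by (fact tau)+
  have sp: "real (cp_time lam0 T (k - 1)) + \<rho> * T \<le> real (cp_time lam0 T k)" if "k \<in> {1..Suc K0}" for k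
  proof -
    have "\<rho> * T \<le> \<epsilon> / 4 * T" using \<rho> by (intro mult_right_mono) auto
    then show ?thesis using tau_gap[OF that] \<rho>(3) by simp
  qed
  then show "real (cp_time lam0 T (k - 1)) + \<rho> * T \<le> real (cp_time lam0 T k)" if "k \<in> {1..Suc K0}" for k
    using that .
  have le_T: "cp_time lam0 T k \<le> T" if "k \<le> Suc K0" for k
    using that
  proof (induction k rule: inc_induct)
    case (step k)
    have "\<rho> * T \<ge> 0" using \<rho> by simp
    moreover have "real (cp_time lam0 T k) + \<rho> * T \<le> real (cp_time lam0 T (Suc k))" using sp[of "Suc k"] step by simp
    ultimately have "real (cp_time lam0 T k) \<le> real (cp_time lam0 T (Suc k))" by linarith
    then show ?case using step.IH by linarith
  qed (simp add: tau)
  have gen: "(\<Sum>t\<in>{s<..s'}. excess Z k t \<xi>) \<ge> real (s' - s) * \<kappa> * phi (dist0 k \<xi>) - 2 * r' * dist0 k \<xi>"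
    if k: "k \<in> {1..Suc K0}" and s: "cp_time lam0 T (k - 1) \<le> s" "s \<le> s'" "s' \<le> cp_time lam0 T k"
      and dv: "\<And>x. \<bar>dev p Z x s' - dev p Z x s\<bar> \<le> r'" for k s s' \<xi> r'
  proof -
    have "(\<Sum>t\<in>{s<..s'}. loss z (Z t) \<xi> - loss z (Z t) (\<xi>0 k))
        \<ge> real (card {s<..s'}) * \<kappa> * phi (dist0 k \<xi>) - 2 * r' * dist0 k \<xi>"
    proof (rule \<kappa>(2)[OF k])
      show "\<forall>t\<in>{s<..s'}. fst (Z t) \<in> E"
        using good s le_T[of k] k by (auto simp: good_def)
      show "\<forall>x. \<bar>\<Sum>t\<in>{s<..s'}. of_bool (Z t = x) - pmf (care_pmf z q (\<xi>0 k)) x\<bar> \<le> r'"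
      proof
        fix x
        have "(\<Sum>t\<in>{s<..s'}. of_bool (Z t = x) - pmf (care_pmf z q (\<xi>0 k)) x)
            = (\<Sum>t\<in>{s<..s'}. of_bool (Z t = x) - p x t)"
          using s by (intro sum.cong) (auto simp: p[OF k])
        also have "\<dots> = dev p Z x s' - dev p Z x s" by (rule dev_diff[OF s(2)])
        finally show "\<bar>\<Sum>t\<in>{s<..s'}. of_bool (Z t = x) - pmf (care_pmf z q (\<xi>0 k)) x\<bar> \<le> r'"
          using dv by simp
      qed
    qed simp
    then show ?thesis by (simp add: excess_def)
  qed
  fix k s s' \<xi>
  assume k: "k \<in> {1..Suc K0}" and s: "cp_time lam0 T (k - 1) \<le> s" "s \<le> s'" "s' \<le> cp_time lam0 T k"
  have sT: "s \<le> T" "s' \<le> T" using s le_T[of k] k by auto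
  have "\<bar>dev p Z x s' - dev p Z x s\<bar> \<le> 2 * r" for x
  proof -
    have "\<bar>dev p Z x s'\<bar> \<le> r" "\<bar>dev p Z x s\<bar> \<le> r" using good sT unfolding good_def by blast+
    then show ?thesis by linarith
  qed
  from gen[OF k s this, of \<xi>]
  show "real (s' - s) * \<kappa> * phi (dist0 k \<xi>) - 4 * r * dist0 k \<xi> \<le> (\<Sum>t\<in>{s<..s'}. excess Z k t \<xi>)" by simp
  assume near: "(k \<ge> 2 \<and> s = cp_time lam0 T (k - 1)) \<or> (k \<le> K0 \<and> s' = cp_time lam0 T k)"
  have "\<bar>dev p Z x s' - dev p Z x s\<bar> \<le> c * real (s' - s) + a" for x
    using near
  proof
    assume *: "k \<ge> 2 \<and> s = cp_time lam0 T (k - 1)"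
    then have "k - 1 \<in> {1..K0}" using k by auto
    then have "\<bar>dev p Z x s' - dev p Z x s\<bar> \<le> c * \<bar>real s' - real s\<bar> + a"
      using good sT * unfolding good_def by blast
    then show ?thesis using s(2) by simp
  next
    assume *: "k \<le> K0 \<and> s' = cp_time lam0 T k"
    then have "k \<in> {1..K0}" using k by auto
    then have "\<bar>dev p Z x s - dev p Z x s'\<bar> \<le> c * \<bar>real s - real s'\<bar> + a"
      using good sT * unfolding good_def by blast
    then show ?thesis using s(2) by (simp add: abs_minus_commute)
  qed
  from gen[OF k s this, of \<xi>]
  show "real (s' - s) * \<kappa> * phi (dist0 k \<xi>) - (2 * c * real (s' - s) + 2 * a) * dist0 k \<xi> \<le> (\<Sum>t\<in>{s<..s'}. excess Z k t \<xi>)"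
    by (simp add: algebra_simps)
qed (use \<kappa>(1) B \<delta> T \<rho> nn c R dist0_nonneg in auto)

end


subsection \<open>Minimizers of the criterion\<close>

locale care_good = care_change_points z E q K0 lam0 \<xi>0 \<epsilon> +
    cb: change_point_bounds T K0 "cp_time lam0 T" "excess Z" dist0 \<kappa> B \<delta> R c a \<rho>
  for z :: "'n::{finite,linorder} \<Rightarrow> real ^ 'd::finite" and E :: "('n \<times> 'n) set" and q :: "('n \<times> 'n) pmf"
    and K0 :: nat and lam0 :: "nat \<Rightarrow> real" and \<xi>0 :: "nat \<Rightarrow> real ^ ('n + 'd)" and \<epsilon> :: real
    and T :: nat and Z :: "nat \<Rightarrow> ('n \<times> 'n) \<times> bool" and \<kappa> B \<delta> R c a \<rho> :: real +
  assumes \<rho>_le: "\<rho> \<le> \<epsilon> / 4" and \<epsilon>T: "\<epsilon> * T \<ge> 2"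
begin

abbreviation tau :: "nat \<Rightarrow> nat" where "tau \<equiv> cp_time lam0 T"

text \<open>A baseline that is independent of the fitted segmentation, so it cancels when two
  candidates are compared.\<close>

definition loss0 :: "nat \<Rightarrow> real" where
  "loss0 t = loss z (Z t) (\<xi>0 (regime tau t))"

lemma tau_mono: "k \<in> {1..Suc K0} \<Longrightarrow> tau (k - 1) \<le> tau k"
proof -
  assume "k \<in> {1..Suc K0}"
  from cb.spacing[OF this] have "real (tau (k - 1)) \<le> real (tau k)"
    using cb.\<rho>_pos by (smt (verit) mult_nonneg_nonneg of_nat_0_le_iff)
  then show ?thesis by simp
qed

lemma seg_eq:
  assumes "s' \<le> T"
  shows "cb.seg s s' \<xi> = seg_loss z Z s s' \<xi> - (\<Sum>t\<in>{s<..s'}. loss0 t)"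
proof -
  have "(\<Sum>k=1..Suc K0. \<Sum>t\<in>{max s (tau (k - 1))<..min s' (tau k)}. excess Z k t \<xi>)
      = (\<Sum>t\<in>{s<..min s' (tau (Suc K0))}. loss z (Z t) \<xi> - loss0 t)"
  proof (rule sum_split_blocks)
    fix k t assume "k \<in> {1..Suc K0}" "tau (k - 1) < t" "t \<le> tau k"
    then have "regime tau t = k" by (intro regime_eq[where n="Suc K0"] tau_mono)
    then show "excess Z k t \<xi> = loss z (Z t) \<xi> - loss0 t" by (simp add: excess_def loss0_def)
  qed (simp_all only: cb.tau_0 tau_mono)
  moreover have "min s' (tau (Suc K0)) = s'" using assms cb.tau_T by simp
  ultimately show ?thesis
    by (simp add: cb.seg_def cb.part_def cb.lo_def cb.hi_def seg_loss_def sum_subtractf del: sum.cl_ivl_Suc)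
qed

text \<open>For \<open>\<epsilon> * T \<ge> 2\<close> the rounding error costs at most half of
  \<open>\<epsilon> * T\<close>, and the other half is at least \<open>2 * \<rho> * T\<close> by
  \<open>\<rho>_le\<close>.\<close>

lemma A_set_len:
  assumes "lam \<in> A_set \<epsilon> K" "j \<in> {1..Suc K}"
  shows "real (cp_time lam T (j - 1)) + 2 * \<rho> * T \<le> real (cp_time lam T j)"
proof -
  have "2 * \<rho> * T \<le> 2 * (\<epsilon> / 4) * T" using \<rho>_le by (intro mult_right_mono mult_left_mono) auto
  then show ?thesis using A_set_cp_time(3)[OF assms(1), where T=T and j=j] assms(2) \<epsilon>T by simp
qed

lemma A_set_le_T:
  assumes "lam \<in> A_set \<epsilon> K" "j \<le> Suc K"
  shows "cp_time lam T j \<le> T"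
  by (rule cb.th_le_T[of "cp_time lam T" K, OF A_set_cp_time(1,2)[OF assms(1)] A_set_len[OF assms(1)] assms(2)])

lemma sum_loss0:
  assumes lam: "lam \<in> A_set \<epsilon> K"
  shows "(\<Sum>j=1..Suc K. \<Sum>t\<in>{cp_time lam T (j - 1)<..cp_time lam T j}. loss0 t) = (\<Sum>t\<in>{0<..T}. loss0 t)"
proof -
  let ?th = "cp_time lam T"
  have mono: "?th (k - 1) \<le> ?th k" if "k \<in> {1..Suc K}" for k
  proof -
    have "2 * \<rho> * T \<ge> 0" using cb.\<rho>_pos by simp
    then have "real (?th (k - 1)) \<le> real (?th k)" using A_set_len[OF lam that] by linarith
    then show ?thesis by simp
  qed
  have le: "?th j \<le> T" if "j \<le> Suc K" for j
    using A_set_le_T[OF lam that] .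
  have "(\<Sum>j=1..Suc K. \<Sum>t\<in>{max 0 (?th (j - 1))<..min T (?th j)}. loss0 t) = (\<Sum>t\<in>{0<..min T (?th (Suc K))}. loss0 t)"
    by (rule sum_split_blocks) (simp_all only: A_set_cp_time(1)[OF lam] mono)
  moreover have "(\<Sum>j=1..Suc K. \<Sum>t\<in>{max 0 (?th (j - 1))<..min T (?th j)}. loss0 t)
      = (\<Sum>j=1..Suc K. \<Sum>t\<in>{?th (j - 1)<..?th j}. loss0 t)"
    using le by (intro sum.cong) (auto simp: min_absorb2)
  ultimately show ?thesis using A_set_cp_time(2)[OF lam, of T] by simp
qed

lemma total_loss:
  assumes lam: "lam \<in> A_set \<epsilon> K"
  shows "(\<Sum>j=1..Suc K. seg_loss z Z (cp_time lam T (j - 1)) (cp_time lam T j) (\<xi> j))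
     = (\<Sum>j=1..Suc K. cb.seg (cp_time lam T (j - 1)) (cp_time lam T j) (\<xi> j)) + (\<Sum>t\<in>{0<..T}. loss0 t)"
proof -
  have le: "cp_time lam T j \<le> T" if "j \<le> Suc K" for j
    using A_set_le_T[OF lam that] .
  have "(\<Sum>j=1..Suc K. seg_loss z Z (cp_time lam T (j - 1)) (cp_time lam T j) (\<xi> j))
      = (\<Sum>j=1..Suc K. cb.seg (cp_time lam T (j - 1)) (cp_time lam T j) (\<xi> j)
          + (\<Sum>t\<in>{cp_time lam T (j - 1)<..cp_time lam T j}. loss0 t))"
  proof (rule sum.cong)
    fix j assume "j \<in> {1..Suc K}"
    then have "cp_time lam T j \<le> T" using le by simp
    from seg_eq[OF this] show "seg_loss z Z (cp_time lam T (j - 1)) (cp_time lam T j) (\<xi> j)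
        = cb.seg (cp_time lam T (j - 1)) (cp_time lam T j) (\<xi> j)
          + (\<Sum>t\<in>{cp_time lam T (j - 1)<..cp_time lam T j}. loss0 t)" by simp
  qed simp
  also have "\<dots> = (\<Sum>j=1..Suc K. cb.seg (cp_time lam T (j - 1)) (cp_time lam T j) (\<xi> j)) + (\<Sum>t\<in>{0<..T}. loss0 t)"
    unfolding sum.distrib sum_loss0[OF lam] ..
  finally show ?thesis .
qed

lemma total_loss_true:
  "(\<Sum>j=1..Suc K0. seg_loss z Z (tau (j - 1)) (tau j) (\<xi>0 j)) = (\<Sum>t\<in>{0<..T}. loss0 t)"
proof -
  have "(\<Sum>j=1..Suc K0. seg_loss z Z (tau (j - 1)) (tau j) (\<xi>0 j))
      = (\<Sum>j=1..Suc K0. \<Sum>t\<in>{tau (j - 1)<..tau j}. loss0 t)"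
    unfolding seg_loss_def
  proof (intro sum.cong refl)
    fix k t assume "k \<in> {1..Suc K0}" "t \<in> {tau (k - 1)<..tau k}"
    then have "regime tau t = k" by (intro regime_eq[where n="Suc K0"] tau_mono) auto
    then show "loss z (Z t) (\<xi>0 k) = loss0 t" by (simp add: loss0_def)
  qed
  then show ?thesis using sum_loss0[OF lam0_A_set] by simp
qed

text \<open>Every admissible segment has a long part in some regime \<open>l\<close>, and its drift
  makes the loss coercive around \<open>\<xi>0 l\<close>. Separated data cannot occur under the
  deviation bounds.\<close>

lemma seg_loss_attains_min:
  assumes len: "real s + 2 * \<rho> * T \<le> real s'" and s': "s' \<le> T"
  shows "\<exists>\<xi>\<in>Theta z. \<forall>\<eta>\<in>Theta z. seg_loss z Z s s' \<xi> \<le> seg_loss z Z s s' \<eta>"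
proof -
  obtain l where l: "l \<in> {1..Suc K0}" "cb.long s s' l"
    using cb.exists_long[OF len s'] by blast
  let ?A = "\<rho> * \<kappa> * T" and ?R = "real (Suc K0) * R"
  have A: "?A > 0" using cb.\<rho>_pos cb.\<kappa>_pos cb.T_pos by simp
  have "\<rho> * \<kappa> * min \<delta> 1 * T \<le> \<rho> * \<kappa> * 1 * T"
    using cb.\<rho>_pos cb.\<kappa>_pos by (intro mult_right_mono mult_left_mono) auto
  then have R: "2 * ?R \<le> ?A" using cb.R_small by linarith
  define Q where "Q = cb.seg s s' (\<xi>0 l) + ?R * B"
  show ?thesis
  proof (rule coercive_attains_min[OF conn A2 _ \<xi>0_Theta[OF l(1)]])
    have "1 + exp v \<noteq> 0" for v :: real using exp_gt_zero[of v] by linarith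
    then show "continuous_on UNIV (seg_loss z Z s s')"
      unfolding seg_loss_def[abs_def] loss_def by (intro continuous_intros) auto
    fix \<xi> assume "seg_loss z Z s s' \<xi> \<le> seg_loss z Z s s' (\<xi>0 l)"
    then have "cb.seg s s' \<xi> \<le> cb.seg s s' (\<xi>0 l)" by (simp add: seg_eq[OF s'])
    with cb.seg_lower[OF l, of \<xi>] have le: "?A * phi (dist0 l \<xi>) - ?R * dist0 l \<xi> \<le> Q"
      by (simp add: Q_def distrib_left)
    \<comment> \<open>Beyond distance 1 the drift is linear and the noise takes at most half of it,
      so the remaining half has slope \<open>?A / 2\<close> and must stay below
      \<open>Q\<close>.\<close>
    show "edge_norm z E (\<xi> - \<xi>0 l) \<le> max 1 (2 * Q / ?A)"
    proof (cases "dist0 l \<xi> \<le> 1")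
      case True
      then show ?thesis by (simp add: dist0_def)
    next
      case False
      then have ph: "phi (dist0 l \<xi>) = dist0 l \<xi>" by (simp add: phi_def power2_eq_square)
      have "?R * dist0 l \<xi> \<le> ?A / 2 * dist0 l \<xi>"
        using R dist0_nonneg by (intro mult_right_mono) auto
      moreover have "?A * dist0 l \<xi> = ?A / 2 * dist0 l \<xi> + ?A / 2 * dist0 l \<xi>" by simp
      ultimately have "?A / 2 * dist0 l \<xi> \<le> Q" using le unfolding ph by linarith
      then have "dist0 l \<xi> \<le> 2 * Q / ?A" using A by (simp add: field_simps)
      then show ?thesis by (simp add: dist0_def)
    qed
  qed
qed

definition opt :: "nat \<Rightarrow> nat \<Rightarrow> real ^ ('n + 'd)" where
  "opt s s' = (SOME \<xi>. \<xi> \<in> Theta z \<and> (\<forall>\<eta>\<in>Theta z. seg_loss z Z s s' \<xi> \<le> seg_loss z Z s s' \<eta>))"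

lemma opt:
  assumes "real s + 2 * \<rho> * T \<le> real s'" "s' \<le> T"
  shows "opt s s' \<in> Theta z" "\<eta> \<in> Theta z \<Longrightarrow> seg_loss z Z s s' (opt s s') \<le> seg_loss z Z s s' \<eta>"
proof -
  have "\<exists>\<xi>. \<xi> \<in> Theta z \<and> (\<forall>\<eta>\<in>Theta z. seg_loss z Z s s' \<xi> \<le> seg_loss z Z s s' \<eta>)"
    using seg_loss_attains_min[OF assms] by blast
  from someI_ex[OF this] show "opt s s' \<in> Theta z"
    "\<eta> \<in> Theta z \<Longrightarrow> seg_loss z Z s s' (opt s s') \<le> seg_loss z Z s s' \<eta>"
    unfolding opt_def by blast+
qed

definition crit :: "nat \<Rightarrow> (nat \<Rightarrow> nat) \<Rightarrow> (nat \<Rightarrow> real ^ ('n + 'd)) \<Rightarrow> real" where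
  "crit K th \<xi> = MDL_penalty ((real CARD('n) + real CARD('d) - 1) / 2) T K th
     + (\<Sum>k=1..K + 1. seg_loss z Z (th (k - 1)) (th k) (\<xi> k)) * log 2 (exp 1)"

text \<open>The criterion sees \<open>\<lambda>\<close> only through the finitely many possible change point times.\<close>

lemma exists_minimizer:
  assumes pr: "\<And>t. Z t = (pr t, y t)"
  shows "\<exists>m. mdl_minimizer z \<epsilon> T pr y m"
proof -
  let ?M = "nat \<lceil>1 / \<epsilon>\<rceil> + 1"
  \<comment> \<open>Minimizing over the parameters first leaves a problem in \<open>K\<close> and
    the integer times alone.\<close>
  define best where "best th k = opt (th (k - 1)) (th k)" for th :: "nat \<Rightarrow> nat" and k
  define S where "S = {(K, lam). K \<le> ?M \<and> lam \<in> A_set \<epsilon> K}"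
  define V where "V = (\<lambda>(K, lam). crit K (cp_time lam T) (best (cp_time lam T))) ` S"
  have Z: "Z = (\<lambda>t. (pr t, y t))" using pr by auto
  have crit: "MDL z T pr y K lam \<xi> = crit K (cp_time lam T) \<xi>" for K lam \<xi>
    unfolding MDL_eq crit_def by (simp only: Z[symmetric])
  have th_le: "cp_time lam T j \<le> T" if "lam \<in> A_set \<epsilon> K" "j \<le> Suc K" for K lam j
    using A_set_le_T[OF that] .
  have "V \<subseteq> (\<lambda>(K, th). crit K th (best th)) ` (SIGMA K:{..?M}. PiE {0..Suc K} (\<lambda>_. {..T}))"
  proof
    fix v assume "v \<in> V"
    then obtain K lam where K: "K \<le> ?M" "lam \<in> A_set \<epsilon> K"
      and v: "v = crit K (cp_time lam T) (best (cp_time lam T))"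
      by (auto simp: V_def S_def)
    \<comment> \<open>\<open>lam\<close> is arbitrary outside \<open>{0..Suc K}\<close>; restricting
      its times yields an element of a finite set of functions.\<close>
    let ?th = "restrict (cp_time lam T) {0..Suc K}"
    have "v = crit K ?th (best ?th)"
      unfolding v crit_def MDL_penalty_def best_def
      by (intro arg_cong2[where f="(+)"] arg_cong2[where f="(*)"] sum.cong refl) auto
    moreover have "?th \<in> PiE {0..Suc K} (\<lambda>_. {..T})"
      using th_le[OF K(2)] by auto
    ultimately show "v \<in> (\<lambda>(K, th). crit K th (best th)) ` (SIGMA K:{..?M}. PiE {0..Suc K} (\<lambda>_. {..T}))"
      using K(1) by (intro image_eqI[of _ _ "(K, ?th)"]) auto
  qed
  then have "finite V" by (rule finite_subset) (intro finite_imageI finite_SigmaI finite_PiE, auto)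
  moreover have "(K0, lam0) \<in> S" using K0_le lam0_A_set by (simp add: S_def)
  then have "V \<noteq> {}" by (auto simp: V_def)
  ultimately have "Min V \<in> V" "\<And>v. v \<in> V \<Longrightarrow> Min V \<le> v" by auto
  then obtain K lam where K: "K \<le> ?M" "lam \<in> A_set \<epsilon> K"
    and min: "\<And>K' lam'. K' \<le> ?M \<Longrightarrow> lam' \<in> A_set \<epsilon> K' \<Longrightarrow>
      crit K (cp_time lam T) (best (cp_time lam T)) \<le> crit K' (cp_time lam' T) (best (cp_time lam' T))"
    by (force simp: V_def S_def)
  have best: "crit K' (cp_time lam' T) (best (cp_time lam' T)) \<le> crit K' (cp_time lam' T) \<xi>"
    if "lam' \<in> A_set \<epsilon> K'" "\<forall>k\<in>{1..K' + 1}. \<xi> k \<in> Theta z" for K' lam' \<xi>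
    unfolding crit_def best_def
  proof (intro add_left_mono mult_right_mono sum_mono)
    fix k assume "k \<in> {1..K' + 1}"
    then show "seg_loss z Z (cp_time lam' T (k - 1)) (cp_time lam' T k) (opt (cp_time lam' T (k - 1)) (cp_time lam' T k))
        \<le> seg_loss z Z (cp_time lam' T (k - 1)) (cp_time lam' T k) (\<xi> k)"
      using that(2) by (intro opt A_set_len[OF that(1)] th_le[OF that(1)]) auto
  qed (simp add: log_def)
  have "mdl_minimizer z \<epsilon> T pr y (K, lam, best (cp_time lam T))"
    unfolding mdl_minimizer_def is_arg_min_def
  proof (intro conjI notI)
    have "best (cp_time lam T) k \<in> Theta z" if "k \<in> {1..K + 1}" for k
      using that unfolding best_def by (intro opt A_set_len[OF K(2)] th_le[OF K(2)]) auto
    then show "case (K, lam, best (cp_time lam T)) of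
        (K, lam, \<xi>) \<Rightarrow> K \<le> ?M \<and> lam \<in> A_set \<epsilon> K \<and> (\<forall>k\<in>{1..K + 1}. \<xi> k \<in> Theta z)"
      using K by simp
    assume "\<exists>m'. (case m' of (K, lam, \<xi>) \<Rightarrow> K \<le> ?M \<and> lam \<in> A_set \<epsilon> K \<and> (\<forall>k\<in>{1..K + 1}. \<xi> k \<in> Theta z)) \<and>
        (case m' of (K, lam, \<xi>) \<Rightarrow> 2 / real T * MDL z T pr y K lam \<xi>)
          < (case (K, lam, best (cp_time lam T)) of (K, lam, \<xi>) \<Rightarrow> 2 / real T * MDL z T pr y K lam \<xi>)"
    then obtain K' lam' \<xi> where 1: "K' \<le> ?M" "lam' \<in> A_set \<epsilon> K'" "\<forall>k\<in>{1..K' + 1}. \<xi> k \<in> Theta z"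
      and 2: "2 / real T * MDL z T pr y K' lam' \<xi> < 2 / real T * MDL z T pr y K lam (best (cp_time lam T))"
      by auto
    have "MDL z T pr y K' lam' \<xi> < MDL z T pr y K lam (best (cp_time lam T))"
      using 2 cb.T_pos by (simp add: divide_strict_right_mono mult_less_cancel_left_pos field_simps)
    then show False using min[OF 1(1,2)] best[OF 1(2,3)] unfolding crit by linarith
  qed
  then show ?thesis by blast
qed

text \<open>The last two assumptions hold for large \<open>T\<close>: \<open>R\<close> is \<open>o(T)\<close> and \<open>R\<^sup>2 / T\<close>, \<open>a\<close> are \<open>o(log T)\<close>.\<close>

lemma minimizer_close:
  fixes K :: nat and lam :: "nat \<Rightarrow> real"
  defines "D \<equiv> (real CARD('n) + real CARD('d) - 1) / 2" and "M \<equiv> nat \<lceil>1 / \<epsilon>\<rceil> + 1" and "c2 \<equiv> log 2 (exp 1)"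
  assumes pr: "\<And>t. Z t = (pr t, y t)" and min: "mdl_minimizer z \<epsilon> T pr y (K, lam, \<xi>)"
    and \<rho>T: "\<rho> * T \<ge> 1"
    and big1: "c2 * (real (Suc M) * (real (Suc K0) * R * (1 + B))) + ln (real (K0 + 1)) + real (K0 + 1) * (1 + D) * ln (real T)
        < c2 * (\<rho> * \<kappa> * min \<delta> 1 * \<delta> / 2 * T)"
    and big2: "c2 * (real (Suc M) * (real (Suc K0) * (R\<^sup>2 / (4 * (\<rho> * \<kappa> * T)) + a * (B + \<delta>))))
        + ln (real (K0 + 1)) + real (Suc M) * D * \<bar>ln (2 * \<rho>)\<bar> < ln (real T)"
  shows "K = K0" and "\<And>k. k \<in> {1..K0} \<Longrightarrow> \<bar>lam k - lam0 k\<bar> \<le> 2 * \<rho>"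
proof -
  let ?th = "cp_time lam T"
  have K: "K \<le> M" "lam \<in> A_set \<epsilon> K" "\<forall>k\<in>{1..K + 1}. \<xi> k \<in> Theta z"
    using min unfolding mdl_minimizer_def is_arg_min_def M_def by auto
  have Z: "Z = (\<lambda>t. (pr t, y t))" using pr by auto
  have T1: "ln (real T) \<ge> 0" using cb.T_pos by simp
  have D0: "D \<ge> 0"
  proof -
    have "real CARD('n) \<ge> 1" by (simp add: Suc_le_eq)
    then have "real CARD('n) + real CARD('d) - 1 \<ge> 0" by linarith
    then show ?thesis unfolding D_def by (rule divide_nonneg_nonneg) simp
  qed
  have c2: "c2 > 0" by (simp add: c2_def log_def)
  note th = A_set_cp_time(1,2)[OF K(2), of T] A_set_len[OF K(2)]
  \<comment> \<open>The true segmentation with the true parameters is the competitor.\<close>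
  have "2 / real T * MDL z T pr y K lam \<xi> \<le> 2 / real T * MDL z T pr y K0 lam0 \<xi>0"
    using \<xi>0_Theta K0_le lam0_A_set by (intro mdl_minimizer_le[OF min]) auto
  then have le: "MDL z T pr y K lam \<xi> \<le> MDL z T pr y K0 lam0 \<xi>0"
    using cb.T_pos by (simp add: divide_le_cancel)
  define S where "S = (\<Sum>j=1..Suc K. cb.seg (?th (j - 1)) (?th j) (\<xi> j))"
  have main: "MDL_penalty D T K ?th + c2 * S \<le> MDL_penalty D T K0 tau"
  proof -
    have 1: "MDL z T pr y K lam \<xi> = MDL_penalty D T K ?th + (S + (\<Sum>t\<in>{0<..T}. loss0 t)) * c2"
      using total_loss[OF K(2), of \<xi>] unfolding MDL_eq D_def c2_def S_def Z[symmetric] by simp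
    have 2: "MDL z T pr y K0 lam0 \<xi>0 = MDL_penalty D T K0 tau + (\<Sum>t\<in>{0<..T}. loss0 t) * c2"
      using total_loss_true unfolding MDL_eq D_def c2_def Z[symmetric] by simp
    show ?thesis using le unfolding 1 2 by (simp add: algebra_simps)
  qed
  have up: "MDL_penalty D T K0 tau \<le> ln (real (K0 + 1)) + real (K0 + 1) * (1 + D) * ln (real T)"
  proof (rule penalty_upper[OF D0])
    fix k assume k: "k \<in> {1..Suc K0}"
    show "tau (k - 1) < tau k" using cb.spacing[OF k] \<rho>T by linarith
    show "tau k \<le> T" using k by (intro cb.tau_le_T) simp
  qed
  have low: "MDL_penalty D T K ?th \<ge> real (K + 1) * ln (real T) + real (K + 1) * D * ln (2 * \<rho> * T)"
    using \<rho>T by (intro penalty_lower[OF D0] th(3)) auto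
  have found: "\<exists>j\<in>{1..K}. \<bar>real (?th j) - real (tau k)\<bar> \<le> \<rho> * T" if k: "k \<in> {1..K0}" for k
  proof (rule ccontr)
    assume "\<not> ?thesis"
    then have "\<bar>real (?th j) - real (tau k)\<bar> > \<rho> * T" if "j \<in> {1..K}" for j
      using that by (meson not_le)
    from cb.total_missed[OF th k this, of \<xi>]
    have "S \<ge> \<rho> * \<kappa> * min \<delta> 1 * \<delta> / 2 * T - real (Suc K) * (real (Suc K0) * R * (1 + B))"
      by (simp add: S_def)
    moreover have "real (Suc K) * (real (Suc K0) * R * (1 + B)) \<le> real (Suc M) * (real (Suc K0) * R * (1 + B))"
      using K(1) cb.R_nonneg cb.B_nonneg by (intro mult_right_mono) auto
    ultimately have "S \<ge> \<rho> * \<kappa> * min \<delta> 1 * \<delta> / 2 * T - real (Suc M) * (real (Suc K0) * R * (1 + B))"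
      by linarith
    then have "c2 * S \<ge> c2 * (\<rho> * \<kappa> * min \<delta> 1 * \<delta> / 2 * T - real (Suc M) * (real (Suc K0) * R * (1 + B)))"
      using c2 by (intro mult_left_mono) auto
    moreover have "MDL_penalty D T K ?th \<ge> 0"
    proof -
      have "real (K + 1) * ln (real T) + real (K + 1) * D * ln (2 * \<rho> * T) \<ge> 0"
        using T1 D0 \<rho>T by (intro add_nonneg_nonneg mult_nonneg_nonneg ln_ge_zero T1) auto
      then show ?thesis using low by linarith
    qed
    ultimately show False using main up big1 by (simp only: right_diff_distrib)
  qed
  then obtain f where f: "\<And>k. k \<in> {1..K0} \<Longrightarrow> f k \<in> {1..K}"
      "\<And>k. k \<in> {1..K0} \<Longrightarrow> \<bar>real (?th (f k)) - real (tau k)\<bar> \<le> \<rho> * T"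
    by metis
  \<comment> \<open>Passing from times back to fractions costs one time step of rounding, which is
    at most \<open>\<rho> * T\<close>; hence \<open>2 * \<rho>\<close>.\<close>
  have close: "\<bar>lam (f k) - lam0 k\<bar> \<le> 2 * \<rho>" if k: "k \<in> {1..K0}" for k
  proof -
    have "lam (f k) \<ge> 0" using f(1)[OF k] by (intro A_set_nonneg[OF K(2)]) auto
    note b1 = cp_time_bounds[where lam=lam and k="f k" and T=T, OF this]
    have "lam0 k \<ge> 0" using k by (intro A_set_nonneg[OF lam0_A_set]) auto
    note b2 = cp_time_bounds[where lam=lam0 and k=k and T=T, OF this]
    have "\<bar>lam (f k) * T - lam0 k * T\<bar> \<le> \<rho> * T + 1"
      using f(2)[OF k] b1 b2 by linarith
    also have "\<dots> \<le> (2 * \<rho>) * T" using \<rho>T by simp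
    also have "\<bar>lam (f k) * T - lam0 k * T\<bar> = \<bar>lam (f k) - lam0 k\<bar> * T"
      by (simp add: abs_mult flip: left_diff_distrib)
    finally show ?thesis using cb.T_pos by (simp add: mult_le_cancel_right)
  qed
  have lam_mono: "lam i \<le> lam j" if "i \<le> j" "j \<le> Suc K" for i j
    using that
  proof (induction i rule: inc_induct)
    case (step i)
    then have "lam i < lam (Suc i)" by (intro A_set_less[OF K(2)]) simp
    then show ?case using step by simp
  qed simp
  \<comment> \<open>True change points are more than \<open>\<epsilon> \<ge> 4 * \<rho>\<close>
    apart, so neighbourhoods of radius \<open>2 * \<rho>\<close> keep their order.\<close>
  have inc: "f k < f (Suc k)" if "1 \<le> k" "k < K0" for k
  proof (rule ccontr)
    assume "\<not> f k < f (Suc k)"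
    moreover have "k \<in> {1..K0}" "Suc k \<in> {1..K0}" using that by auto
    ultimately have "lam (f (Suc k)) \<le> lam (f k)" using f(1)[of k] by (intro lam_mono) auto
    then show False
      using close[of k] close[of "Suc k"] that lam0_gap[of "Suc k"] \<rho>_le by simp
  qed
  have "K0 \<le> K"
    by (rule strictly_increasing_selection(1)[of K0 f]) (use inc f(1) in auto)
  show KK: "K = K0"
  proof (rule ccontr)
    assume "K \<noteq> K0"
    then have gt: "real K \<ge> real K0 + 1" using \<open>K0 \<le> K\<close> by linarith
    have "- (real (Suc K) * (real (Suc K0) * (R\<^sup>2 / (4 * (\<rho> * \<kappa> * T)) + a * (B + \<delta>)))) \<le> S"
      unfolding S_def by (rule cb.total_tight[OF th])
    moreover have "real (Suc K) * (real (Suc K0) * (R\<^sup>2 / (4 * (\<rho> * \<kappa> * T)) + a * (B + \<delta>)))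
        \<le> real (Suc M) * (real (Suc K0) * (R\<^sup>2 / (4 * (\<rho> * \<kappa> * T)) + a * (B + \<delta>)))"
      using K(1) cb.a_nonneg cb.B_nonneg cb.\<delta>_pos cb.\<rho>_pos cb.\<kappa>_pos
      by (intro mult_right_mono mult_nonneg_nonneg add_nonneg_nonneg) auto
    ultimately have "- (real (Suc M) * (real (Suc K0) * (R\<^sup>2 / (4 * (\<rho> * \<kappa> * T)) + a * (B + \<delta>)))) \<le> S"
      by linarith
    then have "c2 * - (real (Suc M) * (real (Suc K0) * (R\<^sup>2 / (4 * (\<rho> * \<kappa> * T)) + a * (B + \<delta>)))) \<le> c2 * S"
      using c2 by (intro mult_left_mono) auto
    then have S: "- (c2 * (real (Suc M) * (real (Suc K0) * (R\<^sup>2 / (4 * (\<rho> * \<kappa> * T)) + a * (B + \<delta>))))) \<le> c2 * S"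
      by simp
    have lnT: "ln (2 * \<rho> * T) = ln (2 * \<rho>) + ln (real T)"
      using cb.\<rho>_pos cb.T_pos by (simp add: ln_mult)
    have "real (K + 1) * D * (- \<bar>ln (2 * \<rho>)\<bar>) \<le> real (K + 1) * D * ln (2 * \<rho>)"
      using D0 by (intro mult_left_mono) auto
    moreover have "real (K + 1) * D * \<bar>ln (2 * \<rho>)\<bar> \<le> real (Suc M) * D * \<bar>ln (2 * \<rho>)\<bar>"
      using K(1) D0 by (intro mult_right_mono) auto
    ultimately have l1: "real (K + 1) * D * ln (2 * \<rho>) \<ge> - (real (Suc M) * D * \<bar>ln (2 * \<rho>)\<bar>)"
      by simp
    have "1 * 1 \<le> (real K - real K0) * (1 + D)"
      using gt D0 by (intro mult_mono) auto
    then have "1 * ln (real T) \<le> (real K - real K0) * (1 + D) * ln (real T)"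
      using T1 by (intro mult_right_mono) auto
    then have l2: "real (K + 1) * ln (real T) + real (K + 1) * D * ln (real T)
        \<ge> real (K0 + 1) * (1 + D) * ln (real T) + ln (real T)"
      by (simp add: algebra_simps)
    have "real (K + 1) * D * ln (2 * \<rho> * T) = real (K + 1) * D * ln (2 * \<rho>) + real (K + 1) * D * ln (real T)"
      unfolding lnT by (rule distrib_left)
    then show False using main up low S l1 l2 big2 by linarith
  qed
  show "\<bar>lam k - lam0 k\<bar> \<le> 2 * \<rho>" if "k \<in> {1..K0}" for k
  proof -
    have "f k = k"
      by (rule strictly_increasing_selection(2)[of K0 f K]) (use inc f(1) KK that in auto)
    then show ?thesis using close[OF that] by simp
  qed
qed

end


subsection \<open>Deviations of the empirical counts\<close>

lemma geometric_tail_le: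
  fixes q :: real
  assumes "0 < q" "q < 1"
  shows "(\<Sum>m=l..n. q ^ m) \<le> q ^ l / (1 - q)"
  using assms by (auto simp: sum_gp intro!: divide_right_mono)

text \<open>\<open>max s k - min s k\<close> is the distance of \<open>s\<close> and
  \<open>k\<close> in natural numbers, and every distance occurs at most once on each side of
  \<open>k\<close>.\<close>

lemma two_sided_geometric_le:
  fixes q :: real
  assumes q: "0 < q" "q < 1"
  shows "(\<Sum>s\<in>{s. s \<le> n \<and> l \<le> (max s k - min s k :: nat)}. q ^ (max s k - min s k)) \<le> 2 * (q ^ l / (1 - q))"
proof -
  let ?S1 = "{s. s \<le> n \<and> l \<le> s - k \<and> k \<le> s}" and ?S2 = "{s. s \<le> n \<and> l \<le> k - s \<and> s < k}"
  have "{s. s \<le> n \<and> l \<le> (max s k - min s k :: nat)} = ?S1 \<union> ?S2" by (auto simp: max_def min_def)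
  then have "(\<Sum>s\<in>{s. s \<le> n \<and> l \<le> (max s k - min s k :: nat)}. q ^ (max s k - min s k))
      = (\<Sum>s\<in>?S1. q ^ (s - k)) + (\<Sum>s\<in>?S2. q ^ (k - s))"
    by (simp only:, subst sum.union_disjoint) (auto simp: max_def min_def intro!: arg_cong2[where f="(+)"] sum.cong)
  also have "(\<Sum>s\<in>?S1. q ^ (s - k)) = (\<Sum>m\<in>(\<lambda>s. s - k) ` ?S1. q ^ m)"
    by (subst sum.reindex) (auto simp: inj_on_def)
  also have "\<dots> \<le> (\<Sum>m=l..n. q ^ m)"
    using q by (intro sum_mono2) auto
  also have "(\<Sum>s\<in>?S2. q ^ (k - s)) = (\<Sum>m\<in>(\<lambda>s. k - s) ` ?S2. q ^ m)"
    by (subst sum.reindex) (auto simp: inj_on_def)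
  also have "\<dots> \<le> (\<Sum>m=l..k. q ^ m)"
    using q by (intro sum_mono2) auto
  finally show ?thesis using geometric_tail_le[OF q, of l n] geometric_tail_le[OF q, of l k] by linarith
qed

context prob_space
begin

context
  fixes Z :: "nat \<Rightarrow> 'a \<Rightarrow> 'b::finite" and n :: nat and p :: "'b \<Rightarrow> nat \<Rightarrow> real"
  assumes indep: "indep_vars (\<lambda>_. count_space UNIV) Z {1..n}"
    and p_def: "\<And>x t. p x t = prob {\<omega> \<in> space M. Z t \<omega> = x}"
begin

lemma Z_meas: "t \<in> {1..n} \<Longrightarrow> Z t \<in> measurable M (count_space UNIV)"
  using indep by (auto simp: indep_vars_def)

lemma Z_event: "t \<in> {1..n} \<Longrightarrow> {\<omega> \<in> space M. Z t \<omega> \<in> A} \<in> events"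
  using measurable_sets[OF Z_meas, of t A] by (simp add: vimage_def Int_def conj_commute)

lemma dev_meas: "s \<le> n \<Longrightarrow> (\<lambda>\<omega>. dev p (\<lambda>t. Z t \<omega>) x s) \<in> borel_measurable M"
  unfolding dev_def
proof (intro borel_measurable_sum borel_measurable_diff borel_measurable_const)
  fix t assume "s \<le> n" "t \<in> {1..s}"
  then have [measurable]: "Z t \<in> measurable M (count_space UNIV)" by (intro Z_meas) auto
  show "(\<lambda>\<omega>. of_bool (Z t \<omega> = x) :: real) \<in> borel_measurable M" by measurable
qed

lemma expectation_of_bool: "t \<in> {1..n} \<Longrightarrow> expectation (\<lambda>\<omega>. of_bool (Z t \<omega> = x)) = p x t"
proof -
  assume t: "t \<in> {1..n}"
  have "expectation (\<lambda>\<omega>. of_bool (Z t \<omega> = x)) = expectation (indicator {\<omega> \<in> space M. Z t \<omega> = x})"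
    by (intro Bochner_Integration.integral_cong) (auto simp: indicator_def)
  also have "\<dots> = p x t"
    using Z_event[OF t, of "{x}"] by (simp add: p_def)
  finally show ?thesis .
qed

lemma dev_overall:
  assumes r: "r > 0"
  shows "{\<omega> \<in> space M. \<exists>s\<le>n. \<bar>dev p (\<lambda>t. Z t \<omega>) x s\<bar> \<ge> r} \<in> events"
    and "prob {\<omega> \<in> space M. \<exists>s\<le>n. \<bar>dev p (\<lambda>t. Z t \<omega>) x s\<bar> \<ge> r} \<le> real n / r\<^sup>2"
proof -
  have "{\<omega> \<in> space M. \<exists>s\<le>n. \<bar>dev p (\<lambda>t. Z t \<omega>) x s\<bar> \<ge> r}
      = (\<Union>s\<in>{..n}. {\<omega> \<in> space M. \<bar>dev p (\<lambda>t. Z t \<omega>) x s\<bar> \<ge> r})" by auto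
  also have "\<dots> \<in> events"
  proof (intro sets.finite_UN)
    fix s assume "s \<in> {..n}"
    then have [measurable]: "(\<lambda>\<omega>. dev p (\<lambda>t. Z t \<omega>) x s) \<in> borel_measurable M" by (simp add: dev_meas)
    show "{\<omega> \<in> space M. \<bar>dev p (\<lambda>t. Z t \<omega>) x s\<bar> \<ge> r} \<in> events" by measurable
  qed simp
  finally show "{\<omega> \<in> space M. \<exists>s\<le>n. \<bar>dev p (\<lambda>t. Z t \<omega>) x s\<bar> \<ge> r} \<in> events" .
  have ind: "indep_vars (\<lambda>_. borel) (\<lambda>t \<omega>. of_bool (Z t \<omega> = x) - p x t) {1..n}"
    by (rule indep_vars_compose2[OF indep]) simp
  show "prob {\<omega> \<in> space M. \<exists>s\<le>n. \<bar>dev p (\<lambda>t. Z t \<omega>) x s\<bar> \<ge> r} \<le> real n / r\<^sup>2"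
    unfolding dev_def
  proof (rule kolmogorov_maximal_ineq[OF ind _ _ r])
    fix t assume t: "t \<in> {1..n}"
    have "integrable M (\<lambda>\<omega>. of_bool (Z t \<omega> = x) :: real)"
      using Z_meas[OF t] by (intro integrable_const_bound[where B=1]) auto
    then show "expectation (\<lambda>\<omega>. of_bool (Z t \<omega> = x) - p x t) = 0"
      using expectation_of_bool[OF t] by (simp add: prob_space)
    show "\<bar>of_bool (Z t \<omega> = x) - p x t\<bar> \<le> 1" for \<omega>
      using prob_le_1[of "{\<omega> \<in> space M. Z t \<omega> = x}"] measure_nonneg[of M "{\<omega> \<in> space M. Z t \<omega> = x}"]
      by (simp add: p_def del: prob_le_1 measure_nonneg)
  qed
qed

text \<open>Over \<open>m\<close> steps the deviation is at most \<open>m\<close>, so exceeding the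
  slack \<open>a\<close> forces \<open>m > a\<close>. From there on Hoeffding's inequality with
  slope \<open>c\<close> is summed as a geometric series. The 4 is 2 from Hoeffding times 2
  sides.\<close>

lemma dev_near:
  fixes x
  assumes k: "k \<le> n" and c: "c > 0" and a: "a \<ge> 0"
  defines "D \<equiv> \<lambda>\<omega> s. \<bar>dev p (\<lambda>t. Z t \<omega>) x s - dev p (\<lambda>t. Z t \<omega>) x k\<bar>"
  shows "{\<omega> \<in> space M. \<exists>s\<le>n. D \<omega> s > c * \<bar>real s - real k\<bar> + a} \<in> events"
    and "prob {\<omega> \<in> space M. \<exists>s\<le>n. D \<omega> s > c * \<bar>real s - real k\<bar> + a}
      \<le> 4 * exp (- 2 * c\<^sup>2 * a) / (1 - exp (- 2 * c\<^sup>2))"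
proof -
  have D_meas: "(\<lambda>\<omega>. D \<omega> s) \<in> borel_measurable M" if "s \<le> n" for s
    unfolding D_def using dev_meas[OF that, of x] dev_meas[OF k, of x] by measurable
  have "{\<omega> \<in> space M. \<exists>s\<le>n. D \<omega> s > c * \<bar>real s - real k\<bar> + a}
      = (\<Union>s\<in>{..n}. {\<omega> \<in> space M. D \<omega> s > c * \<bar>real s - real k\<bar> + a})" by auto
  also have "\<dots> \<in> events"
  proof (intro sets.finite_UN)
    fix s assume "s \<in> {..n}"
    then have [measurable]: "(\<lambda>\<omega>. D \<omega> s) \<in> borel_measurable M" by (simp add: D_meas)
    show "{\<omega> \<in> space M. D \<omega> s > c * \<bar>real s - real k\<bar> + a} \<in> events" by measurable
  qed simp
  finally show "{\<omega> \<in> space M. \<exists>s\<le>n. D \<omega> s > c * \<bar>real s - real k\<bar> + a} \<in> events" .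
  define q where "q = exp (- 2 * c\<^sup>2)"
  have q: "0 < q" "q < 1" using c by (simp_all add: q_def)
  define m where "m s = max s k - min s k" for s
  have m: "real (m s) = \<bar>real s - real k\<bar>" for s by (auto simp: m_def max_def min_def)
  define l where "l = nat \<lceil>a\<rceil>"
  \<comment> \<open>\<open>0 < m s\<close> excludes \<open>s = k\<close>, where the window is empty
    and Hoeffding's inequality does not apply; it matters when \<open>l\<close> is 0.\<close>
  define S where "S = {s. s \<le> n \<and> l \<le> m s \<and> 0 < m s}"
  define B where "B s = {\<omega> \<in> space M. D \<omega> s \<ge> c * real (m s)}" for s
  have B_ev: "B s \<in> events" if "s \<in> S" for s
  proof -
    have [measurable]: "(\<lambda>\<omega>. D \<omega> s) \<in> borel_measurable M" using that by (intro D_meas) (simp add: S_def)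
    show ?thesis unfolding B_def by measurable
  qed
  have D_eq: "D \<omega> s = \<bar>\<Sum>t\<in>{min s k<..max s k}. of_bool (Z t \<omega> = x) - p x t\<bar>" for \<omega> s
    unfolding D_def by (subst dev_diff) (auto simp: max_def min_def abs_minus_commute)
  have B_le: "prob (B s) \<le> 2 * q ^ m s" if "s \<in> S" for s
  proof -
    have sub: "{min s k<..max s k} \<subseteq> {1..n}" using that k by (auto simp: S_def)
    have ne: "{min s k<..max s k} \<noteq> {}" using that by (auto simp: S_def m_def)
    have "indep_vars (\<lambda>_. borel) (\<lambda>t \<omega>. of_bool (Z t \<omega> = x) :: real) {1..n}"
      by (rule indep_vars_compose2[OF indep]) simp
    from indep_vars_subset[OF this sub]
    have h: "prob {\<omega> \<in> space M. \<bar>\<Sum>t\<in>{min s k<..max s k}. of_bool (Z t \<omega> = x) - expectation (\<lambda>\<omega>. of_bool (Z t \<omega> = x))\<bar>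
          \<ge> c * real (card {min s k<..max s k})} \<le> 2 * exp (- 2 * c\<^sup>2) ^ card {min s k<..max s k}"
      using ne c by (intro hoeffding_unit_interval) auto
    have eq: "(\<Sum>t\<in>{min s k<..max s k}. of_bool (Z t \<omega> = x) - expectation (\<lambda>\<omega>. of_bool (Z t \<omega> = x)))
        = (\<Sum>t\<in>{min s k<..max s k}. of_bool (Z t \<omega> = x) - p x t)" for \<omega>
      using sub by (intro sum.cong refl) (auto simp: expectation_of_bool)
    have cd: "card {min s k<..max s k} = m s" by (simp add: m_def)
    show ?thesis unfolding B_def D_eq q_def using h by (simp only: eq cd)
  qed
  have ql: "q ^ l \<le> exp (- 2 * c\<^sup>2 * a)"
  proof -
    have "a \<le> real l" unfolding l_def by linarith
    then have "c\<^sup>2 * a \<le> c\<^sup>2 * real l" by (intro mult_left_mono) auto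
    moreover have "q ^ l = exp (- 2 * c\<^sup>2 * real l)"
      unfolding q_def exp_of_nat_mult[symmetric] by (simp add: mult_ac)
    ultimately show ?thesis by simp
  qed
  have "prob {\<omega> \<in> space M. \<exists>s\<le>n. D \<omega> s > c * \<bar>real s - real k\<bar> + a} \<le> prob (\<Union>s\<in>S. B s)"
  proof (rule finite_measure_mono)
    show "{\<omega> \<in> space M. \<exists>s\<le>n. D \<omega> s > c * \<bar>real s - real k\<bar> + a} \<subseteq> (\<Union>s\<in>S. B s)"
    proof safe
      fix \<omega> s assume \<omega>: "\<omega> \<in> space M" and s: "s \<le> n" and gt: "D \<omega> s > c * \<bar>real s - real k\<bar> + a"
      have "D \<omega> s \<le> (\<Sum>t\<in>{min s k<..max s k}. 1)"
        unfolding D_eq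
      proof (rule order_trans[OF sum_abs], rule sum_mono)
        fix t
        show "\<bar>of_bool (Z t \<omega> = x) - p x t\<bar> \<le> 1"
          using prob_le_1[of "{\<omega> \<in> space M. Z t \<omega> = x}"] measure_nonneg[of M "{\<omega> \<in> space M. Z t \<omega> = x}"]
          by (simp add: p_def del: prob_le_1 measure_nonneg)
      qed
      then have "D \<omega> s \<le> real (m s)" by (simp add: m_def)
      moreover have cm: "c * real (m s) \<ge> 0" using c by simp
      ultimately have "a < real (m s)" using gt unfolding m[symmetric] by linarith
      then have "l \<le> m s" "0 < m s" using a unfolding l_def by linarith+
      then have "s \<in> S" using s by (simp add: S_def)
      moreover have "\<omega> \<in> B s" using \<omega> gt a unfolding B_def m[symmetric] by simp
      ultimately show "\<omega> \<in> (\<Union>s\<in>S. B s)" by blast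
    qed
    show "(\<Union>s\<in>S. B s) \<in> events" using B_ev by (intro sets.finite_UN) (auto simp: S_def)
  qed
  also have "\<dots> \<le> (\<Sum>s\<in>S. prob (B s))"
    using B_ev by (intro finite_measure_subadditive_finite) (auto simp: S_def)
  also have "\<dots> \<le> (\<Sum>s\<in>S. 2 * q ^ m s)" by (intro sum_mono B_le)
  also have "\<dots> \<le> (\<Sum>s\<in>{s. s \<le> n \<and> l \<le> max s k - min s k}. 2 * q ^ m s)"
    using q by (intro sum_mono2) (auto simp: S_def m_def)
  also have "\<dots> = 2 * (\<Sum>s\<in>{s. s \<le> n \<and> l \<le> max s k - min s k}. q ^ (max s k - min s k))"
    by (simp add: sum_distrib_left m_def)
  also have "\<dots> \<le> 2 * (2 * (q ^ l / (1 - q)))"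
    by (intro mult_left_mono two_sided_geometric_le q) simp
  also have "2 * (2 * (q ^ l / (1 - q))) \<le> 4 * exp (- 2 * c\<^sup>2 * a) / (1 - q)"
    using q ql by (simp add: divide_right_mono)
  finally show "prob {\<omega> \<in> space M. \<exists>s\<le>n. D \<omega> s > c * \<bar>real s - real k\<bar> + a}
      \<le> 4 * exp (- 2 * c\<^sup>2 * a) / (1 - exp (- 2 * c\<^sup>2))"
    by (simp add: q_def)
qed

end

end

lemma eventually_sublinear:
  assumes A: "(A::real) > 0"
  shows "eventually (\<lambda>T. C1 * sqrt (real T * sqrt (ln (real T))) + C2 * ln (real T) + C3 < A * real T) sequentially"
  using A by real_asymp

lemma eventually_sublog:
  shows "eventually (\<lambda>T. C1 * sqrt (ln (real T)) + C2 < ln (real T)) sequentially"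
  by real_asymp


subsection \<open>Consistency\<close>

lemma set_pmf_care: "set_pmf (care_pmf z q \<xi>) \<subseteq> {x. fst x \<in> set_pmf q}"
  by (auto simp: care_pmf_def)

theorem theorem1:
  fixes P :: "nat \<Rightarrow> 'w measure"
    and z :: "'n::{finite,linorder} \<Rightarrow> real ^ 'd::finite"
    and E :: "('n \<times> 'n) set"
    and q :: "('n \<times> 'n) pmf"
    and K0 :: nat
    and lam0 :: "nat \<Rightarrow> real"
    and \<xi>0 :: "nat \<Rightarrow> real ^ ('n + 'd)"
    and pr :: "nat \<Rightarrow> nat \<Rightarrow> 'w \<Rightarrow> 'n \<times> 'n"
    and y :: "nat \<Rightarrow> nat \<Rightarrow> 'w \<Rightarrow> bool"
    and \<epsilon> :: real
    and Kh :: "nat \<Rightarrow> 'w \<Rightarrow> nat"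
    and lamh :: "nat \<Rightarrow> 'w \<Rightarrow> nat \<Rightarrow> real"
    and \<xi>h :: "nat \<Rightarrow> 'w \<Rightarrow> nat \<Rightarrow> real ^ ('n + 'd)"
  assumes "E \<subseteq> {(i, j). i < j}" and "connected_graph E"
    and "set_pmf q \<subseteq> E"
    and "ps_care P z q K0 lam0 \<xi>0 pr y"
    and "assumption1 z" and "assumption2 z" and "assumption3 P z E K0 lam0 pr"
    and "\<epsilon> > 0" and "\<forall>k\<in>{1..K0 + 1}. \<epsilon> < lam0 k - lam0 (k - 1)"
    and "mdl_estimator P z \<epsilon> pr y Kh lamh \<xi>h"
  shows "tendsto_in_prob P (\<lambda>T \<omega>. real (Kh T \<omega>)) (real K0) \<and>
         cp_tendsto_in_prob P Kh lamh K0 lam0"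
proof -
  define X where "X T t \<omega> = (pr T t \<omega>, y T t \<omega>)" for T t \<omega>
  have P: "prob_space (P T)" for T
    using assms(4) by (simp add: ps_care_def)
  have indep: "prob_space.indep_vars (P T) (\<lambda>_. count_space UNIV) (X T) {1..T}" for T
    using assms(4) by (simp add: ps_care_def X_def[abs_def])
  have distr: "distr (P T) (count_space UNIV) (X T t) = measure_pmf (care_pmf z q (\<xi>0 k))"
    if "k \<in> {1..Suc K0}" "cp_time lam0 T (k - 1) < t" "t \<le> cp_time lam0 T k" for T t k
    using assms(4) that by (auto simp: ps_care_def X_def[abs_def])
  have lam0: "lam0 \<in> A_set \<epsilon> K0"
    using assms(4,8,9) by (force simp: A_set_def ps_care_def)
  note tau0 = A_set_cp_time(1)[OF lam0] and tauT = A_set_cp_time(2)[OF lam0]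
  have tau_mono: "cp_time lam0 T i \<le> cp_time lam0 T j" if "i \<le> j" "j \<le> Suc K0" for T i j
    using that
  proof (induction i rule: inc_induct)
    case (step i)
    have "lam0 i < lam0 (Suc i)" using step by (intro A_set_less[OF lam0]) simp
    then have "cp_time lam0 T i \<le> cp_time lam0 T (Suc i)"
      unfolding cp_time_def by (intro nat_mono floor_mono mult_right_mono) auto
    then show ?case using step by simp
  qed simp
  have regime_ex: "\<exists>k\<in>{1..Suc K0}. cp_time lam0 T (k - 1) < t \<and> t \<le> cp_time lam0 T k"
    if "t \<in> {1..T}" for T t
  proof -
    define k where "k = (LEAST k. t \<le> cp_time lam0 T k)"
    have "t \<le> cp_time lam0 T (Suc K0)" using that tauT by simp
    then have k: "t \<le> cp_time lam0 T k" "k \<le> Suc K0"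
      unfolding k_def by (rule LeastI, intro Least_le)
    have "k \<noteq> 0" using k(1) tau0[of T] that by (cases k) auto
    then have "\<not> t \<le> cp_time lam0 T (k - 1)"
      unfolding k_def by (intro not_less_Least) simp
    then show ?thesis using k \<open>k \<noteq> 0\<close> by (intro bexI[of _ k]) auto
  qed
  have X_meas: "X T t \<in> measurable (P T) (count_space UNIV)" if "t \<in> {1..T}" for T t
    using indep[of T] that by (auto simp: prob_space.indep_vars_def[OF P])
  have in_T: "t \<in> {1..T}" if "k \<in> {1..Suc K0}" "cp_time lam0 T (k - 1) < t" "t \<le> cp_time lam0 T k" for T t k
    using that tau_mono[of k "Suc K0" T] tauT[of T] by auto
  have X_prob: "measure (P T) {\<omega> \<in> space (P T). X T t \<omega> \<in> A} = measure (measure_pmf (care_pmf z q (\<xi>0 k))) A"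
    if k: "k \<in> {1..Suc K0}" "cp_time lam0 T (k - 1) < t" "t \<le> cp_time lam0 T k" for T t k A
  proof -
    have "measure (distr (P T) (count_space UNIV) (X T t)) A = measure (P T) (X T t -` A \<inter> space (P T))"
      using X_meas[OF in_T[OF k]] by (intro measure_distr) auto
    then show ?thesis unfolding distr[OF k] by (simp add: vimage_def Int_def conj_commute)
  qed
  have X_null: "measure (P T) {\<omega> \<in> space (P T). X T t \<omega> \<in> A} = 0"
    if t: "t \<in> {1..T}" and A: "A \<inter> {x. fst x \<in> set_pmf q} = {}" for T t A
  proof -
    obtain k where k: "k \<in> {1..Suc K0}" "cp_time lam0 T (k - 1) < t" "t \<le> cp_time lam0 T k"
      using regime_ex[OF t] by blast
    show ?thesis
      unfolding X_prob[OF k] measure_pmf_zero_iff using set_pmf_care[of z q "\<xi>0 k"] A by blast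
  qed
  have X_event: "{\<omega> \<in> space (P T). X T t \<omega> \<in> A} \<in> sets (P T)" if "t \<in> {1..T}" for T t A
    using measurable_sets[OF X_meas[OF that], of A] by (simp add: vimage_def Int_def conj_commute)
  have null_Un: "measure (P T) {\<omega> \<in> space (P T). \<exists>t\<in>{1..T}. X T t \<omega> \<in> A} = 0"
      "{\<omega> \<in> space (P T). \<exists>t\<in>{1..T}. X T t \<omega> \<in> A} \<in> sets (P T)"
    if "A \<inter> {x. fst x \<in> set_pmf q} = {}" for T A
  proof -
    interpret prob_space "P T" by (rule P)
    have eq: "{\<omega> \<in> space (P T). \<exists>t\<in>{1..T}. X T t \<omega> \<in> A} = (\<Union>t\<in>{1..T}. {\<omega> \<in> space (P T). X T t \<omega> \<in> A})"
      by auto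
    show "{\<omega> \<in> space (P T). \<exists>t\<in>{1..T}. X T t \<omega> \<in> A} \<in> sets (P T)"
      unfolding eq using X_event by (intro sets.finite_UN) auto
    have "measure (P T) (\<Union>t\<in>{1..T}. {\<omega> \<in> space (P T). X T t \<omega> \<in> A})
        \<le> (\<Sum>t\<in>{1..T}. measure (P T) {\<omega> \<in> space (P T). X T t \<omega> \<in> A})"
      using X_event by (intro finite_measure_subadditive_finite) auto
    also have "\<dots> = 0" using X_null[OF _ that] by (intro sum.neutral) auto
    finally show "measure (P T) {\<omega> \<in> space (P T). \<exists>t\<in>{1..T}. X T t \<omega> \<in> A} = 0"
      unfolding eq by (simp add: measure_le_0_iff)
  qed

  have card_n: "CARD('n) \<ge> 2"
    using assms(7) by (auto simp: assumption3_def)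
  have E_ne: "E \<noteq> {}"
  proof
    assume "E = {}"
    then have "i = j" for i j :: 'n using assms(2) by (simp add: connected_graph_def)
    then have "card (UNIV :: 'n set) \<le> Suc 0" by (simp add: card_le_Suc0_iff_eq)
    then show False using card_n by simp
  qed
  \<comment> \<open>The model puts the law \<open>q\<close> on \<open>E\<close>, and Assumption 3
    forces it to charge every edge: an edge that is never drawn gives \<open>L_min = 0\<close>
    almost surely, which violates the strict second bound, so the probability in the assumption
    would be 0 for all \<open>T\<close>.\<close>
  have q_E: "E \<subseteq> set_pmf q"
  proof
    fix e assume e: "e \<in> E"
    show "e \<in> set_pmf q"
    proof (rule ccontr)
      assume nq: "e \<notin> set_pmf q"
      obtain c1 c2 cp C where cp: "cp > 0" and lim:
        "(\<lambda>T. measure (P T) {\<omega> \<in> space (P T). \<forall>k\<in>{1..K0 + 1}.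
             let s = cp_time lam0 T (k - 1); s' = cp_time lam0 T k;
                 n = real CARD('n); L = real (L_min E (\<lambda>t. pr T t \<omega>) s s'); tk = real (s' - s)
             in L \<le> c1 T * n powr c2 T \<and> n * L / tk > cp * ln n \<and>
                (real CARD('d) + 1) * ln n \<le> C * (n * L / tk)}) \<longlonglongrightarrow> 1"
        using assms(7) unfolding assumption3_def by blast
      have "measure (P T) {\<omega> \<in> space (P T). \<forall>k\<in>{1..K0 + 1}.
             let s = cp_time lam0 T (k - 1); s' = cp_time lam0 T k;
                 n = real CARD('n); L = real (L_min E (\<lambda>t. pr T t \<omega>) s s'); tk = real (s' - s)
             in L \<le> c1 T * n powr c2 T \<and> n * L / tk > cp * ln n \<and>
                (real CARD('d) + 1) * ln n \<le> C * (n * L / tk)} = 0" (is "measure _ ?ev = 0") for T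
      proof -
        interpret prob_space "P T" by (rule P)
        let ?N = "{\<omega> \<in> space (P T). \<exists>t\<in>{1..T}. X T t \<omega> \<in> {e} \<times> UNIV}"
        have "?ev \<subseteq> ?N"
        proof
          fix \<omega> assume "\<omega> \<in> ?ev"
          then have \<omega>: "\<omega> \<in> space (P T)" and gt: "real CARD('n) * real (L_min E (\<lambda>t. pr T t \<omega>) (cp_time lam0 T 0) (cp_time lam0 T 1))
              / real (cp_time lam0 T 1 - cp_time lam0 T 0) > cp * ln (real CARD('n))"
            by (auto simp: Let_def dest!: bspec[of _ _ 1])
          have "cp * ln (real CARD('n)) \<ge> 0" using cp card_n by simp
          then have "L_min E (\<lambda>t. pr T t \<omega>) (cp_time lam0 T 0) (cp_time lam0 T 1) \<noteq> 0"
            using gt by (intro notI) simp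
          moreover have "L_min E (\<lambda>t. pr T t \<omega>) (cp_time lam0 T 0) (cp_time lam0 T 1)
              \<le> card {t \<in> {cp_time lam0 T 0<..cp_time lam0 T 1}. pr T t \<omega> = e}"
            unfolding L_min_def using e by (intro Min_le) auto
          ultimately have "card {t \<in> {cp_time lam0 T 0<..cp_time lam0 T 1}. pr T t \<omega> = e} \<noteq> 0"
            by linarith
          then have "{t \<in> {cp_time lam0 T 0<..cp_time lam0 T 1}. pr T t \<omega> = e} \<noteq> {}"
            by (metis card.empty)
          then obtain t where t: "t \<in> {cp_time lam0 T 0<..cp_time lam0 T 1}" "pr T t \<omega> = e" by blast
          then have "t \<in> {1..T}" using in_T[of 1 T t] by simp
          then show "\<omega> \<in> ?N" using \<omega> t(2) by (auto simp: X_def)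
        qed
        moreover have "({e} \<times> UNIV :: (('n \<times> 'n) \<times> bool) set) \<inter> {x. fst x \<in> set_pmf q} = {}" using nq by auto
        note null_Un[OF this, of T]
        ultimately show ?thesis
          using finite_measure_mono[of ?ev ?N] by (simp add: measure_le_0_iff)
      qed
      with lim have "(\<lambda>T::nat. 0::real) \<longlonglongrightarrow> 1" by (simp only:)
      then show False by (simp add: LIMSEQ_const_iff)
    qed
  qed
  interpret care_change_points z E q K0 lam0 \<xi>0 \<epsilon>
  proof
    show "connected_graph E" "assumption2 z" "E \<noteq> {}" "\<epsilon> > 0" by (fact assms E_ne)+
    show "pmf q e > 0" if "e \<in> E" for e using q_E that by (auto simp: pmf_positive)
    show "lam0 0 = 0" "lam0 (Suc K0) = 1" using assms(4) by (auto simp: ps_care_def)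
    show "\<epsilon> < lam0 k - lam0 (k - 1)" if "k \<in> {1..Suc K0}" for k using assms(9) that by simp
    show "\<xi>0 k \<in> Theta z" if "k \<in> {1..Suc K0}" for k using assms(4) that by (simp add: ps_care_def)
    show "\<xi>0 k \<noteq> \<xi>0 (Suc k)" if "k \<in> {1..K0}" for k using assms(4) that by (auto simp: ps_care_def)
  qed
  from excess_constant obtain \<kappa> where \<kappa>_pos: "\<kappa> > 0"
    and \<kappa>_ex: "\<forall>k\<in>{1..Suc K0}. \<forall>J Z r \<xi>. finite (J :: nat set) \<longrightarrow> (\<forall>t\<in>J. fst (Z t) \<in> E) \<longrightarrow>
      (\<forall>x. \<bar>\<Sum>t\<in>J. of_bool (Z t = x) - pmf (care_pmf z q (\<xi>0 k)) x\<bar> \<le> r) \<longrightarrow>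
      (\<Sum>t\<in>J. loss z (Z t) \<xi> - loss z (Z t) (\<xi>0 k))
        \<ge> real (card J) * \<kappa> * phi (dist0 k \<xi>) - 2 * r * dist0 k \<xi>"
    by (elim exE conjE)
  note \<kappa> = \<kappa>_pos \<kappa>_ex[THEN bspec, THEN spec, THEN spec, THEN spec, THEN spec, THEN mp, THEN mp, THEN mp]
  obtain B where B: "B \<ge> 0" "\<And>k l \<xi>. k \<in> {1..Suc K0} \<Longrightarrow> l \<in> {1..Suc K0} \<Longrightarrow> dist0 k \<xi> \<le> dist0 l \<xi> + B"
    using spread_constant by blast
  obtain \<delta> where \<delta>: "\<delta> > 0" "\<And>k \<xi>. k \<in> {1..K0} \<Longrightarrow> 2 * \<delta> \<le> dist0 k \<xi> + dist0 (Suc k) \<xi>"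
    using separation_constant by blast
  \<comment> \<open>Half of the slope that the drift can absorb, because \<open>good_bounds\<close>
    doubles it.\<close>
  define c where "c = \<kappa> * min \<delta> 1 / 2"
  have c: "c > 0" using \<kappa>(1) \<delta>(1) by (simp add: c_def)
  define r where "r T = sqrt (real T * sqrt (ln (real T)))" for T
  define a where "a T = sqrt (ln (real T))" for T
  define p where "p T x t = measure (P T) {\<omega> \<in> space (P T). X T t \<omega> = x}" for T x t
  \<comment> \<open>Independent of the tolerance, so one limit serves all
    \<open>\<eta>\<close>.\<close>
  define bad where "bad T = {\<omega> \<in> space (P T). \<exists>t\<in>{1..T}. X T t \<omega> \<in> {x. fst x \<notin> E}}
      \<union> (\<Union>x\<in>UNIV. {\<omega> \<in> space (P T). \<exists>s\<le>T. \<bar>dev (p T) (\<lambda>t. X T t \<omega>) x s\<bar> \<ge> r T})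
      \<union> (\<Union>(x, k)\<in>UNIV \<times> {1..K0}. {\<omega> \<in> space (P T). \<exists>s\<le>T. \<bar>dev (p T) (\<lambda>t. X T t \<omega>) x s - dev (p T) (\<lambda>t. X T t \<omega>) x (cp_time lam0 T k)\<bar>
          > c * \<bar>real s - real (cp_time lam0 T k)\<bar> + a T})" for T
  have good: "good T (\<lambda>t. X T t \<omega>) (p T) (r T) c (a T)" if "\<omega> \<in> space (P T) - bad T" for T \<omega>
  proof -
    have "\<omega> \<in> space (P T)" and 1: "\<omega> \<notin> {\<omega> \<in> space (P T). \<exists>t\<in>{1..T}. X T t \<omega> \<in> {x. fst x \<notin> E}}"
      and 2: "\<omega> \<notin> {\<omega> \<in> space (P T). \<exists>s\<le>T. \<bar>dev (p T) (\<lambda>t. X T t \<omega>) x s\<bar> \<ge> r T}"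
      and 3: "k \<in> {1..K0} \<Longrightarrow> \<omega> \<notin> {\<omega> \<in> space (P T). \<exists>s\<le>T. \<bar>dev (p T) (\<lambda>t. X T t \<omega>) x s - dev (p T) (\<lambda>t. X T t \<omega>) x (cp_time lam0 T k)\<bar>
          > c * \<bar>real s - real (cp_time lam0 T k)\<bar> + a T}" for x k
      using that unfolding bad_def by blast+
    show ?thesis
      unfolding good_def
    proof (intro conjI ballI allI impI)
      show "fst (X T t \<omega>) \<in> E" if "t \<in> {1..T}" for t
        using 1 that \<open>\<omega> \<in> space (P T)\<close> by blast
      show "\<bar>dev (p T) (\<lambda>t. X T t \<omega>) x s\<bar> \<le> r T" if "s \<le> T" for x s
        using 2[of x] that \<open>\<omega> \<in> space (P T)\<close> by (metis (mono_tags, lifting) mem_Collect_eq nle_le)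
      show "\<bar>dev (p T) (\<lambda>t. X T t \<omega>) x s - dev (p T) (\<lambda>t. X T t \<omega>) x (cp_time lam0 T k)\<bar>
          \<le> c * \<bar>real s - real (cp_time lam0 T k)\<bar> + a T" if "k \<in> {1..K0}" "s \<le> T" for x k s
        using 3[OF that(1), of x] that \<open>\<omega> \<in> space (P T)\<close> by (auto simp: not_less)
    qed
  qed
  define N where "N = real CARD(('n \<times> 'n) \<times> bool)"
  have bad_le: "bad T \<in> sets (P T)"
      "measure (P T) (bad T) \<le> N * (real T / (r T)\<^sup>2) + N * real K0 * (4 * exp (- 2 * c\<^sup>2 * a T) / (1 - exp (- 2 * c\<^sup>2)))"
    if T: "T \<ge> 2" for T
  proof -
    interpret prob_space "P T" by (rule P)
    \<comment> \<open>\<open>T \<ge> 2\<close> makes \<open>ln T\<close> positive.\<close>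
    have rT: "r T > 0" using T by (simp add: r_def)
    have aT: "a T \<ge> 0" using T by (simp add: a_def)
    have kT: "cp_time lam0 T k \<le> T" if "k \<in> {1..K0}" for k
      using tau_mono[of k "Suc K0" T] tauT[of T] that by auto
    have "{x. fst x \<notin> E} \<inter> {x. fst x \<in> set_pmf q} = ({} :: (('n \<times> 'n) \<times> bool) set)" using assms(3) by auto
    note b1 = null_Un[OF this, of T]
    let ?B2 = "\<lambda>x. {\<omega> \<in> space (P T). \<exists>s\<le>T. \<bar>dev (p T) (\<lambda>t. X T t \<omega>) x s\<bar> \<ge> r T}"
    let ?B3 = "\<lambda>(x, k). {\<omega> \<in> space (P T). \<exists>s\<le>T. \<bar>dev (p T) (\<lambda>t. X T t \<omega>) x s - dev (p T) (\<lambda>t. X T t \<omega>) x (cp_time lam0 T k)\<bar>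
          > c * \<bar>real s - real (cp_time lam0 T k)\<bar> + a T}"
    have b2: "?B2 x \<in> sets (P T)" "measure (P T) (?B2 x) \<le> real T / (r T)\<^sup>2" for x
      using dev_overall[where Z="X T" and n=T and p="p T" and r="r T" and x=x, OF indep p_def rT] by this
    have b3: "?B3 xk \<in> sets (P T)"
        "measure (P T) (?B3 xk) \<le> 4 * exp (- 2 * c\<^sup>2 * a T) / (1 - exp (- 2 * c\<^sup>2))"
      if xk: "xk \<in> UNIV \<times> {1..K0}" for xk
    proof -
      obtain x k where eq: "xk = (x, k)" by (cases xk)
      then have k: "k \<in> {1..K0}" using xk by simp
      note dev_near[where Z="X T" and n=T and p="p T" and x=x and k="cp_time lam0 T k" and c=c and a="a T",
        OF indep p_def kT[OF k] c aT]
      then show "?B3 xk \<in> sets (P T)"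
        "measure (P T) (?B3 xk) \<le> 4 * exp (- 2 * c\<^sup>2 * a T) / (1 - exp (- 2 * c\<^sup>2))"
        unfolding eq prod.case by this
    qed
    have e2: "(\<Union>x\<in>UNIV. ?B2 x) \<in> sets (P T)"
      by (intro sets.finite_UN b2(1)) simp
    have e3': "(\<Union>xk\<in>UNIV \<times> {1..K0}. ?B3 xk) \<in> sets (P T)"
      by (intro sets.finite_UN b3(1)) simp_all
    show "bad T \<in> sets (P T)"
      unfolding bad_def using b1(2) e2 e3' by (intro sets.Un)
    have "measure (P T) (bad T) \<le> measure (P T) {\<omega> \<in> space (P T). \<exists>t\<in>{1..T}. X T t \<omega> \<in> {x. fst x \<notin> E}}
        + measure (P T) (\<Union>x\<in>UNIV. ?B2 x) + measure (P T) (\<Union>xk\<in>UNIV \<times> {1..K0}. ?B3 xk)"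
      unfolding bad_def using b1(2) e2 e3'
      by (intro order_trans[OF measure_Un_le] add_mono sets.Un order_refl)
    also have "measure (P T) {\<omega> \<in> space (P T). \<exists>t\<in>{1..T}. X T t \<omega> \<in> {x. fst x \<notin> E}} = 0" by (rule b1(1))
    also have "measure (P T) (\<Union>x\<in>UNIV. ?B2 x) \<le> (\<Sum>x\<in>UNIV. measure (P T) (?B2 x))"
      by (intro finite_measure_subadditive_finite image_subsetI b2(1)) simp
    also have "\<dots> \<le> (\<Sum>x\<in>(UNIV :: (('n \<times> 'n) \<times> bool) set). real T / (r T)\<^sup>2)"
      by (intro sum_mono b2(2))
    also have "\<dots> = N * (real T / (r T)\<^sup>2)" by (simp add: N_def)
    also have "measure (P T) (\<Union>xk\<in>UNIV \<times> {1..K0}. ?B3 xk) \<le> (\<Sum>xk\<in>UNIV \<times> {1..K0}. measure (P T) (?B3 xk))"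
      by (intro finite_measure_subadditive_finite image_subsetI b3(1)) simp_all
    also have "\<dots> \<le> (\<Sum>xk\<in>(UNIV :: (('n \<times> 'n) \<times> bool) set) \<times> {1..K0}. 4 * exp (- 2 * c\<^sup>2 * a T) / (1 - exp (- 2 * c\<^sup>2)))"
      by (intro sum_mono b3(2))
    also have "\<dots> = N * real K0 * (4 * exp (- 2 * c\<^sup>2 * a T) / (1 - exp (- 2 * c\<^sup>2)))"
      by (simp add: N_def card_cartesian_product)
    finally show "measure (P T) (bad T) \<le> N * (real T / (r T)\<^sup>2) + N * real K0 * (4 * exp (- 2 * c\<^sup>2 * a T) / (1 - exp (- 2 * c\<^sup>2)))"
      by simp
  qed
  have bad_lim: "(\<lambda>T. measure (P T) (bad T)) \<longlonglongrightarrow> 0"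
  proof (rule tendsto_sandwich[where f="\<lambda>_. 0"])
    have 1: "(\<lambda>T. real T / (r T)\<^sup>2) \<longlonglongrightarrow> 0"
      unfolding r_def by real_asymp
    have 2: "(\<lambda>T. exp (- 2 * c\<^sup>2 * a T)) \<longlonglongrightarrow> 0"
    proof -
      have "c\<^sup>2 > 0" using c by simp
      then show ?thesis unfolding a_def by real_asymp
    qed
    have "(\<lambda>T. N * (real T / (r T)\<^sup>2) + N * real K0 * 4 / (1 - exp (- 2 * c\<^sup>2)) * exp (- 2 * c\<^sup>2 * a T)) \<longlonglongrightarrow> 0"
      by (intro tendsto_add_zero tendsto_mult_right_zero 1 2)
    then show "(\<lambda>T. N * (real T / (r T)\<^sup>2) + N * real K0 * (4 * exp (- 2 * c\<^sup>2 * a T) / (1 - exp (- 2 * c\<^sup>2)))) \<longlonglongrightarrow> 0"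
      by (simp add: mult.assoc)
    show "\<forall>\<^sub>F T in sequentially. measure (P T) (bad T)
        \<le> N * (real T / (r T)\<^sup>2) + N * real K0 * (4 * exp (- 2 * c\<^sup>2 * a T) / (1 - exp (- 2 * c\<^sup>2)))"
      using bad_le(2) by (intro eventually_sequentiallyI[of 2])
  qed auto
  have main: "\<forall>\<^sub>F T in sequentially. \<forall>\<omega>\<in>space (P T) - bad T.
      Kh T \<omega> = K0 \<and> (\<forall>k\<in>{1..K0}. \<bar>lamh T \<omega> k - lam0 k\<bar> \<le> \<eta>)" if \<eta>: "\<eta> > 0" for \<eta>
  proof -
    \<comment> \<open>The first bound keeps true change points apart and fitted segments long, the
      second turns the accuracy \<open>2 * \<rho>\<close> into \<open>\<eta>\<close>.\<close>
    define \<rho> where "\<rho> = min (\<epsilon> / 4) (\<eta> / 2)"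
    have \<rho>: "\<rho> > 0" "\<rho> \<le> \<epsilon> / 4" "2 * \<rho> \<le> \<eta>" using \<eta> assms(8) by (auto simp: \<rho>_def)
    define A where "A = \<rho> * \<kappa> * min \<delta> 1"
    have A: "A > 0" "A * \<delta> / 2 > 0" using \<rho>(1) \<kappa>(1) \<delta>(1) by (simp_all add: A_def)
    define S where "S = real (Suc K0)"
    define M where "M = nat \<lceil>1 / \<epsilon>\<rceil> + 1"
    define D where "D = (real CARD('n) + real CARD('d) - 1) / 2"
    define c2 where "c2 = log 2 (exp 1)"
    have c2: "c2 > 0" by (simp add: c2_def log_def)
    have "\<forall>\<^sub>F T in sequentially. T \<ge> 2 \<and> \<epsilon> * T \<ge> 2 \<and> \<rho> * T \<ge> 1 \<and>
        2 * (S * (4 * r T)) \<le> A * T \<and> S * (4 * r T) * B \<le> A * \<delta> / 2 * T \<and>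
        c2 * (real (Suc M) * (S * (4 * r T) * (1 + B))) + ln (real (K0 + 1)) + real (K0 + 1) * (1 + D) * ln (real T) < c2 * (A * \<delta> / 2 * T) \<and>
        c2 * (real (Suc M) * (S * ((4 * r T)\<^sup>2 / (4 * (\<rho> * \<kappa> * T)) + 2 * a T * (B + \<delta>))))
          + ln (real (K0 + 1)) + real (Suc M) * D * \<bar>ln (2 * \<rho>)\<bar> < ln (real T)"
    proof (intro eventually_conj)
      show ge2: "\<forall>\<^sub>F T in sequentially. (2::nat) \<le> T" by (rule eventually_ge_at_top)
      show "\<forall>\<^sub>F T in sequentially. 2 \<le> \<epsilon> * real T" using assms(8) by real_asymp
      show "\<forall>\<^sub>F T in sequentially. 1 \<le> \<rho> * real T" using \<rho>(1) by real_asymp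
      show "\<forall>\<^sub>F T in sequentially. 2 * (S * (4 * r T)) \<le> A * real T"
        using eventually_sublinear[OF A(1), of "8 * S" 0 0] by eventually_elim (simp add: r_def)
      show "\<forall>\<^sub>F T in sequentially. S * (4 * r T) * B \<le> A * \<delta> / 2 * real T"
        using eventually_sublinear[OF A(2), of "S * 4 * B" 0 0] by eventually_elim (simp add: r_def mult_ac)
      have "c2 * (A * \<delta> / 2) > 0" using c2 A(2) by simp
      from eventually_sublinear[OF this, of "c2 * (real (Suc M) * (S * 4 * (1 + B)))" "real (K0 + 1) * (1 + D)" "ln (real (K0 + 1))"]
      show "\<forall>\<^sub>F T in sequentially. c2 * (real (Suc M) * (S * (4 * r T) * (1 + B))) + ln (real (K0 + 1))
          + real (K0 + 1) * (1 + D) * ln (real T) < c2 * (A * \<delta> / 2 * real T)"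
        by eventually_elim (simp add: r_def algebra_simps)
      show "\<forall>\<^sub>F T in sequentially. c2 * (real (Suc M) * (S * ((4 * r T)\<^sup>2 / (4 * (\<rho> * \<kappa> * real T)) + 2 * a T * (B + \<delta>))))
          + ln (real (K0 + 1)) + real (Suc M) * D * \<bar>ln (2 * \<rho>)\<bar> < ln (real T)"
        using ge2 eventually_sublog[of "c2 * (real (Suc M) * (S * (4 / (\<rho> * \<kappa>) + 2 * (B + \<delta>))))"
            "ln (real (K0 + 1)) + real (Suc M) * D * \<bar>ln (2 * \<rho>)\<bar>"]
      proof eventually_elim
        case (elim T)
        \<comment> \<open>This identity makes the completed square, with \<open>R = 4 * r T\<close>,
          a multiple of \<open>a T = sqrt (ln T)\<close>, just like the noise of the short
          pieces.\<close>
        have "(r T)\<^sup>2 = real T * a T" using elim(1) by (simp add: r_def a_def)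
        then have "(4 * r T)\<^sup>2 / (4 * (\<rho> * \<kappa> * real T)) = 4 / (\<rho> * \<kappa>) * a T"
          using elim(1) \<rho>(1) \<kappa>(1) by (simp add: power_mult_distrib field_simps)
        then have "(4 * r T)\<^sup>2 / (4 * (\<rho> * \<kappa> * real T)) + 2 * a T * (B + \<delta>) = (4 / (\<rho> * \<kappa>) + 2 * (B + \<delta>)) * a T"
          by (simp add: algebra_simps)
        then show ?case using elim(2) by (simp add: a_def mult.assoc add.assoc)
      qed
    qed
    then show ?thesis
    proof eventually_elim
      case (elim T)
      show ?case
      proof
        fix \<omega> assume \<omega>: "\<omega> \<in> space (P T) - bad T"
        let ?Z = "\<lambda>t. X T t \<omega>"
        have cpb: "change_point_bounds T K0 (cp_time lam0 T) (excess ?Z) dist0 \<kappa> B \<delta> (4 * r T) (2 * c) (2 * a T) \<rho>"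
        proof (rule good_bounds[OF good[OF \<omega>] _ \<kappa> B \<delta>])
          fix k t x assume k: "k \<in> {1..Suc K0}" "cp_time lam0 T (k - 1) < t" "t \<le> cp_time lam0 T k"
          show "p T x t = pmf (care_pmf z q (\<xi>0 k)) x"
            using X_prob[OF k, of "{x}"] by (simp add: p_def measure_pmf_single)
        qed (use elim \<rho> in \<open>auto simp: c_def a_def r_def A_def S_def\<close>)
        have "care_good z E q K0 lam0 \<xi>0 \<epsilon> T ?Z \<kappa> B \<delta> (4 * r T) (2 * c) (2 * a T) \<rho>"
          using cpb elim \<rho> care_change_points_axioms by (intro care_good.intro care_good_axioms.intro) auto
        then interpret cg: care_good z E q K0 lam0 \<xi>0 \<epsilon> T ?Z \<kappa> B \<delta> "4 * r T" "2 * c" "2 * a T" \<rho> .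
        have Zeq: "X T t \<omega> = (pr T t \<omega>, y T t \<omega>)" for t by (simp add: X_def)
        \<comment> \<open>The estimator is constrained only where a minimizer exists, so existence
          has to be established outside \<open>bad\<close> first.\<close>
        have "mdl_minimizer z \<epsilon> T (\<lambda>t. pr T t \<omega>) (\<lambda>t. y T t \<omega>) (Kh T \<omega>, lamh T \<omega>, \<xi>h T \<omega>)"
          using cg.exists_minimizer[OF Zeq] assms(10) \<omega> unfolding mdl_estimator_def by blast
        note close = cg.minimizer_close[OF Zeq this]
        have "Kh T \<omega> = K0"
          using elim by (intro close(1)) (simp_all only: A_def S_def M_def D_def c2_def)
        moreover have "\<bar>lamh T \<omega> k - lam0 k\<bar> \<le> 2 * \<rho>" if "k \<in> {1..K0}" for k
          using elim that by (intro close(2)) (simp_all only: A_def S_def M_def D_def c2_def)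
        ultimately show "Kh T \<omega> = K0 \<and> (\<forall>k\<in>{1..K0}. \<bar>lamh T \<omega> k - lam0 k\<bar> \<le> \<eta>)"
          using \<rho>(3) by force
      qed
    qed
  qed
  have conv: "(\<lambda>T. measure (P T) (Q T)) \<longlonglongrightarrow> 0" if "\<forall>\<^sub>F T in sequentially. Q T \<subseteq> bad T" for Q
  proof (rule tendsto_sandwich[OF _ _ tendsto_const bad_lim])
    show "\<forall>\<^sub>F T in sequentially. measure (P T) (Q T) \<le> measure (P T) (bad T)"
      using that eventually_ge_at_top[of 2]
    proof eventually_elim
      case (elim T)
      interpret prob_space "P T" by (rule P)
      show ?case using elim bad_le(1)[of T] by (intro finite_measure_mono) auto
    qed
  qed simp
  show ?thesis
    unfolding tendsto_in_prob_def cp_tendsto_in_prob_def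
  proof (intro conjI allI impI)
    fix d :: real assume d: "d > 0"
    show "(\<lambda>T. measure (P T) {\<omega> \<in> space (P T). dist (real (Kh T \<omega>)) (real K0) > d}) \<longlonglongrightarrow> 0"
    proof (rule conv)
      show "\<forall>\<^sub>F T in sequentially. {\<omega> \<in> space (P T). dist (real (Kh T \<omega>)) (real K0) > d} \<subseteq> bad T"
        using main[OF d] by eventually_elim (use d in force)
    qed
    show "(\<lambda>T. measure (P T) {\<omega> \<in> space (P T). Kh T \<omega> \<noteq> K0 \<or> L2_set (\<lambda>k. lamh T \<omega> k - lam0 k) {1..K0} > d}) \<longlonglongrightarrow> 0"
    proof (rule conv)
      \<comment> \<open>The Euclidean norm is at most the sum of \<open>K0\<close> coordinates; the
        \<open>+ 1\<close> avoids division by zero when there is no change point.\<close>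
      let ?\<eta> = "d / (real K0 + 1)"
      have "?\<eta> > 0" using d by simp
      from main[OF this]
      show "\<forall>\<^sub>F T in sequentially. {\<omega> \<in> space (P T). Kh T \<omega> \<noteq> K0 \<or> L2_set (\<lambda>k. lamh T \<omega> k - lam0 k) {1..K0} > d} \<subseteq> bad T"
      proof eventually_elim
        case (elim T)
        have "L2_set (\<lambda>k. lamh T \<omega> k - lam0 k) {1..K0} \<le> d" if "\<omega> \<in> space (P T) - bad T" for \<omega>
        proof -
          have "L2_set (\<lambda>k. lamh T \<omega> k - lam0 k) {1..K0} \<le> (\<Sum>k\<in>{1..K0}. \<bar>lamh T \<omega> k - lam0 k\<bar>)"
            by (rule L2_set_le_sum_abs)
          also have "\<dots> \<le> (\<Sum>k\<in>{1..K0}. ?\<eta>)" using elim that by (intro sum_mono) blast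
          also have "\<dots> \<le> d" using d by (simp add: field_simps)
          finally show ?thesis .
        qed
        then show ?case using elim by (force simp: not_le[symmetric])
      qed
    qed
  qed
qed

end
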